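(* Let $u_0,u_1,u_2,\dots$ be noncommuting indeterminates, $u_i$ of bidegree $(1,i)$, and let $\mathbb Q\langle\langle u_0,u_1,\dots\rangle\rangle$ (resp. $\mathbb Q\langle\langle u_0,u_1\rangle\rangle$) be the completion of the free associative $\mathbb Q$-algebra, i.e. formal sums of noncommutative monomials in which each bidegree occurs as a finite sum, and let $\mathbb Q\{\{u_0,u_1,\dots\}\}$ (resp. $\mathbb Q\{\{u_0,u_1\}\}$) be the completion of the free Lie algebra, i.e. those formal sums whose homogeneous components lie in the Lie subalgebra generated by the $u_i$ under the commutator $[f,g]=fg-gf$. Then: (a) the algebra $V_{\mathrm M}$ of $\mathbb Q$-valued valuative matroid invariants is isomorphic, as a bigraded associative algebra, to $\mathbb Q\langle\langle u_0,u_1\rangle\rangle$; (b) the algebra $V_{\mathrm{PM}}$ of $\mathbb Q$-valued valuative polymatroid invariants is isomorphic to $\mathbb Q\langle\langle u_0,u_1,u_2,\dots\rangle\rangle$; (c) the space of $\mathbb Q$-valued additive matroid invariants is isomorphic to $\mathbb Q\{\{u_0,u_1\}\}$; (d) the space of $\mathbb Q$-valued additive polymatroid invariants is isomorphic to $\mathbb Q\{\{u_0,u_1,u_2,\dots\}\}$. Here the isomorphisms in (a), (b) send the indeterminate $u_i$ to the invariant $u_i$ described in the context, and (c), (d) are the images of the additive invariants under these isomorphisms.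
   Context: Write $[d]=\{1,\dots,d\}$. Polymatroids on a finite set $X$: functions $\mathrm{rk}:2^X\to\{0,1,\dots\}$ with $\mathrm{rk}(\emptyset)=0$, monotone and submodular; matroids additionally satisfy $\mathrm{rk}(\{i\})\le1$. The base polytope of $\mathrm{rk}$ on $[d]$ is $Q(\mathrm{rk})=\{y\in\mathbb R^d:\sum_iy_i=\mathrm{rk}([d]),\sum_{i\in A}y_i\le\mathrm{rk}(A)\ \forall A\}$, $[\Pi]$ is the indicator function of $\Pi$, $P_{\mathrm{(P)M}}(d,r)$ is the $\mathbb Z$-module generated by $[Q(\mathrm{rk})]$ over (poly)matroids on $[d]$ of rank $r$, and $P^{\mathrm{sym}}_{\mathrm{(P)M}}(d,r)$ its quotient by the span of all $[Q(\mathrm{rk})]-[Q(\mathrm{rk}\circ\sigma)]$ ($\sigma$ a permutation of $[d]$, $(\mathrm{rk}\circ\sigma)(A)=\mathrm{rk}(\sigma(A))$). A $\mathbb Q$-valued valuative invariant of bidegree $(d,r)$ is a function $f$ on (poly)matroids on $[d]$ of rank $r$ of the form $f(\mathrm{rk})=\hat f([Q(\mathrm{rk})])$ for a homomorphism $\hat f:P^{\mathrm{sym}}_{\mathrm{(P)M}}(d,r)\to\mathbb Q$ (composed with the quotient); it extends to (poly)matroids on any $d$-element set via any bijection with $[d]$. $V_{\mathrm{(P)M}}=\prod_{d,r}\mathrm{Hom}(P^{\mathrm{sym}}_{\mathrm{(P)M}}(d,r),\mathbb Q)$, bigraded by $(d,r)$. For $\mathrm{rk}$ on $X$ and $A\subseteq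 X$ let $\mathrm{rk}|_A$ be the restriction to $A$ and $\mathrm{rk}_{/A}(C)=\mathrm{rk}(A\cup C)-\mathrm{rk}(A)$ for $C\subseteq X\setminus A$. The product on $V_{\mathrm{(P)M}}$: for $f$ of bidegree $(d,r)$ and $g$ of bidegree $(e,s)$, $fg$ has bidegree $(d+e,r+s)$ and $(fg)(\mathrm{rk})=\sum_{A\subseteq[d+e],\,|A|=d,\,\mathrm{rk}(A)=r}f(\mathrm{rk}|_A)g(\mathrm{rk}_{/A})$, extended to infinite sums by bilinearity (this is the product dual to the coproduct $\Delta([Q(\mathrm{rk})])=\sum_{A}[Q(\mathrm{rk}|_A)]\otimes[Q(\mathrm{rk}_{/A})]$, and the paper shows it is well defined on valuative invariants); the unit is the invariant of bidegree $(0,0)$ with value $1$. For $i\ge0$, $u_i$ is the invariant of bidegree $(1,i)$ taking the value $1$ on the unique polymatroid on $[1]$ of rank $i$ (for matroids only $i\in\{0,1\}$ occur). An additive invariant is an element of $V_{\mathrm{(P)M}}$ whose component of bidegree $(d,r)$ vanishes on all $[Q(\mathrm{rk})]$ with $\dim Q(\mathrm{rk})<d-1$ and whose $(0,0)$ component is $0$. *)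

theory Defs
  imports
    Complex_Main
    "HOL-Library.FuncSet"
    "HOL-Library.Indicator_Function"
    "HOL-Library.Function_Algebras"
    "HOL-Combinatorics.Permutations"
    "HOL-Algebra.Elementary_Groups"
    "HOL-Algebra.QuotRing"
begin

type_synonym rank_fun = "nat set \<Rightarrow> nat"

text \<open>A rank function on \<open>X\<close> is a function on the power set of \<open>X\<close>; extensionality makes equality
  of rank functions equality on \<open>Pow X\<close>.\<close>

definition polymatroid :: "nat set \<Rightarrow> rank_fun \<Rightarrow> bool" where
  "polymatroid X rk \<longleftrightarrow> finite X \<and> rk \<in> extensional (Pow X) \<and> rk {} = 0 \<and>
     (\<forall>A B. A \<subseteq> B \<and> B \<subseteq> X \<longrightarrow> rk A \<le> rk B) \<and>
     (\<forall>A B. A \<subseteq> X \<and> B \<subseteq> X \<longrightarrow> rk (A \<union> B) + rk (A \<inter> B) \<le> rk A + rk B)"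

definition matroid :: "nat set \<Rightarrow> rank_fun \<Rightarrow> bool" where
  "matroid X rk \<longleftrightarrow> polymatroid X rk \<and> (\<forall>i\<in>X. rk {i} \<le> 1)"

text \<open>Everything below is developed once, for a class \<open>K\<close> of rank functions; it is used
  with \<open>K = matroid\<close> and \<open>K = polymatroid\<close> only.\<close>

type_synonym rank_class = "nat set \<Rightarrow> rank_fun \<Rightarrow> bool"

definition of_bidegree :: "rank_class \<Rightarrow> nat \<Rightarrow> nat \<Rightarrow> rank_fun set" where
  "of_bidegree K d r = {rk. K {1..d} rk \<and> rk {1..d} = r}"

definition restriction :: "rank_fun \<Rightarrow> nat set \<Rightarrow> rank_fun" where
  "restriction rk A = restrict rk (Pow A)"

definition contraction :: "nat set \<Rightarrow> rank_fun \<Rightarrow> nat set \<Rightarrow> rank_fun" where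
  "contraction X rk A = restrict (\<lambda>C. rk (A \<union> C) - rk A) (Pow (X - A))"

text \<open>Vectors of \<open>\<real>\<^sup>d\<close> are the functions \<open>nat \<Rightarrow> real\<close> vanishing outside \<open>{1..d}\<close>.\<close>

definition base_polytope :: "nat \<Rightarrow> rank_fun \<Rightarrow> (nat \<Rightarrow> real) set" where
  "base_polytope d rk =
     {y. (\<forall>i. i \<notin> {1..d} \<longrightarrow> y i = 0) \<and>
         (\<Sum>i\<in>{1..d}. y i) = real (rk {1..d}) \<and>
         (\<forall>A\<subseteq>{1..d}. (\<Sum>i\<in>A. y i) \<le> real (rk A))}"

text \<open>The dimension of a nonempty set, i.e. of its affine hull: the linear dimension of the span
  of its differences. (Base polytopes of polymatroids are nonempty.)\<close>

definition affine_dimension :: "(nat \<Rightarrow> real) set \<Rightarrow> nat" where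
  "affine_dimension S =
     vector_space.dim (\<lambda>(c::real) (y::nat \<Rightarrow> real) i. c * y i) {x - y | x y. x \<in> S \<and> y \<in> S}"

definition additive_group :: "'a::ab_group_add monoid" where
  "additive_group = \<lparr>carrier = UNIV, mult = (+), one = 0\<rparr>"

definition base_indicator :: "nat \<Rightarrow> rank_fun \<Rightarrow> (nat \<Rightarrow> real) \<Rightarrow> int" where
  "base_indicator d rk = indicator (base_polytope d rk)"

definition P_group :: "rank_class \<Rightarrow> nat \<Rightarrow> nat \<Rightarrow> ((nat \<Rightarrow> real) \<Rightarrow> int) monoid" where
  "P_group K d r = subgroup_generated additive_group (base_indicator d ` of_bidegree K d r)"

definition sym_relations :: "rank_class \<Rightarrow> nat \<Rightarrow> nat \<Rightarrow> ((nat \<Rightarrow> real) \<Rightarrow> int) set" where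
  "sym_relations K d r =
     generate additive_group
       {base_indicator d rk - base_indicator d (\<lambda>A. rk (\<sigma> ` A)) | rk \<sigma>.
          rk \<in> of_bidegree K d r \<and> \<sigma> permutes {1..d}}"

definition P_sym_group :: "rank_class \<Rightarrow> nat \<Rightarrow> nat \<Rightarrow> ((nat \<Rightarrow> real) \<Rightarrow> int) set monoid" where
  "P_sym_group K d r = P_group K d r Mod sym_relations K d r"

definition P_sym_class :: "rank_class \<Rightarrow> nat \<Rightarrow> nat \<Rightarrow> rank_fun \<Rightarrow> ((nat \<Rightarrow> real) \<Rightarrow> int) set" where
  "P_sym_class K d r rk = sym_relations K d r #>\<^bsub>P_group K d r\<^esub> base_indicator d rk"

text \<open>A homomorphism on the symmetrized group is determined by its values on the classes of base
  polytopes, so it is represented by the function of rank functions it induces, normalized to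
  vanish off the rank functions of the given bidegree.\<close>

definition valuative_invariants :: "rank_class \<Rightarrow> nat \<Rightarrow> nat \<Rightarrow> (rank_fun \<Rightarrow> rat) set" where
  "valuative_invariants K d r =
     {f. (\<exists>h\<in>hom (P_sym_group K d r) additive_group.
            \<forall>rk\<in>of_bidegree K d r. f rk = h (P_sym_class K d r rk)) \<and>
         (\<forall>rk. rk \<notin> of_bidegree K d r \<longrightarrow> f rk = 0)}"

type_synonym invariant_family = "nat \<Rightarrow> nat \<Rightarrow> rank_fun \<Rightarrow> rat"

text \<open>The value, on a rank function on the \<open>d\<close>-element set \<open>X\<close>, of an invariant given
  on \<open>{1..d}\<close>; for valuative invariants it does not depend on the chosen bijection.\<close>

definition value_on :: "nat \<Rightarrow> (rank_fun \<Rightarrow> rat) \<Rightarrow> nat set \<Rightarrow> rank_fun \<Rightarrow> rat" where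
  "value_on d f X rk =
     f (restrict (\<lambda>S. rk ((SOME \<beta>. bij_betw \<beta> {1..d} X) ` S)) (Pow {1..d}))"

definition homogeneous_product ::
  "rank_class \<Rightarrow> nat \<Rightarrow> nat \<Rightarrow> nat \<Rightarrow> nat \<Rightarrow> (rank_fun \<Rightarrow> rat) \<Rightarrow> (rank_fun \<Rightarrow> rat) \<Rightarrow> rank_fun \<Rightarrow> rat"
where
  "homogeneous_product K d r e s f g rk =
     (if rk \<in> of_bidegree K (d + e) (r + s) then
        (\<Sum>A | A \<subseteq> {1..d+e} \<and> card A = d \<and> rk A = r.
           value_on d f A (restriction rk A) *
           value_on e g ({1..d+e} - A) (contraction {1..d+e} rk A))
      else 0)"

definition invariant_product ::
  "rank_class \<Rightarrow> invariant_family \<Rightarrow> invariant_family \<Rightarrow> invariant_family"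
where
  "invariant_product K F G = (\<lambda>n t rk.
     \<Sum>d\<le>n. \<Sum>r\<le>t. homogeneous_product K d r (n - d) (t - r) (F d r) (G (n - d) (t - r)) rk)"

definition invariant_unit :: "rank_class \<Rightarrow> invariant_family" where
  "invariant_unit K = (\<lambda>d r rk. if d = 0 \<and> r = 0 \<and> rk \<in> of_bidegree K 0 0 then 1 else 0)"

definition invariant_algebra :: "rank_class \<Rightarrow> invariant_family ring" where
  "invariant_algebra K =
     \<lparr>carrier = {F. \<forall>d r. F d r \<in> valuative_invariants K d r},
      mult = invariant_product K, one = invariant_unit K, zero = 0, add = (+)\<rparr>"

definition invariant_scale :: "rat \<Rightarrow> invariant_family \<Rightarrow> invariant_family" where
  "invariant_scale c F = (\<lambda>d r rk. c * F d r rk)"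

definition invariant_component :: "nat \<Rightarrow> nat \<Rightarrow> invariant_family \<Rightarrow> invariant_family" where
  "invariant_component d r F = (\<lambda>d' r'. if d' = d \<and> r' = r then F d r else 0)"

definition u_invariant :: "rank_class \<Rightarrow> nat \<Rightarrow> invariant_family" where
  "u_invariant K i = (\<lambda>d r rk. if d = 1 \<and> r = i \<and> rk \<in> of_bidegree K 1 i then 1 else 0)"

definition additive_invariants :: "rank_class \<Rightarrow> invariant_family set" where
  "additive_invariants K =
     {F \<in> carrier (invariant_algebra K).
        (\<forall>d r. \<forall>rk\<in>of_bidegree K d r.
           int (affine_dimension (base_polytope d rk)) < int d - 1 \<longrightarrow> F d r rk = 0) \<and>
        F 0 0 = 0}"

text \<open>The word \<open>[i\<^sub>1, \<dots>, i\<^sub>d]\<close> stands for the monomial in the indeterminates with these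
  indices, and a series is its coefficient function. The bidegree of a word \<open>w\<close> is
  \<open>(length w, sum_list w)\<close>. The set \<open>J\<close> is the set of indices of the available indeterminates.\<close>

type_synonym nc_series = "nat list \<Rightarrow> rat"

definition nc_product :: "nc_series \<Rightarrow> nc_series \<Rightarrow> nc_series" where
  "nc_product a b = (\<lambda>w. \<Sum>k\<le>length w. a (take k w) * b (drop k w))"

definition nc_monomial :: "nat list \<Rightarrow> nc_series" where
  "nc_monomial w = (\<lambda>v. if v = w then 1 else 0)"

definition nc_algebra :: "nat set \<Rightarrow> nc_series ring" where
  "nc_algebra J =
     \<lparr>carrier = {a. (\<forall>w. a w \<noteq> 0 \<longrightarrow> set w \<subseteq> J) \<and>
                    (\<forall>d r. finite {w. a w \<noteq> 0 \<and> length w = d \<and> sum_list w = r})},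
      mult = nc_product, one = nc_monomial [], zero = 0, add = (+)\<rparr>"

definition nc_scale :: "rat \<Rightarrow> nc_series \<Rightarrow> nc_series" where
  "nc_scale c a = (\<lambda>w. c * a w)"

definition nc_component :: "nat \<Rightarrow> nat \<Rightarrow> nc_series \<Rightarrow> nc_series" where
  "nc_component d r a = (\<lambda>w. if length w = d \<and> sum_list w = r then a w else 0)"

inductive_set lie_polynomials :: "nat set \<Rightarrow> nc_series set" for J where
  zero: "0 \<in> lie_polynomials J"
| gen: "i \<in> J \<Longrightarrow> nc_monomial [i] \<in> lie_polynomials J"
| add: "a \<in> lie_polynomials J \<Longrightarrow> b \<in> lie_polynomials J \<Longrightarrow> a + b \<in> lie_polynomials J"
| scale: "a \<in> lie_polynomials J \<Longrightarrow> nc_scale c a \<in> lie_polynomials J"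
| bracket: "a \<in> lie_polynomials J \<Longrightarrow> b \<in> lie_polynomials J \<Longrightarrow>
    nc_product a b - nc_product b a \<in> lie_polynomials J"

definition lie_series :: "nat set \<Rightarrow> nc_series set" where
  "lie_series J = {a \<in> carrier (nc_algebra J). \<forall>d r. nc_component d r a \<in> lie_polynomials J}"

text \<open>Both algebras are products, not direct sums, of their homogeneous parts; compatibility with
  the bigrading means that the map commutes with the projections to these parts.\<close>

definition bigraded_algebra_iso ::
  "rank_class \<Rightarrow> nat set \<Rightarrow> (invariant_family \<Rightarrow> nc_series) \<Rightarrow> bool"
where
  "bigraded_algebra_iso K J \<Phi> \<longleftrightarrow>
     \<Phi> \<in> ring_iso (invariant_algebra K) (nc_algebra J) \<and>
     (\<forall>c. \<forall>F\<in>carrier (invariant_algebra K). \<Phi> (invariant_scale c F) = nc_scale c (\<Phi> F)) \<and>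
     (\<forall>d r. \<forall>F\<in>carrier (invariant_algebra K).
        \<Phi> (invariant_component d r F) = nc_component d r (\<Phi> F))"

end

theory Submission
  imports
    Defs
    "HOL-Analysis.Analysis"
    "HOL-Combinatorics.Multiset_Permutations"
begin

text \<open>
  A series \<open>a\<close> is sent to the invariant which sums \<open>a\<close> over the words of rank jumps along all
  complete flags. Concatenation of words is concatenation of flags, so this is multiplicative.
  It is valuative because a base polytope meets a set cut out by lower bounds along a flag iff these
  bounds are at most the ranks, and because nonemptiness (the Euler characteristic) is a
  valuation on compact convex sets.
  It is injective by evaluation on the rank functions of full chains (Schubert polymatroids), which is
  triangular for the dominance order. It is surjective because the indicator function of a
  base polytope is an alternating sum, over all chains of sets, of indicator functions of
  polytopes that depend only on the ranks along the chain; averaging over the symmetric group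
  then writes every valuative invariant as a sum over complete flags.

  The dimension of a base polytope drops iff the rank function is a direct sum, and the
  flags of a direct sum are the shuffles of flags of the summands. Hence additive invariants
  correspond to the series that vanish on all proper shuffles, and these are the Lie series by
  Ree's theorem.
\<close>

text \<open>The isomorphism is built in the direction from series to invariants, where it is an
  explicit sum, and inverted at the end; products of invariants are then only ever computed for flag
  sums. Matroids and polymatroids are treated at once: membership in the class means that the ranks
  of singletons lie in an initial segment of the naturals, a condition that survives restriction,
  contraction, relabelling and direct sums. The obstacle is that the cones attached to chains are
  unbounded, hence no base polytopes. Cutting them with a cube [0, m]^d, where m is an allowed rank
  of a singleton, makes each piece the base polytope of a member of the same class with the same
  total rank, so that an arbitrary valuative invariant can be evaluated on it. Conversely, the
  pieces of this kind that belong to complete chains are the Schubert polymatroids that give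
  injectivity. Division in the coefficient field is used twice: by d! when averaging over the
  symmetric group, and by the degree when a primitive series is recovered from its image under the
  Dynkin operator.\<close>

section \<open>Shuffles and Lie series\<close>

text \<open>The coefficient of \<open>u \<otimes> v\<close> in the unshuffling coproduct of \<open>a\<close>: the sum of \<open>a\<close> over all
  shuffles of \<open>u\<close> and \<open>v\<close>, with multiplicity.\<close>

fun shuffle_sum :: "('a list \<Rightarrow> 'b::comm_monoid_add) \<Rightarrow> 'a list \<Rightarrow> 'a list \<Rightarrow> 'b" where
  "shuffle_sum a [] v = a v"
| "shuffle_sum a u [] = a u"
| "shuffle_sum a (x # u) (y # v) = shuffle_sum (\<lambda>w. a (x # w)) u (y # v) + shuffle_sum (\<lambda>w. a (y # w)) (x # u) v"

lemma shuffle_sum_Nil2 [simp]: "shuffle_sum a u [] = a u"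
  by (cases u) auto

text \<open>Every shuffle is a rearrangement of the concatenation, so only words with that multiset
  of letters are consulted. Length, sum and alphabet of words enter later arguments through
  this.\<close>

lemma shuffle_sum_cong: "(\<And>w. mset w = mset u + mset v \<Longrightarrow> a w = b w) \<Longrightarrow> shuffle_sum a u v = shuffle_sum b u v"
proof (induction a u v arbitrary: b rule: shuffle_sum.induct)
  case (3 a x u y v)
  have "shuffle_sum (\<lambda>w. a (x # w)) u (y # v) = shuffle_sum (\<lambda>w. b (x # w)) u (y # v)"
    by (rule 3(1)) (simp add: 3(3))
  moreover have "shuffle_sum (\<lambda>w. a (y # w)) (x # u) v = shuffle_sum (\<lambda>w. b (y # w)) (x # u) v"
    by (rule 3(2)) (simp add: 3(3))
  ultimately show ?case by simp
qed auto

lemma shuffle_sum_zero [simp]: "shuffle_sum (\<lambda>w. 0) u v = 0"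
proof (induction "length u + length v" arbitrary: u v rule: less_induct)
  case less
  then show ?case by (cases u; cases v) auto
qed

lemma shuffle_sum_add: "shuffle_sum (\<lambda>w. a w + b w) u v = shuffle_sum a u v + shuffle_sum b u v"
proof (induction a u v arbitrary: b rule: shuffle_sum.induct)
  case (3 a x u y v)
  show ?case by (simp only: shuffle_sum.simps 3) (simp add: add_ac)
qed auto

lemma shuffle_sum_sum: "shuffle_sum (\<lambda>w. \<Sum>i\<in>I. a i w) u v = (\<Sum>i\<in>I. shuffle_sum (a i) u v)"
  by (induction I rule: infinite_finite_induct) (auto simp: shuffle_sum_add)

lemma shuffle_sum_scale: "shuffle_sum (\<lambda>w. c * a w) u v = c * shuffle_sum a u v" for c :: "'b::semiring_0"
  by (induction a u v rule: shuffle_sum.induct) (auto simp: distrib_left)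

lemma shuffle_sum_diff: "shuffle_sum (\<lambda>w. a w - b w) u v = shuffle_sum a u v - shuffle_sum b u v" for a :: "'a list \<Rightarrow> 'b::ab_group_add"
  by (induction a u v arbitrary: b rule: shuffle_sum.induct) auto

lemma nc_product_Nil: "nc_product a b [] = a [] * b []"
  by (simp add: nc_product_def)

lemma nc_product_Cons:
  "nc_product a b (x # w) = a [] * b (x # w) + nc_product (\<lambda>w. a (x # w)) b w"
  by (simp add: nc_product_def sum.atMost_Suc_shift del: sum.atMost_Suc)

text \<open>Unshuffling is an algebra homomorphism: this is Delta(ab) = Delta(a) Delta(b), read off
  at u \<otimes> v.\<close>

lemma shuffle_sum_nc_product:
  "shuffle_sum (nc_product a b) u v =
     (\<Sum>i\<le>length u. \<Sum>j\<le>length v. shuffle_sum a (take i u) (take j v) * shuffle_sum b (drop i u) (drop j v))"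
proof (induction "length u + length v" arbitrary: a u v rule: less_induct)
  case less
  show ?case
  proof (cases "u = [] \<or> v = []")
    case True
    then show ?thesis by (auto simp: nc_product_def)
  next
    case False
    then obtain x u' y v' where uv: "u = x # u'" "v = y # v'" by (meson list.exhaust)
    let ?f = "\<lambda>a u v i j. shuffle_sum a (take i u) (take j v) * shuffle_sum b (drop i u) (drop j v)"
    have split: "shuffle_sum (\<lambda>w. nc_product a b (z # w)) p q =
        a [] * shuffle_sum (\<lambda>w. b (z # w)) p q + shuffle_sum (nc_product (\<lambda>w. a (z # w)) b) p q" for z p q
      by (simp add: nc_product_Cons shuffle_sum_add shuffle_sum_scale)
    \<comment> \<open>Either \<open>a\<close> takes the empty prefix, or the first letter of the
      shuffle belongs to the prefix and comes from \<open>u\<close> or from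
      \<open>v\<close>.\<close>
    have "shuffle_sum (nc_product a b) u v =
        a [] * shuffle_sum b u v + (\<Sum>i\<le>length u'. \<Sum>j\<le>length v. ?f (\<lambda>w. a (x # w)) u' v i j)
          + (\<Sum>i\<le>length u. \<Sum>j\<le>length v'. ?f (\<lambda>w. a (y # w)) u v' i j)"
      by (simp add: uv split less distrib_left add_ac)
    also have "\<dots> = (\<Sum>i\<le>length u. \<Sum>j\<le>length v. ?f a u v i j)"
      by (simp add: uv sum.atMost_Suc_shift sum.distrib distrib_right algebra_simps del: sum.atMost_Suc)
    finally show ?thesis .
  qed
qed

section \<open>The Dynkin operator as a convolution with the antipode\<close>

lemma nc_product_monomial_left:
  "nc_product (nc_monomial [y]) b z = (if z \<noteq> [] \<and> hd z = y then b (tl z) else 0)"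
proof (cases z)
  case Nil
  then show ?thesis by (simp add: nc_product_def nc_monomial_def)
next
  case (Cons x z')
  have "nc_product (nc_monomial [y]) b z = nc_product (\<lambda>w. nc_monomial [y] (x # w)) b z'"
    by (simp add: Cons nc_product_Cons nc_monomial_def)
  also have "\<dots> = (\<Sum>k\<le>length z'. if k = 0 then (if x = y then b z' else 0) else 0)"
    unfolding nc_product_def by (intro sum.cong) (auto simp: nc_monomial_def)
  finally show ?thesis by (simp add: Cons)
qed

lemma nc_product_monomial_right:
  "nc_product b (nc_monomial [y]) z = (if z \<noteq> [] \<and> last z = y then b (butlast z) else 0)"
proof (cases z rule: rev_cases)
  case Nil
  then show ?thesis by (simp add: nc_product_def nc_monomial_def)
next
  case (snoc z' x)
  have "nc_product b (nc_monomial [y]) z =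
      (\<Sum>k\<le>length z. if k = length z' then (if x = y then b z' else 0) else 0)"
    unfolding nc_product_def
  proof (intro sum.cong refl)
    fix k assume "k \<in> {..length z}"
    then consider "k < length z'" | "k = length z'" | "k = Suc (length z')" using snoc by fastforce
    then show "b (take k z) * nc_monomial [y] (drop k z) =
        (if k = length z' then if x = y then b z' else 0 else 0)"
      by cases (auto simp: snoc nc_monomial_def)
  qed
  then show ?thesis by (simp add: snoc)
qed

lemma shuffle_sum_nc_monomial_Cons:
  "shuffle_sum (nc_monomial (y # w)) u v =
     (if u \<noteq> [] \<and> hd u = y then shuffle_sum (nc_monomial w) (tl u) v else 0) +
     (if v \<noteq> [] \<and> hd v = y then shuffle_sum (nc_monomial w) u (tl v) else 0)"
proof -
  have *: "(\<lambda>s. nc_monomial (y # w) (x # s)) = (if x = y then nc_monomial w else (\<lambda>s. 0))" for x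
    by (auto simp: nc_monomial_def fun_eq_iff)
  show ?thesis
    by (cases u; cases v) (auto simp: * nc_monomial_def)
qed

text \<open>The right-normed bracket [x1, [x2, ... [x_(n-1), x_n]]], that is, the Dynkin operator on
  a word. The value 0 at the empty word fits multiplication by the degree.\<close>

fun right_bracket :: "nat list \<Rightarrow> nc_series" where
  "right_bracket [] = 0"
| "right_bracket [x] = nc_monomial [x]"
| "right_bracket (x # w) =
     nc_product (nc_monomial [x]) (right_bracket w) - nc_product (right_bracket w) (nc_monomial [x])"

lemma right_bracket_lie: "set w \<subseteq> J \<Longrightarrow> right_bracket w \<in> lie_polynomials J"
  by (induction w rule: right_bracket.induct) (auto intro: lie_polynomials.intros)

text \<open>The coefficient of \<open>z\<close> in the convolution \<open>C * S\<close> applied to the word \<open>w\<close>, where \<open>C\<close> multiplies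
  words of length \<open>k\<close> by \<open>c k\<close> and \<open>S(w) = (-1) ^ length w * rev w\<close> is the antipode.\<close>

definition conv_antipode :: "(nat \<Rightarrow> rat) \<Rightarrow> nat list \<Rightarrow> nc_series" where
  "conv_antipode c w z =
     (\<Sum>k\<le>length z. (-1) ^ (length z - k) * c k * shuffle_sum (nc_monomial w) (take k z) (rev (drop k z)))"

text \<open>The letter \<open>y\<close> heads either the part handled by \<open>C\<close>, and then
  it is the first letter of \<open>z\<close>, or the reversed part, and then it is the last letter
  of \<open>z\<close>. In the first case the length counted by \<open>c\<close> includes one more
  letter; in the second the antipode contributes a minus sign.\<close>

lemma conv_antipode_Cons:
  "conv_antipode c (y # w) =
     nc_product (nc_monomial [y]) (conv_antipode (\<lambda>k. c (Suc k)) w) -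
     nc_product (conv_antipode c w) (nc_monomial [y])"
proof
  fix z
  let ?f = "\<lambda>k. (-1) ^ (length z - k) * c k *
     (if take k z \<noteq> [] \<and> hd (take k z) = y then shuffle_sum (nc_monomial w) (tl (take k z)) (rev (drop k z)) else 0)"
  let ?g = "\<lambda>k. (-1) ^ (length z - k) * c k *
     (if rev (drop k z) \<noteq> [] \<and> hd (rev (drop k z)) = y then shuffle_sum (nc_monomial w) (take k z) (tl (rev (drop k z))) else 0)"
  have 1: "conv_antipode c (y # w) z = (\<Sum>k\<le>length z. ?f k) + (\<Sum>k\<le>length z. ?g k)"
    unfolding conv_antipode_def shuffle_sum_nc_monomial_Cons sum.distrib[symmetric]
    by (intro sum.cong) (auto simp: distrib_left)
  have 2: "(\<Sum>k\<le>length z. ?f k) = nc_product (nc_monomial [y]) (conv_antipode (\<lambda>k. c (Suc k)) w) z"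
  proof (cases z)
    case (Cons x z')
    show ?thesis
      unfolding nc_product_monomial_left conv_antipode_def
      by (simp add: Cons sum.atMost_Suc_shift del: sum.atMost_Suc)
  qed (simp add: nc_product_monomial_left)
  have 3: "(\<Sum>k\<le>length z. ?g k) = - nc_product (conv_antipode c w) (nc_monomial [y]) z"
  proof (cases z rule: rev_cases)
    case (snoc z' x)
    have "(\<Sum>k\<le>length z. ?g k) = (\<Sum>k\<le>length z'. ?g k)"
      by (simp add: snoc)
    also have "\<dots> = (\<Sum>k\<le>length z'. - (if x = y then (-1) ^ (length z' - k) * c k *
        shuffle_sum (nc_monomial w) (take k z') (rev (drop k z')) else 0))"
      by (intro sum.cong) (auto simp: snoc Suc_diff_le)
    also have "\<dots> = - nc_product (conv_antipode c w) (nc_monomial [y]) z"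
      by (auto simp: nc_product_monomial_right conv_antipode_def snoc sum_negf)
    finally show ?thesis .
  qed (simp add: nc_product_monomial_right)
  show "conv_antipode c (y # w) z = (nc_product (nc_monomial [y]) (conv_antipode (\<lambda>k. c (Suc k)) w) -
     nc_product (conv_antipode c w) (nc_monomial [y])) z"
    unfolding 1 2 3 by simp
qed

lemma nc_product_zero [simp]: "nc_product a 0 = 0" "nc_product 0 a = 0"
  by (auto simp: nc_product_def fun_eq_iff)

lemma conv_antipode_Nil: "conv_antipode c [] = nc_scale (c 0) (nc_monomial [])"
proof
  fix z
  have "conv_antipode c [] z = (\<Sum>k\<le>length z. if k = 0 then (if z = [] then c 0 else 0) else 0)"
    unfolding conv_antipode_def
  proof (intro sum.cong refl)
    fix k assume "k \<in> {..length z}"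
    have "shuffle_sum (nc_monomial []) u v = (if u = [] \<and> v = [] then 1 else 0)" for u v :: "nat list"
    proof -
      have "shuffle_sum (\<lambda>w. nc_monomial [] (x # w)) u v = 0" for x u v
        by (simp add: nc_monomial_def)
      then show ?thesis by (cases u; cases v) (auto simp: nc_monomial_def)
    qed
    then show "(-1) ^ (length z - k) * c k * shuffle_sum (nc_monomial []) (take k z) (rev (drop k z)) =
       (if k = 0 then if z = [] then c 0 else 0 else 0)" using \<open>k \<in> _\<close> by auto
  qed
  then show "conv_antipode c [] z = nc_scale (c 0) (nc_monomial []) z"
    by (simp add: nc_scale_def nc_monomial_def)
qed

lemma nc_product_scale_Nil:
  "nc_product a (nc_scale c (nc_monomial [])) = nc_scale c a"
  "nc_product (nc_scale c (nc_monomial [])) a = nc_scale c a"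
proof -
  show "nc_product a (nc_scale c (nc_monomial [])) = nc_scale c a"
  proof
    fix w
    have "nc_product a (nc_scale c (nc_monomial [])) w = (\<Sum>k\<le>length w. if k = length w then c * a w else 0)"
      unfolding nc_product_def by (intro sum.cong) (auto simp: nc_scale_def nc_monomial_def)
    then show "nc_product a (nc_scale c (nc_monomial [])) w = nc_scale c a w"
      by (simp add: nc_scale_def)
  qed
  show "nc_product (nc_scale c (nc_monomial [])) a = nc_scale c a"
  proof
    fix w
    have "nc_product (nc_scale c (nc_monomial [])) a w = (\<Sum>k\<le>length w. if k = 0 then c * a w else 0)"
      unfolding nc_product_def by (intro sum.cong) (auto simp: nc_scale_def nc_monomial_def)
    then show "nc_product (nc_scale c (nc_monomial [])) a w = nc_scale c a w"
      by (simp add: nc_scale_def)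
  qed
qed

text \<open>For constant \<open>c\<close> the map \<open>C\<close> is the identity, and this is the
  antipode axiom id * S = counit. In the recursion it appears as a commutator with 1 or with
  0.\<close>

lemma conv_antipode_one: "w \<noteq> [] \<Longrightarrow> conv_antipode (\<lambda>k. 1) w = 0"
proof (induction w)
  case (Cons y w)
  show ?case
  proof (cases w)
    case Nil
    then show ?thesis
      by (simp add: conv_antipode_Cons conv_antipode_Nil nc_product_scale_Nil)
  next
    case (Cons x w')
    then have "conv_antipode (\<lambda>k. 1) w = 0" using Cons.IH by blast
    then have "conv_antipode (\<lambda>k. 1) (y # w) = 0 - 0"
      by (simp only: conv_antipode_Cons nc_product_zero)
    then show ?thesis by (simp only: diff_0_right)
  qed
qed simp

lemma conv_antipode_add:
  "conv_antipode (\<lambda>k. c k + d k) w = conv_antipode c w + conv_antipode d w"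
  by (rule ext) (simp add: conv_antipode_def distrib_left distrib_right sum.distrib)

text \<open>For \<open>c k = k\<close> the map \<open>C\<close> is the degree derivation. Splitting
  k + 1 as 1 + k, the constant part vanishes on nonempty words by \<open>conv_antipode_one\<close>,
  and the recursion that remains is the one of \<open>right_bracket\<close>.\<close>

lemma conv_antipode_length: "conv_antipode (\<lambda>k. of_nat k) w = right_bracket w"
proof (induction w rule: right_bracket.induct)
  case 1
  show ?case by (auto simp: conv_antipode_Nil nc_scale_def fun_eq_iff)
next
  case (2 x)
  show ?case
    by (simp add: conv_antipode_Cons conv_antipode_Nil nc_product_scale_Nil)
      (auto simp: nc_scale_def fun_eq_iff)
next
  case (3 x y w)
  have "conv_antipode (\<lambda>k. of_nat (Suc k)) (y # w) = conv_antipode (\<lambda>k. 1) (y # w) + conv_antipode (\<lambda>k. of_nat k) (y # w)"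
    by (subst conv_antipode_add[symmetric]) simp
  then have "conv_antipode (\<lambda>k. of_nat (Suc k)) (y # w) = right_bracket (y # w)"
    using conv_antipode_one[of "y # w"] by (simp only: 3) simp
  then show ?case
    by (subst conv_antipode_Cons) (simp add: 3 del: of_nat_Suc)
qed

lemma sum_fun_apply: "(\<Sum>i\<in>I. f i) x = (\<Sum>i\<in>I. f i x)"
  by (induction I rule: infinite_finite_induct) auto

text \<open>The Dynkin operator multiplies a homogeneous primitive element by its degree.\<close>

lemma primitive_imp_lie:
  assumes fin: "finite {w. a w \<noteq> 0}" and len: "\<And>w. a w \<noteq> 0 \<Longrightarrow> length w = d" and d: "d > 0"
    and prim: "\<And>u v. u \<noteq> [] \<Longrightarrow> v \<noteq> [] \<Longrightarrow> shuffle_sum a u v = 0"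
    and J: "\<And>w. a w \<noteq> 0 \<Longrightarrow> set w \<subseteq> J"
  shows "a \<in> lie_polynomials J"
proof -
  let ?W = "{w. a w \<noteq> 0}"
  have a: "a = (\<lambda>z. \<Sum>w\<in>?W. a w * nc_monomial w z)"
  proof
    fix z
    have "(\<Sum>w\<in>?W. a w * nc_monomial w z) = (\<Sum>w\<in>?W. if w = z then a w else 0)"
      by (intro sum.cong) (auto simp: nc_monomial_def)
    then show "a z = (\<Sum>w\<in>?W. a w * nc_monomial w z)" using fin by (simp add: sum.delta')
  qed
  have "(\<Sum>w\<in>?W. a w * right_bracket w z) = of_nat d * a z" for z
  proof -
    have "(\<Sum>w\<in>?W. a w * right_bracket w z) =
       (\<Sum>w\<in>?W. \<Sum>k\<le>length z. (-1) ^ (length z - k) * of_nat k *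
          (a w * shuffle_sum (nc_monomial w) (take k z) (rev (drop k z))))"
      by (auto simp: conv_antipode_length[symmetric] conv_antipode_def sum_distrib_left mult_ac
          intro!: sum.cong)
    also have "\<dots> = (\<Sum>k\<le>length z. (-1) ^ (length z - k) * of_nat k *
          shuffle_sum (\<lambda>z. \<Sum>w\<in>?W. a w * nc_monomial w z) (take k z) (rev (drop k z)))"
      by (subst sum.swap) (simp add: shuffle_sum_sum shuffle_sum_scale sum_distrib_left)
    also have "\<dots> = (\<Sum>k\<le>length z. (-1) ^ (length z - k) * of_nat k * shuffle_sum a (take k z) (rev (drop k z)))"
      by (simp only: a[symmetric])
    also have "\<dots> = (\<Sum>k\<le>length z. if k = length z then of_nat k * a z else 0)"
    proof (intro sum.cong refl)
      fix k assume k: "k \<in> {..length z}"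
      \<comment> \<open>Proper cuts vanish by primitivity and the cut at 0 by the factor k, so only
        the uncut word survives, with its length as coefficient.\<close>
      consider "k = length z" | "k = 0" | "k < length z" "k > 0" using k by fastforce
      then show "(-1) ^ (length z - k) * of_nat k * shuffle_sum a (take k z) (rev (drop k z)) =
         (if k = length z then of_nat k * a z else 0)"
      proof cases
        case 3
        then have "shuffle_sum a (take k z) (rev (drop k z)) = 0" by (intro prim) auto
        then show ?thesis using 3 by simp
      qed auto
    qed
    also have "\<dots> = of_nat d * a z" using len[of z] by (cases "a z = 0") auto
    finally show ?thesis .
  qed
  then have "a = nc_scale (1 / of_nat d) (\<Sum>w\<in>?W. nc_scale (a w) (right_bracket w))"
    using d by (auto simp: nc_scale_def fun_eq_iff sum_fun_apply)
  moreover have "(\<Sum>w\<in>W. nc_scale (a w) (right_bracket w)) \<in> lie_polynomials J"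
    if "finite W" "W \<subseteq> ?W" for W
    using that
  proof (induction W rule: finite_induct)
    case (insert w W)
    then have "right_bracket w \<in> lie_polynomials J" using J by (intro right_bracket_lie) auto
    moreover have "(\<Sum>w\<in>W. nc_scale (a w) (right_bracket w)) \<in> lie_polynomials J"
      using insert by blast
    ultimately show ?case
      unfolding sum.insert[OF insert(1,2)] by (intro lie_polynomials.add lie_polynomials.scale)
  qed (simp add: lie_polynomials.zero)
  from this[OF fin subset_refl] have "(\<Sum>w\<in>?W. nc_scale (a w) (right_bracket w)) \<in> lie_polynomials J" .
  then have "nc_scale (1 / of_nat d) (\<Sum>w\<in>?W. nc_scale (a w) (right_bracket w)) \<in> lie_polynomials J"
    by (rule lie_polynomials.scale)
  ultimately show ?thesis by argo
qed

text \<open>For primitive \<open>a\<close> and \<open>b\<close> the mixed part of Delta(ab) is a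
  \<otimes> b + b \<otimes> a. It is symmetric in the two factors, hence cancels in the
  commutator.\<close>

lemma lie_imp_primitive:
  assumes "a \<in> lie_polynomials J"
  shows "a [] = 0 \<and> (\<forall>u v. u \<noteq> [] \<longrightarrow> v \<noteq> [] \<longrightarrow> shuffle_sum a u v = 0)"
  using assms
proof induction
  case zero
  show ?case by (simp add: zero_fun_def)
next
  case (gen i)
  show ?case
  proof (intro conjI allI impI)
    fix u v :: "nat list" assume "u \<noteq> []" "v \<noteq> []"
    then have "length u + length v \<noteq> 1" by (cases u; cases v) auto
    have "nc_monomial [i] w = 0" if "mset w = mset u + mset v" for w
      using \<open>length u + length v \<noteq> 1\<close> arg_cong[OF that, of size] by (auto simp: nc_monomial_def)
    then have "shuffle_sum (nc_monomial [i]) u v = shuffle_sum (\<lambda>w. 0) u v"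
      by (intro shuffle_sum_cong) auto
    then show "shuffle_sum (nc_monomial [i]) u v = 0" by simp
  qed (simp add: nc_monomial_def)
next
  case (add a b)
  then show ?case using shuffle_sum_add[of a b] by (simp add: plus_fun_def)
next
  case (scale a c)
  then show ?case using shuffle_sum_scale[of c a] by (simp add: nc_scale_def)
next
  case (bracket a b)
  have *: "shuffle_sum (nc_product a b) u v = a u * b v + a v * b u"
    if uv: "u \<noteq> []" "v \<noteq> []" and a: "a [] = 0" "\<forall>u v. u \<noteq> [] \<longrightarrow> v \<noteq> [] \<longrightarrow> shuffle_sum a u v = 0"
      and b: "b [] = 0" "\<forall>u v. u \<noteq> [] \<longrightarrow> v \<noteq> [] \<longrightarrow> shuffle_sum b u v = 0" for a b u v
  proof -
    let ?f = "\<lambda>i j. shuffle_sum a (take i u) (take j v) * shuffle_sum b (drop i u) (drop j v)"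
    have "shuffle_sum (nc_product a b) u v = (\<Sum>i\<le>length u. \<Sum>j\<le>length v. ?f i j)"
      by (rule shuffle_sum_nc_product)
    \<comment> \<open>A nonzero product requires that each factor sees all of one of the words
      \<open>u\<close>, \<open>v\<close> and nothing of the other.\<close>
    also have "\<dots> = (\<Sum>i\<le>length u. \<Sum>j\<le>length v.
       (if j = 0 then (if i = length u then a u * b v else 0) else 0) +
       (if j = length v then (if i = 0 then a v * b u else 0) else 0))"
    proof (intro sum.cong refl)
      fix i j assume "i \<in> {..length u}" "j \<in> {..length v}"
      then have "i = 0 \<or> i = length u \<or> 0 < i \<and> i < length u"
        "j = 0 \<or> j = length v \<or> 0 < j \<and> j < length v" by auto
      then consider "i = 0" "j = 0" | "i = 0" "j = length v" | "i = 0" "0 < j" "j < length v"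
        | "i = length u" "j = 0" | "i = length u" "j = length v" | "i = length u" "0 < j" "j < length v"
        | "0 < i" "i < length u" "j = 0" | "0 < i" "i < length u" "j = length v"
        | "0 < i" "i < length u" "0 < j" "j < length v"
        by argo
      then show "?f i j = (if j = 0 then (if i = length u then a u * b v else 0) else 0) +
       (if j = length v then (if i = 0 then a v * b u else 0) else 0)"
        using uv a b by cases auto
    qed
    also have "\<dots> = a u * b v + a v * b u"
      by (simp add: sum.distrib)
    finally show ?thesis .
  qed
  have "shuffle_sum (nc_product a b - nc_product b a) u v = 0" if "u \<noteq> []" "v \<noteq> []" for u v
    using *[OF that, of a b] *[OF that, of b a] bracket.IH shuffle_sum_diff[of "nc_product a b" "nc_product b a" u v]
    by (simp add: fun_diff_def)
  moreover have "(nc_product a b - nc_product b a) [] = 0"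
    by (simp add: nc_product_Nil)
  ultimately show ?case by blast
qed

section \<open>Euler characteristic of compact convex sets\<close>

text \<open>One-dimensional Euler characteristic: for small \<open>\<epsilon>\<close>, the function \<open>t \<mapsto> [t \<in> J] - [t + \<epsilon> \<in> J]\<close>
  detects the right endpoint of the interval \<open>J\<close>.\<close>

lemma sum_nonempty_intervals:
  fixes a b :: "'i \<Rightarrow> real" and c :: "'i \<Rightarrow> int"
  assumes fin: "finite I" and zero: "\<And>s. (\<Sum>i\<in>I. c i * of_bool (s \<in> {a i..b i})) = 0"
  shows "(\<Sum>i\<in>I. c i * of_bool ({a i..b i} \<noteq> {})) = 0"
proof -
  let ?I = "{i\<in>I. a i \<le> b i}"
  have fin': "finite ?I" using fin by simp
  have fibre: "(\<Sum>i\<in>{i\<in>?I. b i = t}. c i) = 0" for t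
  proof -
    \<comment> \<open>The number \<open>e\<close> is chosen below the distance from \<open>t\<close>
      to the next endpoint, so that no interval starts or ends in (t, t + e].\<close>
    let ?B = "{x \<in> a ` I \<union> b ` I. x > t}"
    have "finite ?B" using fin by simp
    then obtain e where e: "e > 0" "\<And>x. x \<in> ?B \<Longrightarrow> t + e < x"
    proof (cases "?B = {}")
      case True
      then show ?thesis using that[of 1] by auto
    next
      case False
      define m where "m = Min ?B"
      have m: "m > t" using Min_in[OF \<open>finite ?B\<close> False] by (simp add: m_def)
      have "t + (m - t) / 2 < x" if "x \<in> ?B" for x
      proof -
        have "m \<le> x" unfolding m_def by (rule Min_le[OF \<open>finite ?B\<close> that])
        moreover have "(m - t) / 2 < m - t" using m by simp
        ultimately show ?thesis by linarith
      qed
      with m show ?thesis using that[of "(m - t) / 2"] by simp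
    qed
    have "(\<Sum>i\<in>I. c i * of_bool (t \<in> {a i..b i})) - (\<Sum>i\<in>I. c i * of_bool (t + e \<in> {a i..b i})) =
       (\<Sum>i\<in>I. if i \<in> {i\<in>?I. b i = t} then c i else 0)"
      unfolding sum_subtractf[symmetric]
    proof (intro sum.cong refl)
      fix i assume i: "i \<in> I"
      have "a i > t \<Longrightarrow> t + e < a i" "b i > t \<Longrightarrow> t + e < b i" using e(2) i by auto
      then show "c i * of_bool (t \<in> {a i..b i}) - c i * of_bool (t + e \<in> {a i..b i}) =
         (if i \<in> {i\<in>?I. b i = t} then c i else 0)"
        using i e(1) by (auto simp: of_bool_def)
    qed
    also have "\<dots> = (\<Sum>i\<in>{i\<in>?I. b i = t}. c i)"
      using fin by (subst sum.inter_restrict[symmetric]) (auto intro!: sum.cong)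
    finally show ?thesis unfolding zero by simp
  qed
  have "(\<Sum>i\<in>I. c i * of_bool ({a i..b i} \<noteq> {})) = sum c ?I"
    using fin by (simp add: of_bool_def if_distrib sum.If_cases Int_def cong: if_cong)
  also have "\<dots> = (\<Sum>t\<in>b ` ?I. \<Sum>i\<in>{i\<in>?I. b i = t}. c i)"
    by (rule sum.image_gen[OF fin'])
  also have "\<dots> = 0" using fibre by simp
  finally show ?thesis .
qed

definition convex_fun_set :: "('a \<Rightarrow> real) set \<Rightarrow> bool" where
  "convex_fun_set S \<longleftrightarrow>
     (\<forall>x\<in>S. \<forall>y\<in>S. \<forall>t\<in>{0..1}. (\<lambda>i. (1 - t) * x i + t * y i) \<in> S)"

lemma closed_fun_coordinate_eq: "closed {y :: 'a \<Rightarrow> real. y i = c}"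
proof -
  have "{y :: 'a \<Rightarrow> real. y i = c} = (\<lambda>y. y i) -` {c}" by auto
  then show ?thesis
    by (metis closed_singleton closed_vimage continuous_on_product_coordinates)
qed

text \<open>Coordinates are projected out one at a time. Over each point the fibres of the
  projection are compact intervals, so the one-dimensional case carries the linear relation over to
  the projected sets, and projecting preserves nonemptiness. Once all coordinates in
  \<open>T\<close> are gone, the origin is the only possible point.\<close>

lemma sum_nonempty_compact_convex:
  fixes K :: "'i \<Rightarrow> ('a \<Rightarrow> real) set" and c :: "'i \<Rightarrow> int"
  assumes "finite I" "finite T"
    and "\<And>i. i \<in> I \<Longrightarrow> compact (K i)" "\<And>i. i \<in> I \<Longrightarrow> convex_fun_set (K i)"
    and "\<And>i y j. i \<in> I \<Longrightarrow> y \<in> K i \<Longrightarrow> j \<notin> T \<Longrightarrow> y j = 0"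
    and "\<And>y. (\<Sum>i\<in>I. c i * of_bool (y \<in> K i)) = 0"
  shows "(\<Sum>i\<in>I. c i * of_bool (K i \<noteq> {})) = 0"
  using assms(2-)
proof (induction T arbitrary: K rule: finite_induct)
  case empty
  have "K i \<noteq> {} \<longleftrightarrow> (\<lambda>_. 0) \<in> K i" if "i \<in> I" for i
  proof -
    have "y = (\<lambda>_. 0)" if "y \<in> K i" for y using empty(3)[OF \<open>i \<in> I\<close> that] by auto
    then show ?thesis by auto
  qed
  then have "(\<Sum>i\<in>I. c i * of_bool (K i \<noteq> {})) = (\<Sum>i\<in>I. c i * of_bool ((\<lambda>_. 0) \<in> K i))"
    by (intro sum.cong) auto
  then show ?case using empty(4) by simp
next
  case (insert t T)
  let ?p = "\<lambda>y::'a \<Rightarrow> real. y(t := 0)"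
  define K' where "K' = (\<lambda>i. ?p ` K i)"
  have cont: "continuous_on S ?p" for S
  proof (rule continuous_on_coordinatewise_then_product)
    fix i show "continuous_on S (\<lambda>x. ?p x i)"
      by (cases "i = t") (auto intro: continuous_on_subset[OF continuous_on_product_coordinates])
  qed
  have "(\<Sum>i\<in>I. c i * of_bool (K' i \<noteq> {})) = 0"
  proof (rule insert.IH)
    show "compact (K' i)" if "i \<in> I" for i
      unfolding K'_def using insert.prems(1)[OF that] cont by (intro compact_continuous_image)
    show "convex_fun_set (K' i)" if "i \<in> I" for i
      unfolding convex_fun_set_def
    proof (intro ballI)
      fix x y s assume "x \<in> K' i" "y \<in> K' i" and s: "s \<in> {0..1::real}"
      then obtain x' y' where *: "x' \<in> K i" "y' \<in> K i" "x = ?p x'" "y = ?p y'" by (auto simp: K'_def)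
      then have "(\<lambda>i. (1 - s) * x' i + s * y' i) \<in> K i"
        using insert.prems(2)[OF that] s by (auto simp: convex_fun_set_def)
      moreover have "(\<lambda>i. (1 - s) * x i + s * y i) = ?p (\<lambda>i. (1 - s) * x' i + s * y' i)"
        by (auto simp: *)
      ultimately show "(\<lambda>i. (1 - s) * x i + s * y i) \<in> K' i" by (auto simp: K'_def)
    qed
    show "y j = 0" if "i \<in> I" "y \<in> K' i" "j \<notin> T" for i y j
      using that insert.prems(3) by (auto simp: K'_def)
    fix y
    show "(\<Sum>i\<in>I. c i * of_bool (y \<in> K' i)) = 0"
    proof (cases "y t = 0")
      case False
      then have "y \<notin> K' i" for i by (auto simp: K'_def)
      then show ?thesis by simp
    next
      case True
      \<comment> \<open>The fibre over \<open>y\<close> of the projection that forgets coordinate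
        \<open>t\<close>. An empty fibre is written as an interval whose bounds are in the wrong
        order.\<close>
      define J where "J = (\<lambda>i. {s. y(t := s) \<in> K i})"
      have "\<exists>a b. J i = {a..b}" if i: "i \<in> I" for i
      proof -
        have "J i = (\<lambda>z. z t) ` (K i \<inter> (\<Inter>j\<in>-{t}. {z. z j = y j}))"
        proof
          show "J i \<subseteq> (\<lambda>z. z t) ` (K i \<inter> (\<Inter>j\<in>-{t}. {z. z j = y j}))"
          proof
            fix s assume "s \<in> J i"
            then have "y(t := s) \<in> K i \<inter> (\<Inter>j\<in>-{t}. {z. z j = y j})" by (auto simp: J_def)
            then show "s \<in> (\<lambda>z. z t) ` (K i \<inter> (\<Inter>j\<in>-{t}. {z. z j = y j}))"
              by (metis (no_types, lifting) fun_upd_same imageI)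
          qed
          show "(\<lambda>z. z t) ` (K i \<inter> (\<Inter>j\<in>-{t}. {z. z j = y j})) \<subseteq> J i"
          proof clarify
            fix z assume z: "z \<in> K i" "z \<in> (\<Inter>j\<in>-{t}. {z. z j = y j})"
            then have "y(t := z t) = z" by auto
            with z show "z t \<in> J i" by (simp add: J_def)
          qed
        qed
        moreover have "compact (K i \<inter> (\<Inter>j\<in>-{t}. {z. z j = y j}))"
          using insert.prems(1)[OF i] by (intro compact_Int_closed closed_INT ballI closed_fun_coordinate_eq)
        ultimately have "compact (J i)"
          by (auto intro: compact_continuous_image continuous_on_subset[OF continuous_on_product_coordinates])
        moreover have "convex (J i)"
          unfolding convex_alt
        proof (intro ballI allI impI)
          fix s s' u :: real assume *: "s \<in> J i" "s' \<in> J i" "0 \<le> u \<and> u \<le> 1"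
          then have "(\<lambda>j. (1 - u) * (y(t := s)) j + u * (y(t := s')) j) \<in> K i"
            using insert.prems(2)[OF i] unfolding convex_fun_set_def J_def mem_Collect_eq
            by (meson atLeastAtMost_iff)
          also have "(\<lambda>j. (1 - u) * (y(t := s)) j + u * (y(t := s')) j) = y(t := (1 - u) * s + u * s')"
            by (auto simp: algebra_simps)
          finally show "(1 - u) *\<^sub>R s + u *\<^sub>R s' \<in> J i" by (simp only: J_def mem_Collect_eq real_scaleR_def)
        qed
        ultimately show ?thesis
          using connected_compact_interval_1[of "J i"] convex_connected by blast
      qed
      then obtain a b where ab: "\<And>i. i \<in> I \<Longrightarrow> J i = {a i..b i}" by metis
      have "(\<Sum>i\<in>I. c i * of_bool ({a i..b i} \<noteq> {})) = 0"
      proof (rule sum_nonempty_intervals[OF \<open>finite I\<close>])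
        fix s
        have "(\<Sum>i\<in>I. c i * of_bool (s \<in> {a i..b i})) = (\<Sum>i\<in>I. c i * of_bool (y(t := s) \<in> K i))"
        proof (intro sum.cong refl)
          fix i assume "i \<in> I"
          then show "c i * of_bool (s \<in> {a i..b i}) = c i * of_bool (y(t := s) \<in> K i)"
            using ab[of i, symmetric] by (simp only: J_def mem_Collect_eq)
        qed
        then show "(\<Sum>i\<in>I. c i * of_bool (s \<in> {a i..b i})) = 0" using insert.prems(4) by simp
      qed
      moreover have "y \<in> K' i \<longleftrightarrow> {a i..b i} \<noteq> {}" if "i \<in> I" for i
      proof -
        have "y \<in> K' i \<longleftrightarrow> (\<exists>s. y(t := s) \<in> K i)"
        proof
          assume "y \<in> K' i"
          then obtain z where z: "z \<in> K i" "y = ?p z" by (auto simp: K'_def)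
          then have "y(t := z t) = z" by auto
          with z show "\<exists>s. y(t := s) \<in> K i" by metis
        next
          assume "\<exists>s. y(t := s) \<in> K i"
          then obtain s where "y(t := s) \<in> K i" ..
          moreover have "y = ?p (y(t := s))" using True by auto
          ultimately show "y \<in> K' i" unfolding K'_def by blast
        qed
        also have "\<dots> \<longleftrightarrow> J i \<noteq> {}" by (auto simp: J_def)
        finally show ?thesis using ab[OF that] by simp
      qed
      ultimately show ?thesis by simp
    qed
  qed
  moreover have "K' i \<noteq> {} \<longleftrightarrow> K i \<noteq> {}" for i by (simp add: K'_def)
  ultimately show ?case by simp
qed

text \<open>Moebius inversion for the componentwise order, as a downward induction on the total of
  \<open>r\<close>: the vectors that dominate \<open>r\<close> without being equal to it have larger
  total, so their coefficients sum to zero for each common value.\<close>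

lemma sum_dominating_imp_sum_equal:
  fixes v :: "'i \<Rightarrow> nat \<Rightarrow> nat" and c :: "'i \<Rightarrow> int"
  assumes fin: "finite I"
    and zero: "\<And>r. (\<Sum>i\<in>I. c i * of_bool (\<forall>k\<le>n. r k \<le> v i k)) = 0"
  shows "(\<Sum>i\<in>I. c i * of_bool (\<forall>k\<le>n. v i k = r k)) = 0"
proof -
  define tot where "tot = (\<lambda>r. \<Sum>k\<le>n. r k :: nat)"
  \<comment> \<open>A bound for all totals that occur; it makes the downward induction
    terminate.\<close>
  define M where "M = Max (insert 0 ((\<lambda>i. tot (v i)) ` I))"
  have M: "tot (v i) \<le> M" if "i \<in> I" for i unfolding M_def using fin that by (intro Max_ge) auto
  have *: "(\<forall>k\<le>n. r k \<le> s k) \<Longrightarrow> tot r \<le> tot s" for r s unfolding tot_def by (intro sum_mono) auto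
  have eq: "(\<forall>k\<le>n. s k = r k)" if "\<forall>k\<le>n. r k \<le> s k" "tot s \<le> tot r" for r s
  proof (rule ccontr)
    assume "\<not> ?thesis"
    then obtain k where k: "k \<le> n" "s k \<noteq> r k" by blast
    then have "r k < s k" using that(1) by (simp add: order_less_le)
    with k have "tot r < tot s" unfolding tot_def using that(1) by (intro sum_strict_mono_ex1) auto
    with that show False by simp
  qed
  show ?thesis
  proof (induction "Suc M - tot r" arbitrary: r rule: less_induct)
    case less
    let ?D = "\<lambda>i. \<forall>k\<le>n. r k \<le> v i k" and ?E = "\<lambda>i. \<forall>k\<le>n. v i k = r k"
    \<comment> \<open>Truncation after \<open>n\<close> turns agreement up to \<open>n\<close> into
      equality of functions, which allows grouping by value.\<close>
    define cl where "cl = (\<lambda>i k. if k \<le> n then v i k else (0::nat))"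
    have cl: "(\<forall>k\<le>n. v i k = cl j k) \<longleftrightarrow> cl i = cl j" for i j by (auto simp: cl_def fun_eq_iff)
    have "0 = (\<Sum>i\<in>I. c i * of_bool (?D i))" using zero by simp
    also have "\<dots> = (\<Sum>i\<in>I. c i * of_bool (?E i)) + (\<Sum>i\<in>I. c i * of_bool (?D i \<and> \<not> ?E i))"
      unfolding sum.distrib[symmetric] by (intro sum.cong) (auto simp: of_bool_def)
    also have "(\<Sum>i\<in>I. c i * of_bool (?D i \<and> \<not> ?E i)) = (\<Sum>i\<in>{i\<in>I. ?D i \<and> \<not> ?E i}. c i)"
      using fin by (simp add: of_bool_def if_distrib sum.If_cases Int_def cong: if_cong)
    also have "\<dots> = (\<Sum>x\<in>cl ` {i\<in>I. ?D i \<and> \<not> ?E i}. \<Sum>i\<in>{j\<in>{i\<in>I. ?D i \<and> \<not> ?E i}. cl j = x}. c i)"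
      by (rule sum.image_gen) (use fin in simp)
    also have "\<dots> = 0"
    proof (rule sum.neutral, rule ballI)
      fix x assume "x \<in> cl ` {i\<in>I. ?D i \<and> \<not> ?E i}"
      then obtain i where i: "i \<in> I" "?D i" "\<not> ?E i" "x = cl i" by blast
      have "tot r < tot x"
      proof -
        have "tot x = tot (v i)" unfolding i tot_def cl_def by (intro sum.cong) auto
        then show ?thesis using *[OF i(2)] eq[OF i(2)] i(3) by fastforce
      qed
      moreover have "tot x \<le> M" using M[OF i(1)] unfolding i tot_def cl_def by simp
      ultimately have "(\<Sum>j\<in>I. c j * of_bool (\<forall>k\<le>n. v j k = x k)) = 0"
        by (intro less) auto
      also have "(\<Sum>j\<in>I. c j * of_bool (\<forall>k\<le>n. v j k = x k)) = (\<Sum>j\<in>{j\<in>I. cl j = x}. c j)"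
        unfolding i(4) cl
        using fin by (simp add: of_bool_def if_distrib sum.If_cases Int_def cong: if_cong)
      also have "{j\<in>I. cl j = x} = {j\<in>{i\<in>I. ?D i \<and> \<not> ?E i}. cl j = x}"
      proof -
        have "?D j \<and> \<not> ?E j" if "cl j = x" for j
        proof -
          have "\<forall>k\<le>n. v j k = v i k" using that i(4) cl[of j i] by (auto simp: cl_def)
          then show ?thesis using i(2,3) by auto
        qed
        then show ?thesis by auto
      qed
      finally show "(\<Sum>i\<in>{j\<in>{i\<in>I. ?D i \<and> \<not> ?E i}. cl j = x}. c i) = 0" .
    qed
    finally show ?case by simp
  qed
qed

section \<open>Rank functions and flags\<close>

lemma polymatroidD:
  assumes "polymatroid X rk"
  shows "finite X" "rk {} = 0" "rk \<in> extensional (Pow X)"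
    "\<And>A B. A \<subseteq> B \<Longrightarrow> B \<subseteq> X \<Longrightarrow> rk A \<le> rk B"
    "\<And>A B. A \<subseteq> X \<Longrightarrow> B \<subseteq> X \<Longrightarrow> rk (A \<union> B) + rk (A \<inter> B) \<le> rk A + rk B"
  using assms unfolding polymatroid_def by blast+

lemma polymatroid_insert_le:
  assumes "polymatroid X rk" "A \<subseteq> X" "x \<in> X"
  shows "rk (insert x A) \<le> rk A + rk {x}"
  using polymatroidD(5)[OF assms(1,2), of "{x}"] assms(3) by simp

text \<open>By submodularity each added element raises the rank by at most the rank of its
  singleton.\<close>

lemma polymatroid_le_sum:
  assumes rk: "polymatroid X rk" and m: "\<And>x. x \<in> X \<Longrightarrow> rk {x} \<le> m" and AX: "A \<subseteq> X" "B \<subseteq> X"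
  shows "rk A \<le> rk B + m * card (A - B)"
proof -
  have "finite (A - B)" using AX polymatroidD(1)[OF rk] by (meson finite_Diff finite_subset)
  have "rk (B \<union> C) \<le> rk B + m * card C" if "C \<subseteq> A - B" "finite C" for C
    using that(2,1)
  proof (induction C rule: finite_induct)
    case (insert x C)
    have "rk (insert x (B \<union> C)) \<le> rk (B \<union> C) + rk {x}"
      using insert.prems AX by (intro polymatroid_insert_le[OF rk]) auto
    moreover have "rk {x} \<le> m" using insert.prems AX by (intro m) auto
    ultimately show ?case using insert by simp
  qed simp
  from this[of "A - B"] have "rk (B \<union> (A - B)) \<le> rk B + m * card (A - B)" using \<open>finite (A - B)\<close> by simp
  moreover have "rk A \<le> rk (B \<union> (A - B))" using AX by (intro polymatroidD(4)[OF rk]) auto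
  ultimately show ?thesis by simp
qed

text \<open>A decomposition of the ground set as a direct sum is inherited by all subsets:
  submodularity for the pair S, A and for the pair S \<union> A, X - A adds up, after cancelling
  with the hypothesis, to the inequality opposite to subadditivity.\<close>

lemma separable_rank:
  assumes rk: "polymatroid X rk" and A: "A \<subseteq> X" "rk A + rk (X - A) = rk X" and S: "S \<subseteq> X"
  shows "rk S = rk (S \<inter> A) + rk (S - A)"
proof -
  have 1: "rk S \<le> rk (S \<inter> A) + rk (S - A)"
    using polymatroidD(5)[OF rk, of "S \<inter> A" "S - A"] S by (simp add: Int_Diff_Un le_infI1 Diff_subset subset_trans)
      (metis Diff_subset Int_Diff_Un S add_leE inf.coboundedI1 subset_trans)
  have 2: "rk (S \<union> A) + rk (S \<inter> A) \<le> rk S + rk A"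
    by (intro polymatroidD(5)[OF rk] S A)
  have "rk ((S \<union> A) \<union> (X - A)) + rk ((S \<union> A) \<inter> (X - A)) \<le> rk (S \<union> A) + rk (X - A)"
    using S A by (intro polymatroidD(5)[OF rk]) auto
  moreover have "(S \<union> A) \<union> (X - A) = X" "(S \<union> A) \<inter> (X - A) = S - A" using S A by auto
  ultimately show ?thesis using 1 2 A(2) by simp
qed

section \<open>Complete flags and their words of rank jumps\<close>

primrec jumps :: "rank_fun \<Rightarrow> nat set \<Rightarrow> nat list \<Rightarrow> nat list" where
  "jumps rk A [] = []"
| "jumps rk A (x # l) = (rk (insert x A) - rk A) # jumps rk (insert x A) l"

lemma length_jumps [simp]: "length (jumps rk A l) = length l"
  by (induction l arbitrary: A) auto

lemma take_jumps: "take k (jumps rk A l) = jumps rk A (take k l)"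
  by (induction l arbitrary: A k) (auto simp: take_Cons split: nat.splits)

lemma drop_jumps: "drop k (jumps rk A l) = jumps rk (A \<union> set (take k l)) (drop k l)"
proof (induction l arbitrary: A k)
  case (Cons x l)
  then show ?case by (cases k) auto
qed simp

lemma sum_list_jumps:
  assumes rk: "polymatroid X rk" and "A \<subseteq> X" "set l \<subseteq> X"
  shows "rk A + sum_list (jumps rk A l) = rk (A \<union> set l)"
  using assms(2-)
proof (induction l arbitrary: A)
  case (Cons x l)
  have "rk A \<le> rk (insert x A)"
    using Cons.prems by (intro polymatroidD(4)[OF rk]) auto
  moreover have "rk (insert x A) + sum_list (jumps rk (insert x A) l) = rk (A \<union> set (x # l))"
    using Cons.IH[of "insert x A"] Cons.prems by simp
  ultimately show ?case by simp
qed simp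

lemma set_jumps:
  assumes rk: "polymatroid X rk" and J: "\<And>x j. x \<in> X \<Longrightarrow> j \<le> rk {x} \<Longrightarrow> j \<in> J"
    and "A \<subseteq> X" "set l \<subseteq> X"
  shows "set (jumps rk A l) \<subseteq> J"
  using assms(3-)
proof (induction l arbitrary: A)
  case (Cons x l)
  have "rk (insert x A) - rk A \<le> rk {x}"
    using polymatroid_insert_le[OF rk, of A x] Cons.prems by simp
  then show ?case using Cons J[of x] by simp
qed simp

text \<open>Jumps are differences of ranks, so the two rank functions may differ by a constant; it
  is split into \<open>c\<close> and \<open>c'\<close> because the ranks are natural numbers. One
  statement thus serves relabelling, restriction and, with the rank of the contracted set as
  constant, contraction.\<close>

lemma jumps_map:
  assumes "\<And>S. S \<subseteq> set l \<Longrightarrow> rk' (A' \<union> \<beta> ` S) + c = rk (A \<union> S) + c'"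
  shows "jumps rk' A' (map \<beta> l) = jumps rk A l"
  using assms
proof (induction l arbitrary: A A')
  case (Cons x l)
  have "rk' A' + c = rk A + c'" "rk' (insert (\<beta> x) A') + c = rk (insert x A) + c'"
    using Cons.prems[of "{}"] Cons.prems[of "{x}"] by auto
  then have "rk' (insert (\<beta> x) A') - rk' A' = rk (insert x A) - rk A" by linarith
  moreover have "jumps rk' (insert (\<beta> x) A') (map \<beta> l) = jumps rk (insert x A) l"
  proof (rule Cons.IH)
    fix S assume "S \<subseteq> set l"
    then show "rk' (insert (\<beta> x) A' \<union> \<beta> ` S) + c = rk (insert x A \<union> S) + c'"
      using Cons.prems[of "insert x S"] by auto
  qed
  ultimately show ?case by simp
qed simp

text \<open>An ordering of \<open>X\<close> is a complete flag from \<open>A\<close> to A \<union>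
  X. The starting set stands for a contraction by \<open>A\<close> that need not be formed
  explicitly.\<close>

definition flag_sum :: "rank_fun \<Rightarrow> nat set \<Rightarrow> nat set \<Rightarrow> nc_series \<Rightarrow> rat" where
  "flag_sum rk A X a = (\<Sum>l\<in>permutations_of_set X. a (jumps rk A l))"

lemma flag_sum_transport:
  assumes \<beta>: "bij_betw \<beta> X X'"
    and eq: "\<And>S. S \<subseteq> X \<Longrightarrow> rk' (A' \<union> \<beta> ` S) + c = rk (A \<union> S) + c'"
  shows "flag_sum rk' A' X' a = flag_sum rk A X a"
proof -
  have inj: "inj_on \<beta> X" and X': "X' = \<beta> ` X" using \<beta> by (auto simp: bij_betw_def)
  have "flag_sum rk' A' X' a = (\<Sum>l\<in>map \<beta> ` permutations_of_set X. a (jumps rk' A' l))"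
    unfolding flag_sum_def X' by (simp add: permutations_of_set_image_inj[OF inj])
  also have "\<dots> = (\<Sum>l\<in>permutations_of_set X. a (jumps rk' A' (map \<beta> l)))"
  proof (subst sum.reindex)
    show "inj_on (map \<beta>) (permutations_of_set X)"
      by (rule inj_on_mapI, rule inj_on_subset[OF inj]) (auto dest: permutations_of_setD)
  qed simp
  also have "\<dots> = flag_sum rk A X a"
    unfolding flag_sum_def
    by (intro sum.cong refl arg_cong[of _ _ a] jumps_map[of _ rk' A' \<beta> c rk A c'] eq)
      (auto dest: permutations_of_setD)
  finally show ?thesis .
qed

text \<open>Cutting the word after k letters cuts the flag at the set \<open>B\<close> of its first
  k elements; the second half is a flag above A \<union> B. Conversely \<open>B\<close> with an
  ordering of it and one of its complement determines the flag, and k is its cardinality.\<close>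

lemma flag_sum_product:
  assumes "finite X"
  shows "flag_sum rk A X (nc_product a b) =
    (\<Sum>B\<in>Pow X. flag_sum rk A B a * flag_sum rk (A \<union> B) (X - B) b)"
proof -
  have "flag_sum rk A X (nc_product a b) = (\<Sum>l\<in>permutations_of_set X. \<Sum>k\<le>card X.
      a (jumps rk A (take k l)) * b (jumps rk (A \<union> set (take k l)) (drop k l)))"
    unfolding flag_sum_def nc_product_def
    by (intro sum.cong) (auto simp: take_jumps drop_jumps length_finite_permutations_of_set)
  also have "\<dots> = (\<Sum>(l,k)\<in>permutations_of_set X \<times> {..card X}.
      a (jumps rk A (take k l)) * b (jumps rk (A \<union> set (take k l)) (drop k l)))"
    by (rule sum.cartesian_product)
  also have "\<dots> = (\<Sum>(B,l1,l2)\<in>(SIGMA B:Pow X. permutations_of_set B \<times> permutations_of_set (X - B)).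
      a (jumps rk A l1) * b (jumps rk (A \<union> B) l2))"
    by (rule sum.reindex_bij_witness[of _ "\<lambda>(B,l1,l2). (l1 @ l2, card B)"
          "\<lambda>(l,k). (set (take k l), take k l, drop k l)"])
      ((auto simp: permutations_of_set_def distinct_card set_drop_subset card_mono assms min_def
        dest: in_set_takeD in_set_dropD set_take_disj_set_drop_if_distinct),
        metis Un_iff append_take_drop_id set_append)
  also have "\<dots> = (\<Sum>B\<in>Pow X. \<Sum>(l1,l2)\<in>permutations_of_set B \<times> permutations_of_set (X - B).
      a (jumps rk A l1) * b (jumps rk (A \<union> B) l2))"
    using assms by (subst sum.Sigma) auto
  also have "\<dots> = (\<Sum>B\<in>Pow X. flag_sum rk A B a * flag_sum rk (A \<union> B) (X - B) b)"
    unfolding flag_sum_def sum_product sum.cartesian_product ..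
  finally show ?thesis .
qed

text \<open>The orderings of a disjoint union are the shuffles of orderings of the parts. The
  induction removes the first element, which lies in one of the two parts.\<close>

lemma sum_permutations_of_set_Un:
  fixes g :: "'a list \<Rightarrow> 'b::comm_monoid_add"
  assumes "finite A" "finite B" "A \<inter> B = {}"
  shows "(\<Sum>l\<in>permutations_of_set (A \<union> B). g l) =
    (\<Sum>l1\<in>permutations_of_set A. \<Sum>l2\<in>permutations_of_set B. shuffle_sum g l1 l2)"
  using assms
proof (induction "card A + card B" arbitrary: A B g rule: less_induct)
  case less
  have split: "(\<Sum>l\<in>permutations_of_set X. h l) =
      (\<Sum>x\<in>X. \<Sum>l\<in>permutations_of_set (X - {x}). h (x # l))" if "X \<noteq> {}" "finite X"
    for X :: "'a set" and h :: "'a list \<Rightarrow> 'b"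
  proof -
    have "(\<Sum>l\<in>permutations_of_set X. h l) =
        (\<Sum>x\<in>X. sum h ((\<lambda>l. x # l) ` permutations_of_set (X - {x})))"
      unfolding permutations_of_set_nonempty[OF that(1)] using that(2)
      by (intro sum.UNION_disjoint) auto
    also have "\<dots> = (\<Sum>x\<in>X. \<Sum>l\<in>permutations_of_set (X - {x}). h (x # l))"
      by (simp add: sum.reindex)
    finally show ?thesis .
  qed
  show ?case
  proof (cases "A = {} \<or> B = {}")
    case True
    then show ?thesis by auto
  next
    case False
    have "(\<Sum>l\<in>permutations_of_set (A \<union> B). g l) =
      (\<Sum>x\<in>A. \<Sum>l\<in>permutations_of_set (A \<union> B - {x}). g (x # l)) +
      (\<Sum>x\<in>B. \<Sum>l\<in>permutations_of_set (A \<union> B - {x}). g (x # l))"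
      using False less.prems by (subst split) (auto simp: sum.union_disjoint)
    also have "(\<Sum>x\<in>A. \<Sum>l\<in>permutations_of_set (A \<union> B - {x}). g (x # l)) =
      (\<Sum>x\<in>A. \<Sum>l1\<in>permutations_of_set (A - {x}). \<Sum>l2\<in>permutations_of_set B. shuffle_sum (\<lambda>w. g (x # w)) l1 l2)"
    proof (rule sum.cong[OF refl])
      fix x assume x: "x \<in> A"
      have *: "A \<union> B - {x} = (A - {x}) \<union> B" using x less.prems by auto
      have "card (A - {x}) < card A" using x less.prems by (intro card_Diff1_less)
      then show "(\<Sum>l\<in>permutations_of_set (A \<union> B - {x}). g (x # l)) =
          (\<Sum>l1\<in>permutations_of_set (A - {x}). \<Sum>l2\<in>permutations_of_set B. shuffle_sum (\<lambda>w. g (x # w)) l1 l2)"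
        unfolding * using less.prems by (intro less.hyps) auto
    qed
    also have "(\<Sum>x\<in>B. \<Sum>l\<in>permutations_of_set (A \<union> B - {x}). g (x # l)) =
      (\<Sum>y\<in>B. \<Sum>l1\<in>permutations_of_set A. \<Sum>l2\<in>permutations_of_set (B - {y}). shuffle_sum (\<lambda>w. g (y # w)) l1 l2)"
    proof (rule sum.cong[OF refl])
      fix x assume x: "x \<in> B"
      have *: "A \<union> B - {x} = A \<union> (B - {x})" using x less.prems by auto
      have "card (B - {x}) < card B" using x less.prems by (intro card_Diff1_less)
      then show "(\<Sum>l\<in>permutations_of_set (A \<union> B - {x}). g (x # l)) =
          (\<Sum>l1\<in>permutations_of_set A. \<Sum>l2\<in>permutations_of_set (B - {x}). shuffle_sum (\<lambda>w. g (x # w)) l1 l2)"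
        unfolding * using less.prems by (intro less.hyps) auto
    qed
    \<comment> \<open>The chosen first element and an ordering of the rest are merged back into one
      ordering, with the element as its head.\<close>
    also have "(\<Sum>x\<in>A. \<Sum>l1\<in>permutations_of_set (A - {x}). \<Sum>l2\<in>permutations_of_set B. shuffle_sum (\<lambda>w. g (x # w)) l1 l2) =
       (\<Sum>l1\<in>permutations_of_set A. \<Sum>l2\<in>permutations_of_set B. shuffle_sum (\<lambda>w. g (hd l1 # w)) (tl l1) l2)"
      using False less.prems split[of A "\<lambda>l1. \<Sum>l2\<in>permutations_of_set B. shuffle_sum (\<lambda>w. g (hd l1 # w)) (tl l1) l2"]
      by simp
    also have "(\<Sum>y\<in>B. \<Sum>l1\<in>permutations_of_set A. \<Sum>l2\<in>permutations_of_set (B - {y}). shuffle_sum (\<lambda>w. g (y # w)) l1 l2) =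
       (\<Sum>l1\<in>permutations_of_set A. \<Sum>l2\<in>permutations_of_set B. shuffle_sum (\<lambda>w. g (hd l2 # w)) l1 (tl l2))"
      using False less.prems split[of B "\<lambda>l2. shuffle_sum (\<lambda>w. g (hd l2 # w)) _ (tl l2)"]
      by (subst sum.swap) simp
    finally show ?thesis
      unfolding sum.distrib[symmetric]
    proof (rule trans, intro sum.cong refl)
      fix l1 l2 assume "l1 \<in> permutations_of_set A" "l2 \<in> permutations_of_set B"
      then have "l1 \<noteq> []" "l2 \<noteq> []" using False by (auto dest: permutations_of_setD)
      then show "shuffle_sum (\<lambda>w. g (hd l1 # w)) (tl l1) l2 + shuffle_sum (\<lambda>w. g (hd l2 # w)) l1 (tl l2) = shuffle_sum g l1 l2"
        by (cases l1; cases l2) auto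
    qed
  qed
qed

text \<open>The hypothesis says that above \<open>C\<close> the rank splits along the two lists. A
  step in one list then leaves the later jumps along the other unchanged, so shuffling flags
  shuffles their words.\<close>

lemma shuffle_sum_jumps:
  assumes "\<And>S T. S \<subseteq> set l1 \<Longrightarrow> T \<subseteq> set l2 \<Longrightarrow> rk (C \<union> S \<union> T) + rk C = rk (C \<union> S) + rk (C \<union> T)"
  shows "shuffle_sum (\<lambda>l. a (jumps rk C l)) l1 l2 = shuffle_sum a (jumps rk C l1) (jumps rk C l2)"
  using assms
proof (induction "length l1 + length l2" arbitrary: a C l1 l2 rule: less_induct)
  case less
  show ?case
  proof (cases "l1 = [] \<or> l2 = []")
    case False
    then obtain x l1' y l2' where l: "l1 = x # l1'" "l2 = y # l2'" by (meson list.exhaust)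
    note H = less.prems[unfolded l]
    have 1: "shuffle_sum (\<lambda>l. a (jumps rk C (x # l))) l1' l2 =
        shuffle_sum (\<lambda>w. a ((rk (insert x C) - rk C) # w)) (jumps rk (insert x C) l1') (jumps rk (insert x C) l2)"
    proof (simp, rule less.hyps)
      fix S T assume "S \<subseteq> set l1'" "T \<subseteq> set l2"
      then show "rk (insert x C \<union> S \<union> T) + rk (insert x C) = rk (insert x C \<union> S) + rk (insert x C \<union> T)"
        using H[of "insert x S" T] H[of "{x}" T] by (simp add: l insert_commute subset_insertI2)
    qed (simp add: l)
    have 2: "shuffle_sum (\<lambda>l. a (jumps rk C (y # l))) l1 l2' =
        shuffle_sum (\<lambda>w. a ((rk (insert y C) - rk C) # w)) (jumps rk (insert y C) l1) (jumps rk (insert y C) l2')"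
    proof (simp, rule less.hyps)
      fix S T assume "S \<subseteq> set l1" "T \<subseteq> set l2'"
      then show "rk (insert y C \<union> S \<union> T) + rk (insert y C) = rk (insert y C \<union> S) + rk (insert y C \<union> T)"
        using H[of S "insert y T"] H[of S "{y}"] by (simp add: l insert_commute subset_insertI2)
    qed (simp add: l)
    have 3: "jumps rk (insert x C) l2 = jumps rk C l2"
    proof (rule jumps_map[of l2 rk "insert x C" id "rk C" rk C "rk (insert x C)", simplified])
      fix S assume "S \<subseteq> set l2"
      then show "rk (insert x (C \<union> S)) + rk C = rk (C \<union> S) + rk (insert x C)"
        using H[of "{x}" S] by (simp add: l)
    qed
    have 4: "jumps rk (insert y C) l1 = jumps rk C l1"
    proof (rule jumps_map[of l1 rk "insert y C" id "rk C" rk C "rk (insert y C)", simplified])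
      fix S assume "S \<subseteq> set l1"
      then show "rk (insert y (C \<union> S)) + rk C = rk (C \<union> S) + rk (insert y C)"
        using H[of S "{y}"] by (simp add: l)
    qed
    have "shuffle_sum (\<lambda>l. a (jumps rk C l)) l1 l2 =
        shuffle_sum (\<lambda>l. a (jumps rk C (x # l))) l1' l2 + shuffle_sum (\<lambda>l. a (jumps rk C (y # l))) l1 l2'"
      by (simp add: l)
    also have "\<dots> = shuffle_sum a (jumps rk C l1) (jumps rk C l2)"
      unfolding 1 2 3 4 by (simp add: l)
    finally show ?thesis .
  qed auto
qed

lemma flag_sum_separable:
  assumes rk: "polymatroid X rk" and A: "A \<subseteq> X" "rk A + rk (X - A) = rk X"
  shows "flag_sum rk {} X a =
    (\<Sum>l1\<in>permutations_of_set A. \<Sum>l2\<in>permutations_of_set (X - A). shuffle_sum a (jumps rk {} l1) (jumps rk {} l2))"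
proof -
  have fin: "finite A" "finite (X - A)" and X: "X = A \<union> (X - A)"
    using polymatroidD(1)[OF rk] A by (auto intro: finite_subset)
  have "flag_sum rk {} X a = (\<Sum>l\<in>permutations_of_set (A \<union> (X - A)). a (jumps rk {} l))"
    using X by (simp add: flag_sum_def)
  also have "\<dots> = (\<Sum>l1\<in>permutations_of_set A. \<Sum>l2\<in>permutations_of_set (X - A). shuffle_sum (\<lambda>l. a (jumps rk {} l)) l1 l2)"
    using fin by (intro sum_permutations_of_set_Un) auto
  also have "\<dots> = (\<Sum>l1\<in>permutations_of_set A. \<Sum>l2\<in>permutations_of_set (X - A). shuffle_sum a (jumps rk {} l1) (jumps rk {} l2))"
  proof (intro sum.cong refl shuffle_sum_jumps)
    fix l1 l2 S T
    assume "l1 \<in> permutations_of_set A" "l2 \<in> permutations_of_set (X - A)" "S \<subseteq> set l1" "T \<subseteq> set l2"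
    then have ST: "S \<subseteq> A" "T \<subseteq> X - A" using permutations_of_setD(1) by metis+
    then have "(S \<union> T) \<inter> A = S" "S \<union> T - A = T" by auto
    moreover have "S \<union> T \<subseteq> X" using ST A by auto
    ultimately show "rk ({} \<union> S \<union> T) + rk {} = rk ({} \<union> S) + rk ({} \<union> T)"
      using separable_rank[OF rk A, of "S \<union> T"] polymatroidD(2)[OF rk] by simp
  qed
  finally show ?thesis .
qed

text \<open>The rank function of the polytope cut out of the box \<open>[0, m]\<^sup>D\<close> by the constraints
  \<open>y(B) \<le> \<rho>(B)\<close> for \<open>B\<close> in a chain \<open>\<B>\<close>.\<close>

definition chain_rank :: "nat \<Rightarrow> nat set \<Rightarrow> nat set set \<Rightarrow> (nat set \<Rightarrow> nat) \<Rightarrow> rank_fun" where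
  "chain_rank m D \<B> \<rho> = restrict (\<lambda>S. Min ((\<lambda>B. \<rho> B + m * card (S - B)) ` \<B>)) (Pow D)"

lemma chain_rank_le:
  assumes "finite D" "\<B> \<subseteq> Pow D" "B \<in> \<B>" "S \<subseteq> D"
  shows "chain_rank m D \<B> \<rho> S \<le> \<rho> B + m * card (S - B)"
  using assms unfolding chain_rank_def by (auto intro!: Min_le finite_subset[OF assms(2)])

lemma chain_rank_attained:
  assumes "finite D" "\<B> \<subseteq> Pow D" "\<B> \<noteq> {}" "S \<subseteq> D"
  obtains B where "B \<in> \<B>" "chain_rank m D \<B> \<rho> S = \<rho> B + m * card (S - B)"
proof -
  have "finite \<B>" using assms finite_subset by blast
  then have "Min ((\<lambda>B. \<rho> B + m * card (S - B)) ` \<B>) \<in> (\<lambda>B. \<rho> B + m * card (S - B)) ` \<B>"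
    using assms by (intro Min_in) auto
  then show thesis using that assms(4) unfolding chain_rank_def by auto
qed

text \<open>For submodularity, let B and C attain the minimum for S and T. They are comparable; the
  larger one is used to bound the union, the smaller one to bound the intersection. The bound on
  singletons comes from the empty member of the chain.\<close>

lemma chain_rank_polymatroid:
  assumes D: "finite D" and B: "\<B> \<subseteq> Pow D" "{} \<in> \<B>"
    and chain: "\<And>B C. B \<in> \<B> \<Longrightarrow> C \<in> \<B> \<Longrightarrow> B \<subseteq> C \<or> C \<subseteq> B" and \<rho>: "\<rho> {} = 0"
  shows "polymatroid D (chain_rank m D \<B> \<rho>)" "i \<in> D \<Longrightarrow> chain_rank m D \<B> \<rho> {i} \<le> m"
proof -
  let ?r = "chain_rank m D \<B> \<rho>"
  have ne: "\<B> \<noteq> {}" using B by auto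
  show "i \<in> D \<Longrightarrow> ?r {i} \<le> m" using chain_rank_le[OF D B(1,2), of "{i}" m \<rho>] \<rho> by simp
  show "polymatroid D ?r"
    unfolding polymatroid_def
  proof (intro conjI allI impI)
    show "?r \<in> extensional (Pow D)" by (simp add: chain_rank_def)
    show "?r {} = 0" using chain_rank_le[OF D B(1,2), of "{}" m \<rho>] \<rho> by simp
  next
    fix S T assume ST: "S \<subseteq> T \<and> T \<subseteq> D"
    then have fin: "finite T" using D finite_subset by blast
    obtain B where B': "B \<in> \<B>" "?r T = \<rho> B + m * card (T - B)"
      using chain_rank_attained[OF D B(1) ne] ST by blast
    have "?r S \<le> \<rho> B + m * card (S - B)" using ST by (intro chain_rank_le D B B') auto
    also have "\<dots> \<le> ?r T" unfolding B' using ST fin by (intro add_left_mono mult_le_mono card_mono) auto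
    finally show "?r S \<le> ?r T" .
  next
    have *: "?r (S \<union> T) + ?r (S \<inter> T) \<le> ?r S + ?r T"
      if ST: "S \<subseteq> D" "T \<subseteq> D" and BS: "B \<in> \<B>" "?r S = \<rho> B + m * card (S - B)"
        and CT: "C \<in> \<B>" "?r T = \<rho> C + m * card (T - C)" and BC: "B \<subseteq> C" for S T B C
    proof -
      have fin: "finite S" "finite T" using ST D finite_subset by auto
      have "S - B = (S - C) \<union> (S \<inter> (C - B))" using BC by auto
      then have 1: "card (S - B) = card (S - C) + card (S \<inter> (C - B))"
        using fin by (simp add: card_Un_disjoint disjoint_iff)
      have "(S \<inter> T) - B = ((S \<inter> T) - C) \<union> (S \<inter> T \<inter> (C - B))" using BC by auto
      then have "card ((S \<inter> T) - B) = card ((S \<inter> T) - C) + card (S \<inter> T \<inter> (C - B))"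
        using fin by (subst card_Un_disjoint[symmetric]) auto
      moreover have "card (S \<inter> T \<inter> (C - B)) \<le> card (S \<inter> (C - B))" using fin by (intro card_mono) auto
      ultimately have 2: "card ((S \<inter> T) - B) \<le> card ((S \<inter> T) - C) + card (S \<inter> (C - B))" by simp
      have "card (S - C) + card (T - C) = card ((S - C) \<union> (T - C)) + card ((S - C) \<inter> (T - C))"
        using fin by (intro card_Un_Int) auto
      then have 3: "card (S - C) + card (T - C) = card ((S \<union> T) - C) + card ((S \<inter> T) - C)"
        by (simp add: Un_Diff Diff_Int_distrib2 Int_Diff)
      have "?r (S \<union> T) + ?r (S \<inter> T) \<le>
          (\<rho> C + m * card ((S \<union> T) - C)) + (\<rho> B + m * card ((S \<inter> T) - B))"
        using ST by (intro add_mono chain_rank_le D B BS CT) auto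
      also have "\<dots> = \<rho> B + \<rho> C + m * (card ((S \<union> T) - C) + card ((S \<inter> T) - B))"
        by (simp add: algebra_simps)
      also have "\<dots> \<le> \<rho> B + \<rho> C + m * (card (S - B) + card (T - C))"
        using 1 2 3 by (intro add_left_mono mult_le_mono2) simp
      also have "\<dots> = ?r S + ?r T" unfolding BS CT by (simp add: algebra_simps)
      finally show ?thesis .
    qed
    fix S T assume ST: "S \<subseteq> D \<and> T \<subseteq> D"
    obtain B where BS: "B \<in> \<B>" "?r S = \<rho> B + m * card (S - B)"
      using chain_rank_attained[OF D B(1) ne] ST by blast
    obtain C where CT: "C \<in> \<B>" "?r T = \<rho> C + m * card (T - C)"
      using chain_rank_attained[OF D B(1) ne] ST by blast
    from chain[OF BS(1) CT(1)] show "?r (S \<union> T) + ?r (S \<inter> T) \<le> ?r S + ?r T"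
    proof
      assume "B \<subseteq> C"
      then show ?thesis using *[OF _ _ BS CT] ST by blast
    next
      assume "C \<subseteq> B"
      then show ?thesis using *[OF _ _ CT BS] ST by (simp add: Un_commute Int_commute add.commute)
    qed
  qed (rule D)
qed

text \<open>The hypothesis on \<rho> says that giving the value \<open>m\<close> to every element
  outside \<open>B\<close> suffices to reach the total, so the cube does not lower the rank.\<close>

lemma chain_rank_top:
  assumes D: "finite D" and B: "\<B> \<subseteq> Pow D" "D \<in> \<B>"
    and \<rho>: "\<And>B. B \<in> \<B> \<Longrightarrow> \<rho> D \<le> \<rho> B + m * card (D - B)"
  shows "chain_rank m D \<B> \<rho> D = \<rho> D"
proof (rule antisym)
  show "chain_rank m D \<B> \<rho> D \<le> \<rho> D" using chain_rank_le[OF D B, of D m \<rho>] by simp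
  obtain B where "B \<in> \<B>" "chain_rank m D \<B> \<rho> D = \<rho> B + m * card (D - B)"
    using chain_rank_attained[OF D B(1), of D] B(2) by blast
  then show "\<rho> D \<le> chain_rank m D \<B> \<rho> D" using \<rho> by simp
qed

text \<open>The greedy vertex of Edmonds: each element receives the rank jump at its place in
  \<open>l\<close>. For a set that contains the last element, the inequality is submodularity of
  that set against the preceding initial segment.\<close>

lemma greedy_vertex:
  assumes rk: "polymatroid X rk" and "distinct l" "set l \<subseteq> X"
  shows "\<exists>y::nat \<Rightarrow> real. (\<forall>i. i \<notin> set l \<longrightarrow> y i = 0) \<and> (\<forall>A\<subseteq>set l. sum y A \<le> real (rk A)) \<and>
    (\<forall>k\<le>length l. sum y (set (take k l)) = real (rk (set (take k l))))"
  using assms(2-)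
proof (induction l rule: rev_induct)
  case Nil
  then show ?case using polymatroidD(2)[OF rk] by auto
next
  case (snoc x l)
  then obtain y :: "nat \<Rightarrow> real" where y: "\<And>i. i \<notin> set l \<Longrightarrow> y i = 0" "\<And>A. A \<subseteq> set l \<Longrightarrow> sum y A \<le> real (rk A)"
    "\<And>k. k \<le> length l \<Longrightarrow> sum y (set (take k l)) = real (rk (set (take k l)))" by auto
  define y' where "y' = y(x := real (rk (insert x (set l))) - real (rk (set l)))"
  have x: "x \<notin> set l" using snoc.prems by simp
  have same: "sum y' A = sum y A" if "A \<subseteq> set l" for A
    unfolding y'_def using that x by (intro sum.cong) auto
  have upd: "sum y' (insert x A) = real (rk (insert x (set l))) - real (rk (set l)) + sum y A"
    if "A \<subseteq> set l" for A
    using that x finite_subset[OF that] same[OF that] by (subst sum.insert) (auto simp: y'_def)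
  show ?case
  proof (intro exI[of _ y'] conjI allI impI)
    fix i assume "i \<notin> set (l @ [x])"
    then show "y' i = 0" using y(1) by (simp add: y'_def)
  next
    fix A assume A: "A \<subseteq> set (l @ [x])"
    show "sum y' A \<le> real (rk A)"
    proof (cases "x \<in> A")
      case False
      then have "A \<subseteq> set l" using A by auto
      then show ?thesis using same y(2) by simp
    next
      case True
      define B where "B = A - {x}"
      have B: "B \<subseteq> set l" "A = insert x B" using A True by (auto simp: B_def)
      have "rk (A \<union> set l) + rk (A \<inter> set l) \<le> rk A + rk (set l)"
        using A snoc.prems by (intro polymatroidD(5)[OF rk]) auto
      moreover have "A \<union> set l = insert x (set l)" "A \<inter> set l = B" using B x by auto
      ultimately have "real (rk (insert x (set l))) + real (rk B) \<le> real (rk A) + real (rk (set l))"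
        by (metis of_nat_add of_nat_le_iff)
      then show ?thesis using upd[OF B(1)] y(2)[OF B(1)] B(2) by simp
    qed
  next
    fix k assume "k \<le> length (l @ [x])"
    then consider "k \<le> length l" | "k = Suc (length l)" by fastforce
    then show "sum y' (set (take k (l @ [x]))) = real (rk (set (take k (l @ [x]))))"
    proof cases
      case 1
      then show ?thesis using y(3) same[of "set (take k l)"] set_take_subset[of k l] by simp
    next
      case 2
      then show ?thesis using upd[of "set l"] y(3)[of "length l"] by simp
    qed
  qed
qed

section \<open>Valuative invariants as functions of rank functions\<close>

lemma comm_group_additive_group: "comm_group (additive_group :: 'a::ab_group_add monoid)"
proof (rule comm_groupI)
  show "\<exists>y\<in>carrier additive_group. y \<otimes>\<^bsub>additive_group\<^esub> x = \<one>\<^bsub>additive_group\<^esub>"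
    for x :: 'a by (rule bexI[of _ "- x"]) (auto simp: additive_group_def)
qed (auto simp: additive_group_def add_ac)

lemma inv_additive_group: "inv\<^bsub>additive_group\<^esub> x = - (x :: 'a::ab_group_add)"
proof -
  interpret comm_group "additive_group :: 'a monoid" by (rule comm_group_additive_group)
  show ?thesis by (rule inv_equality) (auto simp: additive_group_def)
qed

lemma additive_group_simps [simp]:
  "carrier additive_group = UNIV" "x \<otimes>\<^bsub>additive_group\<^esub> y = x + y" "\<one>\<^bsub>additive_group\<^esub> = 0"
  by (auto simp: additive_group_def)

lemma P_group_simps:
  "carrier (P_group K d r) = generate additive_group (base_indicator d ` of_bidegree K d r)"
  "mult (P_group K d r) = mult additive_group" "one (P_group K d r) = one additive_group"
  by (simp_all add: P_group_def carrier_subgroup_generated subgroup_generated_def)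

lemma comm_group_P_group: "comm_group (P_group K d r)"
proof -
  interpret comm_group "additive_group :: ((nat \<Rightarrow> real) \<Rightarrow> int) monoid"
    by (rule comm_group_additive_group)
  show ?thesis unfolding P_group_def by (rule abelian_subgroup_generated) (rule comm_group_axioms)
qed

lemma P_group_closed:
  shows "0 \<in> carrier (P_group K d r)"
    "g \<in> carrier (P_group K d r) \<Longrightarrow> h \<in> carrier (P_group K d r) \<Longrightarrow> g + h \<in> carrier (P_group K d r)"
    "g \<in> carrier (P_group K d r) \<Longrightarrow> - g \<in> carrier (P_group K d r)"
    "rk \<in> of_bidegree K d r \<Longrightarrow> base_indicator d rk \<in> carrier (P_group K d r)"
proof -
  interpret comm_group "additive_group :: ((nat \<Rightarrow> real) \<Rightarrow> int) monoid"
    by (rule comm_group_additive_group)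
  have sub: "subgroup (carrier (P_group K d r)) additive_group"
    unfolding P_group_simps by (rule generate_is_subgroup) simp
  show "0 \<in> carrier (P_group K d r)" using subgroup.one_closed[OF sub] by simp
  show "g + h \<in> carrier (P_group K d r)" if "g \<in> carrier (P_group K d r)" "h \<in> carrier (P_group K d r)"
    using subgroup.m_closed[OF sub that] by simp
  show "- g \<in> carrier (P_group K d r)" if "g \<in> carrier (P_group K d r)"
    using subgroup.m_inv_closed[OF sub that] by (simp add: inv_additive_group)
  show "base_indicator d rk \<in> carrier (P_group K d r)" if "rk \<in> of_bidegree K d r"
    unfolding P_group_simps using that by (intro generate.incl) auto
qed

text \<open>Unlike plain composition with the permutation, the result is extensional and hence again
  a member of the class.\<close>

definition relabel :: "nat \<Rightarrow> (nat \<Rightarrow> nat) \<Rightarrow> rank_fun \<Rightarrow> rank_fun" where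
  "relabel d \<sigma> rk = restrict (\<lambda>A. rk (\<sigma> ` A)) (Pow {1..d})"

lemma base_indicator_cong:
  assumes "\<And>A. A \<subseteq> {1..d} \<Longrightarrow> rk A = rk' A"
  shows "base_indicator d rk = base_indicator d rk'"
proof -
  have "base_polytope d rk = base_polytope d rk'" unfolding base_polytope_def using assms by auto
  then show ?thesis by (simp add: base_indicator_def)
qed

lemma base_indicator_relabel:
  "base_indicator d (\<lambda>A. rk (\<sigma> ` A)) = base_indicator d (relabel d \<sigma> rk)"
  by (rule base_indicator_cong) (simp add: relabel_def)

lemma polymatroid_pullback:
  assumes rk: "polymatroid X rk" and \<beta>: "inj_on \<beta> Y" "\<beta> ` Y \<subseteq> X" and Y: "finite Y"
  shows "polymatroid Y (restrict (\<lambda>A. rk (\<beta> ` A)) (Pow Y))"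
  unfolding polymatroid_def
proof (intro conjI allI impI)
  fix A B assume "A \<subseteq> B \<and> B \<subseteq> Y"
  then have "A \<subseteq> Y" "B \<subseteq> Y" "\<beta> ` A \<subseteq> \<beta> ` B" "\<beta> ` B \<subseteq> X" using \<beta>(2) by auto
  then show "restrict (\<lambda>A. rk (\<beta> ` A)) (Pow Y) A \<le> restrict (\<lambda>A. rk (\<beta> ` A)) (Pow Y) B"
    using polymatroidD(4)[OF rk] by simp
next
  fix A B assume AB: "A \<subseteq> Y \<and> B \<subseteq> Y"
  then have "\<beta> ` (A \<inter> B) = \<beta> ` A \<inter> \<beta> ` B" by (intro inj_on_image_Int[OF \<beta>(1)]) auto
  moreover have "\<beta> ` A \<subseteq> X" "\<beta> ` B \<subseteq> X" using AB \<beta>(2) by auto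
  moreover have "A \<union> B \<subseteq> Y" "A \<inter> B \<subseteq> Y" using AB by auto
  ultimately show "restrict (\<lambda>A. rk (\<beta> ` A)) (Pow Y) (A \<union> B) + restrict (\<lambda>A. rk (\<beta> ` A)) (Pow Y) (A \<inter> B)
      \<le> restrict (\<lambda>A. rk (\<beta> ` A)) (Pow Y) A + restrict (\<lambda>A. rk (\<beta> ` A)) (Pow Y) B"
    using AB polymatroidD(5)[OF rk, of "\<beta> ` A" "\<beta> ` B"] by (simp add: image_Un)
qed (use Y polymatroidD(2)[OF rk] in auto)

text \<open>Matroids are the case \<open>J = {0, 1}\<close>, polymatroids the case
  \<open>J = UNIV\<close>. Closure of \<open>J\<close> under smaller numbers covers contraction,
  which can only lower the ranks of singletons, and truncation by a cube with side in
  \<open>J\<close>.\<close>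

locale singleton_rank_class =
  fixes K :: rank_class and J :: "nat set"
  assumes K_iff: "K X rk \<longleftrightarrow> polymatroid X rk \<and> (\<forall>i\<in>X. rk {i} \<in> J)"
    and zero_J: "0 \<in> J"
    and down_J: "j \<in> J \<Longrightarrow> i \<le> j \<Longrightarrow> i \<in> J"
begin

lemma pullback_of_bidegree:
  assumes \<beta>: "bij_betw \<beta> {1..d} X" and rk: "K X rk"
  shows "restrict (\<lambda>A. rk (\<beta> ` A)) (Pow {1..d}) \<in> of_bidegree K d (rk X)"
proof -
  have X: "\<beta> ` {1..d} = X" and inj: "inj_on \<beta> {1..d}" using \<beta> by (auto simp: bij_betw_def)
  have "polymatroid {1..d} (restrict (\<lambda>A. rk (\<beta> ` A)) (Pow {1..d}))"
    using rk inj equalityD1[OF X] by (intro polymatroid_pullback) (simp_all add: K_iff)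
  moreover have "restrict (\<lambda>A. rk (\<beta> ` A)) (Pow {1..d}) {i} \<in> J" if "i \<in> {1..d}" for i
    using rk that X by (auto simp: K_iff)
  ultimately show ?thesis using X by (simp add: of_bidegree_def K_iff)
qed

lemma relabel_of_bidegree:
  assumes "rk \<in> of_bidegree K d r" "\<sigma> permutes {1..d}"
  shows "relabel d \<sigma> rk \<in> of_bidegree K d r"
  using pullback_of_bidegree[OF permutes_imp_bij[OF assms(2)]] assms(1)
  by (auto simp: relabel_def of_bidegree_def)

lemma normal_sym_relations: "sym_relations K d r \<lhd> P_group K d r"
proof -
  interpret A: comm_group "additive_group :: ((nat \<Rightarrow> real) \<Rightarrow> int) monoid"
    by (rule comm_group_additive_group)
  interpret P: comm_group "P_group K d r" by (rule comm_group_P_group)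
  let ?R = "{base_indicator d rk - base_indicator d (\<lambda>A. rk (\<sigma> ` A)) | rk \<sigma>.
          rk \<in> of_bidegree K d r \<and> \<sigma> permutes {1..d}}"
  have subP: "subgroup (carrier (P_group K d r)) additive_group"
    unfolding P_group_simps by (rule A.generate_is_subgroup) simp
  have "?R \<subseteq> carrier (P_group K d r)"
  proof clarify
    fix rk \<sigma> assume *: "rk \<in> of_bidegree K d r" "\<sigma> permutes {1..d}"
    show "base_indicator d rk - base_indicator d (\<lambda>A. rk (\<sigma> ` A)) \<in> carrier (P_group K d r)"
      unfolding base_indicator_relabel diff_conv_add_uminus
      using * relabel_of_bidegree by (intro P_group_closed) auto
  qed
  then have "sym_relations K d r \<subseteq> carrier (P_group K d r)"
    unfolding sym_relations_def by (rule A.generate_subgroup_incl[OF _ subP])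
  moreover have "subgroup (sym_relations K d r) additive_group"
    unfolding sym_relations_def by (rule A.generate_is_subgroup) simp
  ultimately have "subgroup (sym_relations K d r) (additive_group\<lparr>carrier := carrier (P_group K d r)\<rparr>)"
    using A.subgroup_incl[OF _ subP] by blast
  also have "additive_group\<lparr>carrier := carrier (P_group K d r)\<rparr> = P_group K d r"
    by (simp add: P_group_def carrier_subgroup_generated subgroup_generated_def)
  finally show ?thesis by (simp add: P.normal_iff_subgroup)
qed

text \<open>The hypothesis \<open>lin\<close> lets \<open>f\<close> descend to the group generated
  by the indicators, \<open>sym\<close> makes the induced map vanish on the symmetry relations, and
  the universal property of the quotient does the rest.\<close>

lemma valuative_invariantsI:
  assumes off: "\<And>rk. rk \<notin> of_bidegree K d r \<Longrightarrow> f rk = 0"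
    and lin: "\<And>I c. finite I \<Longrightarrow> I \<subseteq> of_bidegree K d r \<Longrightarrow>
        (\<And>y. (\<Sum>rk\<in>I. c rk * base_indicator d rk y) = 0) \<Longrightarrow> (\<Sum>rk\<in>I. of_int (c rk) * f rk) = 0"
    and sym: "\<And>rk \<sigma>. rk \<in> of_bidegree K d r \<Longrightarrow> \<sigma> permutes {1..d} \<Longrightarrow> f (relabel d \<sigma> rk) = f rk"
  shows "f \<in> valuative_invariants K d r"
proof -
  \<comment> \<open>The relation \<open>rep g v\<close> holds if \<open>g\<close> is an integer
    combination of base indicators and \<open>v\<close> the same combination of values of
    \<open>f\<close>. By \<open>lin\<close> it is functional, so no combination has to be chosen for
    \<open>g\<close>.\<close>
  define rep_by where "rep_by = (\<lambda>I c g v. finite I \<and> I \<subseteq> of_bidegree K d r \<and>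
      g = (\<lambda>y. \<Sum>rk\<in>I. c rk * base_indicator d rk y) \<and> v = (\<Sum>rk\<in>I. of_int (c rk) * f rk))"
  define rep where "rep = (\<lambda>g v. \<exists>I c. rep_by I c g v)"
  have repI: "rep g v" if "finite I" "I \<subseteq> of_bidegree K d r"
      "g = (\<lambda>y. \<Sum>rk\<in>I. c rk * base_indicator d rk y)" "v = (\<Sum>rk\<in>I. of_int (c rk) * f rk)"
    for g v I c
    unfolding rep_def rep_by_def using that by (intro exI conjI)
  have rep_add: "rep (g + h) (v + w)" if gv: "rep g v" and hw: "rep h w" for g h v w
  proof -
    obtain I c where I: "finite I" "I \<subseteq> of_bidegree K d r"
      "g = (\<lambda>y. \<Sum>rk\<in>I. c rk * base_indicator d rk y)" "v = (\<Sum>rk\<in>I. of_int (c rk) * f rk)"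
      using gv unfolding rep_def rep_by_def by blast
    obtain I' c' where I': "finite I'" "I' \<subseteq> of_bidegree K d r"
      "h = (\<lambda>y. \<Sum>rk\<in>I'. c' rk * base_indicator d rk y)" "w = (\<Sum>rk\<in>I'. of_int (c' rk) * f rk)"
      using hw unfolding rep_def rep_by_def by blast
    let ?c = "\<lambda>rk. (if rk \<in> I then c rk else 0) + (if rk \<in> I' then c' rk else 0)"
    have *: "(\<Sum>rk\<in>I \<union> I'. (if rk \<in> I then F rk else 0) + (if rk \<in> I' then F' rk else 0)) = sum F I + sum F' I'"
      for F F' :: "rank_fun \<Rightarrow> 'a::comm_monoid_add"
      using I(1) I'(1) by (simp add: sum.distrib sum.inter_restrict[symmetric] Int_absorb1 Int_absorb2)
    have "g + h = (\<lambda>y. \<Sum>rk\<in>I \<union> I'. ?c rk * base_indicator d rk y)"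
    proof
      fix y
      show "(g + h) y = (\<Sum>rk\<in>I \<union> I'. ?c rk * base_indicator d rk y)"
        unfolding I I' plus_fun_apply by (subst *[symmetric]) (auto intro!: sum.cong simp: distrib_right)
    qed
    moreover have "v + w = (\<Sum>rk\<in>I \<union> I'. of_int (?c rk) * f rk)"
      unfolding I I' by (subst *[symmetric]) (auto intro!: sum.cong simp: distrib_right)
    ultimately show ?thesis
      using I(1,2) I'(1,2) by (intro repI[of "I \<union> I'" _ ?c]) auto
  qed
  have rep_uminus: "rep (- g) (- v)" if gv: "rep g v" for g v
  proof -
    obtain I c where I: "finite I" "I \<subseteq> of_bidegree K d r"
      "g = (\<lambda>y. \<Sum>rk\<in>I. c rk * base_indicator d rk y)" "v = (\<Sum>rk\<in>I. of_int (c rk) * f rk)"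
      using gv unfolding rep_def rep_by_def by blast
    then show ?thesis
      by (intro repI[of I _ "\<lambda>rk. - c rk"]) (auto simp: sum_negf fun_eq_iff)
  qed
  have rep_zero: "rep 0 0" by (rule repI[of "{}"]) auto
  have rep_base: "rep (base_indicator d rk) (f rk)" if "rk \<in> of_bidegree K d r" for rk
    using that by (intro repI[of "{rk}" _ "\<lambda>_. 1"]) auto
  have rep_unique: "v = w" if vw: "rep g v" "rep g w" for g v w
  proof -
    have "rep (g + - g) (v + - w)" by (intro rep_add rep_uminus vw)
    then obtain I c where I: "finite I" "I \<subseteq> of_bidegree K d r"
      "g + - g = (\<lambda>y. \<Sum>rk\<in>I. c rk * base_indicator d rk y)" "v + - w = (\<Sum>rk\<in>I. of_int (c rk) * f rk)"
      unfolding rep_def rep_by_def by blast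
    have "(\<Sum>rk\<in>I. c rk * base_indicator d rk y) = 0" for y
      using fun_cong[OF I(3), of y] by simp
    then have "v + - w = 0" unfolding I(4) by (intro lin I)
    then show ?thesis by simp
  qed
  have rep_carrier: "\<exists>v. rep g v" if "g \<in> carrier (P_group K d r)" for g
    using that unfolding P_group_simps
  proof (induction rule: generate.induct)
    case one
    then show ?case using rep_zero by (simp only: additive_group_simps) blast
  next
    case (incl g)
    then show ?case using rep_base by auto
  next
    case (inv g)
    then obtain rk where "rk \<in> of_bidegree K d r" "g = base_indicator d rk" by auto
    then show ?case using rep_uminus[OF rep_base] by (simp only: inv_additive_group) blast
  next
    case (eng g h)
    then show ?case using rep_add by (simp only: additive_group_simps) blast
  qed
  define \<phi> where "\<phi> = (\<lambda>g. THE v. rep g v)"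
  have \<phi>: "\<phi> g = v" if "rep g v" for g v
    unfolding \<phi>_def using that rep_unique by (intro the_equality) auto
  have hom: "\<phi> \<in> hom (P_group K d r) additive_group"
  proof (rule homI)
    fix g h assume "g \<in> carrier (P_group K d r)" "h \<in> carrier (P_group K d r)"
    then obtain v w where "rep g v" "rep h w" using rep_carrier by blast
    then show "\<phi> (g \<otimes>\<^bsub>P_group K d r\<^esub> h) = \<phi> g \<otimes>\<^bsub>additive_group\<^esub> \<phi> h"
      using \<phi> rep_add by (simp only: P_group_simps additive_group_simps)
  qed simp
  have group_hom: "group_hom (P_group K d r) additive_group \<phi>"
    using hom comm_group.axioms(2)[OF comm_group_P_group] comm_group.axioms(2)[OF comm_group_additive_group]
    by (simp add: group_hom_def group_hom_axioms_def)
  have "rep g 0" if "g \<in> sym_relations K d r" for g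
    using that unfolding sym_relations_def
  proof (induction rule: generate.induct)
    case one
    then show ?case using rep_zero by (simp only: additive_group_simps)
  next
    case (incl g)
    then obtain rk \<sigma> where *: "rk \<in> of_bidegree K d r" "\<sigma> permutes {1..d}"
      "g = base_indicator d rk - base_indicator d (\<lambda>A. rk (\<sigma> ` A))" by blast
    have "rep (base_indicator d rk + - base_indicator d (relabel d \<sigma> rk)) (f rk + - f (relabel d \<sigma> rk))"
      using * relabel_of_bidegree by (intro rep_add rep_uminus rep_base) auto
    then show ?case
      using sym[OF *(1,2)] by (simp only: *(3) base_indicator_relabel add_uminus_conv_diff diff_self)
  next
    case (inv g)
    then obtain rk \<sigma> where *: "rk \<in> of_bidegree K d r" "\<sigma> permutes {1..d}"
      "g = base_indicator d rk - base_indicator d (\<lambda>A. rk (\<sigma> ` A))" by blast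
    have "rep (- (base_indicator d rk + - base_indicator d (relabel d \<sigma> rk))) (- (f rk + - f (relabel d \<sigma> rk)))"
      using * relabel_of_bidegree by (intro rep_add rep_uminus rep_base) auto
    then show ?case
      using sym[OF *(1,2)]
      by (simp only: *(3) base_indicator_relabel add_uminus_conv_diff diff_self minus_zero inv_additive_group)
  next
    case (eng g h)
    then show ?case using rep_add[of g 0 h 0] by (simp only: additive_group_simps add_0)
  qed
  then have "sym_relations K d r \<subseteq> kernel (P_group K d r) additive_group \<phi>"
    using \<phi> normal_imp_subgroup[OF normal_sym_relations, of d r]
    by (auto simp: kernel_def dest: subgroup.subset)
  then obtain h where h: "h \<in> hom (P_group K d r Mod sym_relations K d r) (additive_group :: rat monoid)"
    "\<And>g. g \<in> carrier (P_group K d r) \<Longrightarrow> h (sym_relations K d r #>\<^bsub>P_group K d r\<^esub> g) = \<phi> g"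
    using group_hom.FactGroup_universal_kernel[OF group_hom normal_sym_relations] by metis
  then have "\<exists>h\<in>hom (P_sym_group K d r) additive_group.
            \<forall>rk\<in>of_bidegree K d r. f rk = h (P_sym_class K d r rk)"
    unfolding P_sym_group_def P_sym_class_def
    using P_group_closed(4) \<phi>[OF rep_base] by (intro bexI[of _ h]) auto
  then show ?thesis using off by (simp add: valuative_invariants_def)
qed

text \<open>The given homomorphism is composed with the coset projection. The last claim is stated
  for an indexed family, because different chains may yield the same rank function.\<close>

lemma valuative_invariantsD:
  assumes "f \<in> valuative_invariants K d r"
  shows "\<And>rk. rk \<notin> of_bidegree K d r \<Longrightarrow> f rk = 0"
    and "\<And>rk \<sigma>. rk \<in> of_bidegree K d r \<Longrightarrow> \<sigma> permutes {1..d} \<Longrightarrow> f (relabel d \<sigma> rk) = f rk"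
    and "\<And>I c R rk. finite I \<Longrightarrow> R ` I \<subseteq> of_bidegree K d r \<Longrightarrow> rk \<in> of_bidegree K d r \<Longrightarrow>
        (\<And>y. base_indicator d rk y = (\<Sum>i\<in>I. c i * base_indicator d (R i) y)) \<Longrightarrow>
        f rk = (\<Sum>i\<in>I. of_int (c i) * f (R i))"
proof -
  let ?P = "P_group K d r" and ?N = "sym_relations K d r"
  interpret P: comm_group ?P by (rule comm_group_P_group)
  interpret N: normal ?N ?P by (rule normal_sym_relations)
  show "\<And>rk. rk \<notin> of_bidegree K d r \<Longrightarrow> f rk = 0" using assms by (simp add: valuative_invariants_def)
  obtain h where h: "h \<in> hom (P_sym_group K d r) additive_group"
    "\<And>rk. rk \<in> of_bidegree K d r \<Longrightarrow> f rk = h (P_sym_class K d r rk)"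
    using assms by (auto simp: valuative_invariants_def)
  define \<phi> where "\<phi> = (\<lambda>g. h (?N #>\<^bsub>?P\<^esub> g))"
  have hom: "\<phi> \<in> hom ?P additive_group"
    using hom_compose[OF N.r_coset_hom_Mod h(1)[unfolded P_sym_group_def]] by (simp add: \<phi>_def comp_def)
  have base: "\<phi> (base_indicator d rk) = f rk" if "rk \<in> of_bidegree K d r" for rk
    using h(2)[OF that] by (simp add: \<phi>_def P_sym_class_def)
  have add: "\<phi> (g + g') = \<phi> g + \<phi> g'" if "g \<in> carrier ?P" "g' \<in> carrier ?P" for g g'
    using hom_mult[OF hom that] by (simp add: P_group_simps)
  have zero: "\<phi> 0 = 0" using add[of 0 0] P_group_closed(1) by simp
  have minus: "\<phi> (- g) = - \<phi> g" if "g \<in> carrier ?P" for g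
    using add[OF that P_group_closed(3)[OF that]] zero by (simp add: eq_neg_iff_add_eq_0 add.commute)
  have nat_mult: "(\<lambda>y. int n * g y) \<in> carrier ?P \<and> \<phi> (\<lambda>y. int n * g y) = of_nat n * \<phi> g"
    if "g \<in> carrier ?P" for g n
  proof (induction n)
    case 0
    then show ?case using zero P_group_closed(1)[of K d r] by (simp add: zero_fun_def)
  next
    case (Suc n)
    have "(\<lambda>y. int (Suc n) * g y) = g + (\<lambda>y. int n * g y)" by (auto simp: algebra_simps)
    then show ?case using Suc add[OF that, of "\<lambda>y. int n * g y"] P_group_closed(2)[OF that]
      by (simp only:) (simp add: algebra_simps)
  qed
  have int_mult: "(\<lambda>y. k * g y) \<in> carrier ?P \<and> \<phi> (\<lambda>y. k * g y) = of_int k * \<phi> g"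
    if "g \<in> carrier ?P" for g k
  proof (cases k)
    case (nonneg n)
    then show ?thesis using nat_mult[OF that] by simp
  next
    case (neg n)
    have k: "of_int k = - (of_nat (Suc n) :: rat)" by (simp add: neg)
    have "(\<lambda>y. k * g y) = - (\<lambda>y. int (Suc n) * g y)"
      by (rule ext) (simp add: neg algebra_simps)
    moreover have "- (\<lambda>y. int (Suc n) * g y) \<in> carrier ?P"
      using nat_mult[OF that, of "Suc n"] by (intro P_group_closed(3)) blast
    moreover have "\<phi> (- (\<lambda>y. int (Suc n) * g y)) = - (of_nat (Suc n) * \<phi> g)"
      using nat_mult[OF that, of "Suc n"] minus by metis
    ultimately show ?thesis unfolding k by (simp only: minus_mult_left)
  qed
  have sum: "(\<lambda>y. \<Sum>i\<in>I. c i * base_indicator d (R i) y) \<in> carrier ?P \<and>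
      \<phi> (\<lambda>y. \<Sum>i\<in>I. c i * base_indicator d (R i) y) = (\<Sum>i\<in>I. of_int (c i) * f (R i))"
    if "finite I" "R ` I \<subseteq> of_bidegree K d r" for I c and R :: "'i \<Rightarrow> rank_fun"
    using that
  proof (induction I rule: finite_induct)
    case empty
    then show ?case using zero P_group_closed(1)[of K d r] by (simp add: zero_fun_def)
  next
    case (insert i I)
    let ?a = "\<lambda>y. c i * base_indicator d (R i) y" and ?b = "\<lambda>y. \<Sum>i\<in>I. c i * base_indicator d (R i) y"
    have *: "(\<lambda>y. \<Sum>i\<in>insert i I. c i * base_indicator d (R i) y) = ?a + ?b"
      using insert.hyps by auto
    have a: "?a \<in> carrier ?P" "\<phi> ?a = of_int (c i) * f (R i)"
      using int_mult[of "base_indicator d (R i)" "c i"] P_group_closed(4)[of "R i"] base insert.prems by auto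
    have b: "?b \<in> carrier ?P" "\<phi> ?b = (\<Sum>i\<in>I. of_int (c i) * f (R i))"
      using insert by auto
    show ?case
      unfolding * unfolding sum.insert[OF insert.hyps]
      using P_group_closed(2)[OF a(1) b(1)] add[OF a(1) b(1)] unfolding a(2) b(2) by (rule conjI)
  qed
  show "f rk = (\<Sum>i\<in>I. of_int (c i) * f (R i))"
    if "finite I" "R ` I \<subseteq> of_bidegree K d r" "rk \<in> of_bidegree K d r"
      "\<And>y. base_indicator d rk y = (\<Sum>i\<in>I. c i * base_indicator d (R i) y)"
    for I c rk and R :: "'i \<Rightarrow> rank_fun"
  proof -
    have "base_indicator d rk = (\<lambda>y. \<Sum>i\<in>I. c i * base_indicator d (R i) y)" using that(4) by auto
    then show ?thesis using sum[OF that(1,2), of c] base[OF that(3)] by simp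
  qed
  show "f (relabel d \<sigma> rk) = f rk" if "rk \<in> of_bidegree K d r" "\<sigma> permutes {1..d}" for rk \<sigma>
  proof -
    let ?s = "base_indicator d rk - base_indicator d (relabel d \<sigma> rk)"
    have s: "?s \<in> ?N"
      unfolding sym_relations_def
      by (intro generate.incl CollectI exI[of _ rk] exI[of _ \<sigma>] conjI that)
        (simp only: base_indicator_relabel)
    then have "?s \<in> carrier ?P" using N.subset by auto
    have "?N #>\<^bsub>?P\<^esub> ?s = ?N #>\<^bsub>?P\<^esub> 0"
      using P.coset_join2[OF \<open>?s \<in> carrier ?P\<close> N.subgroup_axioms s]
        P.coset_mult_one[OF N.subset] by (simp only: P_group_simps additive_group_simps)
    then have "\<phi> ?s = 0" using zero by (simp only: \<phi>_def)
    moreover have "\<phi> ?s = f rk - f (relabel d \<sigma> rk)"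
      using add[OF P_group_closed(4)[OF that(1)] P_group_closed(3)[OF P_group_closed(4)[OF relabel_of_bidegree[OF that]]]]
        minus[OF P_group_closed(4)[OF relabel_of_bidegree[OF that]]] base[OF that(1)] base[OF relabel_of_bidegree[OF that]]
      by (simp only: add_uminus_conv_diff)
    ultimately show ?thesis by simp
  qed
qed

end

section \<open>Sums over flags are valuative and independent\<close>

lemma partial_sums_eq:
  fixes v w :: "nat list"
  assumes "length v = length w" "\<And>k. k \<le> length w \<Longrightarrow> sum_list (take k v) = sum_list (take k w)"
  shows "v = w"
proof (rule nth_equalityI)
  fix k assume k: "k < length v"
  then show "v ! k = w ! k"
    using assms(2)[of k] assms(2)[of "Suc k"] assms(1) by (simp add: take_Suc_conv_app_nth)
qed (rule assms(1))

text \<open>Polytopes see ranks along a flag, series see jumps; partial sums translate between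
  them.\<close>

lemma jumps_eq_iff:
  assumes rk: "polymatroid X rk" and l: "set l \<subseteq> X" and w: "length w = length l"
  shows "jumps rk {} l = w \<longleftrightarrow> (\<forall>k\<le>length l. rk (set (take k l)) = sum_list (take k w))"
proof -
  have ps: "sum_list (take k (jumps rk {} l)) = rk (set (take k l))" for k
    using sum_list_jumps[OF rk, of "{}" "take k l"] l polymatroidD(2)[OF rk] set_take_subset[of k l]
    by (simp add: take_jumps)
  show ?thesis
  proof
    assume "\<forall>k\<le>length l. rk (set (take k l)) = sum_list (take k w)"
    then show "jumps rk {} l = w" using ps w by (intro partial_sums_eq) auto
  qed (use ps in auto)
qed

lemma of_bidegreeD:
  assumes "singleton_rank_class K J" "rk \<in> of_bidegree K d r"
  shows "polymatroid {1..d} rk" "rk {1..d} = r" "\<And>i. i \<in> {1..d} \<Longrightarrow> rk {i} \<in> J"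
  using assms by (auto simp: of_bidegree_def singleton_rank_class.K_iff)

text \<open>Monotonicity of the rank enters here, through the constraint for the complement of
  \<open>i\<close>.\<close>

lemma base_polytope_nonneg:
  assumes "polymatroid {1..d} rk" "y \<in> base_polytope d rk" "i \<in> {1..d}"
  shows "0 \<le> y i"
proof -
  have "sum y {1..d} = y i + sum y ({1..d} - {i})" using assms(3) by (intro sum.remove) auto
  moreover have "sum y {1..d} = real (rk {1..d})" "sum y ({1..d} - {i}) \<le> real (rk ({1..d} - {i}))"
    using assms(2) by (auto simp: base_polytope_def)
  moreover have "rk ({1..d} - {i}) \<le> rk {1..d}" by (intro polymatroidD(4)[OF assms(1)]) auto
  ultimately show ?thesis by simp
qed

lemma continuous_on_sum_coordinates: "continuous_on UNIV (\<lambda>y :: nat \<Rightarrow> real. sum y A)"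
  by (intro continuous_on_sum continuous_on_product_coordinates)

lemma closed_base_polytope: "closed (base_polytope d rk)"
proof -
  have "base_polytope d rk = (\<Inter>i\<in>-{1..d}. {y. y i = 0}) \<inter> {y. sum y {1..d} = real (rk {1..d})} \<inter>
      (\<Inter>A\<in>Pow {1..d}. {y. sum y A \<le> real (rk A)})"
    by (auto simp: base_polytope_def)
  then show ?thesis
    by (auto intro!: closed_Int closed_INT closed_fun_coordinate_eq closed_Collect_eq closed_Collect_le
        continuous_on_sum_coordinates)
qed

lemma compact_base_polytope:
  assumes "polymatroid {1..d} rk"
  shows "compact (base_polytope d rk)"
proof -
  let ?B = "\<lambda>i. if i \<in> {1..d} then {0..real (rk {1..d})} else {0}"
  have "compactin (product_topology (\<lambda>i::nat. euclidean :: real topology) UNIV) (Pi\<^sub>E UNIV ?B)"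
    unfolding compactin_PiE by auto
  then have "compact (Pi\<^sub>E UNIV ?B)" by (simp add: euclidean_product_topology)
  moreover have "base_polytope d rk \<subseteq> Pi\<^sub>E UNIV ?B"
  proof
    fix y assume y: "y \<in> base_polytope d rk"
    have "y i \<in> ?B i" for i
    proof (cases "i \<in> {1..d}")
      case True
      have "sum y {i} \<le> real (rk {i})" using y True unfolding base_polytope_def by blast
      moreover have "rk {i} \<le> rk {1..d}" using True by (intro polymatroidD(4)[OF assms]) auto
      ultimately show ?thesis using True base_polytope_nonneg[OF assms y True] by simp
    next
      case False
      then show ?thesis using y by (auto simp: base_polytope_def)
    qed
    then show "y \<in> Pi\<^sub>E UNIV ?B" by (simp add: PiE_def Pi_def del: split_paired_All)
  qed
  ultimately show ?thesis
    using compact_Int_closed[OF _ closed_base_polytope, of "Pi\<^sub>E UNIV ?B" d rk] by (simp add: Int_absorb1)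
qed

lemma sum_convex_combination:
  "(\<Sum>i\<in>A. (1 - t) * x i + t * y i) = (1 - t) * sum x A + t * sum y A" for t :: real
  by (simp add: sum.distrib sum_distrib_left)

lemma convex_base_polytope: "convex_fun_set (base_polytope d rk)"
  unfolding convex_fun_set_def
proof (intro ballI)
  fix x y and t :: real assume xy: "x \<in> base_polytope d rk" "y \<in> base_polytope d rk" and t: "t \<in> {0..1}"
  have "(\<Sum>i\<in>A. (1 - t) * x i + t * y i) \<le> real (rk A)" if "A \<subseteq> {1..d}" for A
  proof -
    have "sum x A \<le> real (rk A)" "sum y A \<le> real (rk A)" using xy that by (auto simp: base_polytope_def)
    then show ?thesis unfolding sum_convex_combination using t
      by (intro convex_bound_le) auto
  qed
  moreover have "(\<Sum>i\<in>{1..d}. (1 - t) * x i + t * y i) = real (rk {1..d})"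
    unfolding sum_convex_combination using xy by (simp add: base_polytope_def algebra_simps)
  ultimately show "(\<lambda>i. (1 - t) * x i + t * y i) \<in> base_polytope d rk"
    using xy by (simp add: base_polytope_def)
qed

text \<open>By the greedy algorithm, a base polytope meets the convex set \<open>C\<close> below iff the rank function
  dominates \<open>\<rho>\<close> along the flag.\<close>

lemma flag_relation:
  assumes fin: "finite I" and I: "\<And>rk. rk \<in> I \<Longrightarrow> polymatroid {1..d} rk"
    and rel: "\<And>y. (\<Sum>rk\<in>I. c rk * base_indicator d rk y) = 0"
    and l: "l \<in> permutations_of_set {1..d}"
  shows "(\<Sum>rk\<in>I. c rk * of_bool (\<forall>k\<le>d. rk (set (take k l)) = \<rho> k)) = 0"
\<comment> \<open>Prescribed ranks along the flag are replaced by lower bounds, since only the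
  latter amount to meeting a closed convex set.\<close>
proof (rule sum_dominating_imp_sum_equal[OF fin])
  fix \<rho> :: "nat \<Rightarrow> nat"
  have l': "set l = {1..d}" "distinct l" "length l = d"
    using l length_finite_permutations_of_set[OF l] by (auto dest: permutations_of_setD)
  define C where "C = {y :: nat \<Rightarrow> real. \<forall>k\<le>d. real (\<rho> k) \<le> sum y (set (take k l))}"
  have "(\<Sum>rk\<in>I. c rk * of_bool (base_polytope d rk \<inter> C \<noteq> {})) = 0"
  proof (rule sum_nonempty_compact_convex[OF fin, of "{1..d}"])
    have "C = (\<Inter>k\<in>{..d}. {y. real (\<rho> k) \<le> sum y (set (take k l))})" by (auto simp: C_def)
    then have "closed C"
      by (auto intro!: closed_INT closed_Collect_le continuous_on_sum_coordinates)
    then show "compact (base_polytope d rk \<inter> C)" if "rk \<in> I" for rk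
      by (intro compact_Int_closed compact_base_polytope I that)
    have "convex_fun_set C"
      unfolding convex_fun_set_def C_def
    proof clarsimp
      fix x y and t :: real and k
      assume "\<forall>k\<le>d. real (\<rho> k) \<le> sum x (set (take k l))" "\<forall>k\<le>d. real (\<rho> k) \<le> sum y (set (take k l))"
        and t: "0 \<le> t" "t \<le> 1" and "k \<le> d"
      then have "(1 - t) * real (\<rho> k) + t * real (\<rho> k) \<le>
          (1 - t) * sum x (set (take k l)) + t * sum y (set (take k l))"
        by (intro add_mono mult_left_mono) auto
      then show "real (\<rho> k) \<le> (\<Sum>i\<in>set (take k l). (1 - t) * x i + t * y i)"
        unfolding sum_convex_combination by (simp add: algebra_simps)
    qed
    then show "convex_fun_set (base_polytope d rk \<inter> C)" for rk
      using convex_base_polytope[of d rk] by (auto simp: convex_fun_set_def)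
    show "y j = 0" if "y \<in> base_polytope d rk \<inter> C" "j \<notin> {1..d}" for rk y j
      using that by (auto simp: base_polytope_def)
    fix y
    have "(\<Sum>rk\<in>I. c rk * of_bool (y \<in> base_polytope d rk \<inter> C)) =
        (if y \<in> C then \<Sum>rk\<in>I. c rk * base_indicator d rk y else 0)"
      by (auto simp: base_indicator_def indicator_def intro!: sum.cong)
    then show "(\<Sum>rk\<in>I. c rk * of_bool (y \<in> base_polytope d rk \<inter> C)) = 0" using rel by simp
  qed simp
  moreover have "base_polytope d rk \<inter> C \<noteq> {} \<longleftrightarrow> (\<forall>k\<le>d. \<rho> k \<le> rk (set (take k l)))" if rk: "rk \<in> I" for rk
  proof
    assume "base_polytope d rk \<inter> C \<noteq> {}"
    then obtain y where y: "y \<in> base_polytope d rk" "y \<in> C" by auto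
    show "\<forall>k\<le>d. \<rho> k \<le> rk (set (take k l))"
    proof (intro allI impI)
      fix k assume "k \<le> d"
      then have "real (\<rho> k) \<le> sum y (set (take k l))" using y by (auto simp: C_def)
      also have "\<dots> \<le> real (rk (set (take k l)))"
        using y(1) set_take_subset[of k l] l' unfolding base_polytope_def by blast
      finally show "\<rho> k \<le> rk (set (take k l))" by simp
    qed
  next
    assume \<rho>: "\<forall>k\<le>d. \<rho> k \<le> rk (set (take k l))"
    obtain y :: "nat \<Rightarrow> real" where y: "\<forall>i. i \<notin> set l \<longrightarrow> y i = 0" "\<forall>A\<subseteq>set l. sum y A \<le> real (rk A)"
      "\<forall>k\<le>length l. sum y (set (take k l)) = real (rk (set (take k l)))"
      using greedy_vertex[OF I[OF rk] l'(2)] l' by blast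
    have "sum y (set (take d l)) = real (rk (set (take d l)))" using y(3) l' by blast
    then have "y \<in> base_polytope d rk" using y l' by (simp add: base_polytope_def)
    moreover have "y \<in> C" using y(3) l' \<rho> by (simp add: C_def)
    ultimately show "base_polytope d rk \<inter> C \<noteq> {}" by blast
  qed
  ultimately show "(\<Sum>rk\<in>I. c rk * of_bool (\<forall>k\<le>d. \<rho> k \<le> rk (set (take k l)))) = 0" by simp
qed

text \<open>The inverse of the desired isomorphism. In bidegree (d, r) only the words of that
  bidegree contribute, since the jumps along a complete flag number d and add up to r.\<close>

definition flag_invariant :: "rank_class \<Rightarrow> nc_series \<Rightarrow> invariant_family" where
  "flag_invariant K a = (\<lambda>d r rk. if rk \<in> of_bidegree K d r then flag_sum rk {} {1..d} a else 0)"

context singleton_rank_class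
begin

text \<open>For a fixed flag the rank functions are grouped by their word; the coefficients in each
  group sum to zero by \<open>flag_relation\<close>, whatever value the series takes there.\<close>

lemma flag_sum_relation:
  assumes fin: "finite I" and I: "I \<subseteq> of_bidegree K d r"
    and rel: "\<And>y. (\<Sum>rk\<in>I. c rk * base_indicator d rk y) = 0"
  shows "(\<Sum>rk\<in>I. of_int (c rk) * flag_sum rk {} {1..d} a) = 0"
proof -
  have poly: "polymatroid {1..d} rk" if "rk \<in> I" for rk
    using I that of_bidegreeD[OF singleton_rank_class_axioms] by blast
  have flag: "(\<Sum>rk\<in>I. of_int (c rk) * a (jumps rk {} l)) = 0" if l: "l \<in> permutations_of_set {1..d}" for l
  proof -
    have l': "set l = {1..d}" "length l = d"
      using l length_finite_permutations_of_set[OF l] by (auto dest: permutations_of_setD)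
    let ?j = "\<lambda>rk. jumps rk {} l"
    have "(\<Sum>rk\<in>I. of_int (c rk) * a (?j rk)) = (\<Sum>w\<in>?j ` I. \<Sum>rk\<in>{rk\<in>I. ?j rk = w}. of_int (c rk) * a (?j rk))"
      by (rule sum.image_gen[OF fin])
    also have "\<dots> = (\<Sum>w\<in>?j ` I. of_int (\<Sum>rk\<in>{rk\<in>I. ?j rk = w}. c rk) * a w)"
      by (intro sum.cong refl) (simp add: sum_distrib_right)
    also have "\<dots> = 0"
    proof (rule sum.neutral, rule ballI)
      fix w assume "w \<in> ?j ` I"
      then have w: "length w = length l" by auto
      have "(\<Sum>rk\<in>{rk\<in>I. ?j rk = w}. c rk) = (\<Sum>rk\<in>I. c rk * of_bool (?j rk = w))"
        using fin by (simp add: of_bool_def if_distrib sum.If_cases Int_def cong: if_cong)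
      also have "\<dots> = (\<Sum>rk\<in>I. c rk * of_bool (\<forall>k\<le>d. rk (set (take k l)) = sum_list (take k w)))"
      proof (intro sum.cong refl)
        fix rk assume "rk \<in> I"
        then show "c rk * of_bool (?j rk = w) = c rk * of_bool (\<forall>k\<le>d. rk (set (take k l)) = sum_list (take k w))"
          using jumps_eq_iff[OF poly, of rk l w] l' w by simp
      qed
      also have "\<dots> = 0" by (rule flag_relation[OF fin poly rel l])
      finally show "of_int (\<Sum>rk\<in>{rk\<in>I. ?j rk = w}. c rk) * a w = 0" by simp
    qed
    finally show ?thesis .
  qed
  have "(\<Sum>rk\<in>I. of_int (c rk) * flag_sum rk {} {1..d} a) =
      (\<Sum>l\<in>permutations_of_set {1..d}. \<Sum>rk\<in>I. of_int (c rk) * a (jumps rk {} l))"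
    unfolding flag_sum_def sum_distrib_left by (rule sum.swap)
  also have "\<dots> = 0" using flag by simp
  finally show ?thesis .
qed

lemma flag_invariant_valuative: "flag_invariant K a d r \<in> valuative_invariants K d r"
proof (rule valuative_invariantsI)
  show "flag_invariant K a d r rk = 0" if "rk \<notin> of_bidegree K d r" for rk
    using that by (simp add: flag_invariant_def)
next
  fix I c assume *: "finite I" "I \<subseteq> of_bidegree K d r"
    "\<And>y. (\<Sum>rk\<in>I. c rk * base_indicator d rk y) = 0"
  have "(\<Sum>rk\<in>I. of_int (c rk) * flag_invariant K a d r rk) =
      (\<Sum>rk\<in>I. of_int (c rk) * flag_sum rk {} {1..d} a)"
    using *(2) by (intro sum.cong) (auto simp: flag_invariant_def)
  then show "(\<Sum>rk\<in>I. of_int (c rk) * flag_invariant K a d r rk) = 0"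
    using flag_sum_relation[OF *] by simp
next
  fix rk \<sigma> assume *: "rk \<in> of_bidegree K d r" "\<sigma> permutes {1..d}"
  have "flag_sum rk {} {1..d} a = flag_sum (relabel d \<sigma> rk) {} {1..d} a"
    by (rule flag_sum_transport[OF permutes_imp_bij[OF *(2)], of _ _ 0 _ _ 0]) (simp add: relabel_def)
  then show "flag_invariant K a d r (relabel d \<sigma> rk) = flag_invariant K a d r rk"
    using * relabel_of_bidegree by (simp add: flag_invariant_def)
qed

text \<open>Among the words of this bidegree in the support of \<open>a\<close>, take one that is
  maximal for dominance of partial sums. Every word of its Schubert polymatroid dominates it, so in
  the flag sum there only this word contributes.\<close>

lemma flag_sum_independent:
  assumes zero: "\<And>rk. rk \<in> of_bidegree K d r \<Longrightarrow> flag_sum rk {} {1..d} a = 0"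
    and w: "length w = d" "sum_list w = r" "set w \<subseteq> J"
  shows "a w = 0"
proof (rule ccontr)
  assume "a w \<noteq> 0"
  define W where "W = {w. length w = d \<and> sum_list w = r \<and> set w \<subseteq> J \<and> a w \<noteq> 0}"
  \<comment> \<open>A linear extension of the dominance order: for words with dominating partial
    sums, equal weight forces equality.\<close>
  define pot where "pot = (\<lambda>w::nat list. \<Sum>k\<le>d. sum_list (take k w))"
  have "W \<subseteq> {w. set w \<subseteq> {..r} \<and> length w = d}"
    by (auto simp: W_def member_le_sum_list)
  then have "finite W" by (rule finite_subset) (simp add: finite_lists_length_eq)
  moreover have "W \<noteq> {}" using w \<open>a w \<noteq> 0\<close> by (auto simp: W_def)
  ultimately have "Max (pot ` W) \<in> pot ` W" by (intro Max_in) auto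
  then obtain v where "v \<in> W" "Max (pot ` W) = pot v" by auto
  then have v: "v \<in> W" "\<And>v'. v' \<in> W \<Longrightarrow> pot v' \<le> pot v"
    using Max_ge[of "pot ` W"] \<open>finite W\<close> by auto
  have v': "length v = d" "sum_list v = r" "set v \<subseteq> J" "a v \<noteq> 0" using v(1) by (auto simp: W_def)
  \<comment> \<open>The side of the cube is the largest letter of \<open>v\<close>, with 0 for the
    empty word. It lies in \<open>J\<close> because the letters do, and it bounds the increments of
    the partial sums.\<close>
  define m where "m = Max (insert 0 (set v))"
  have "m \<in> insert 0 (set v)" unfolding m_def by (rule Max_in) auto
  then have m: "m \<in> J" using v'(3) zero_J by auto
  have m_ge: "x \<le> m" if "x \<in> set v" for x unfolding m_def using that by simp
  define ps where "ps = (\<lambda>k. sum_list (take k v))"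
  have ps_Suc: "ps (Suc k) = (if k < d then ps k + v ! k else ps k)" for k
    using v'(1) by (simp add: ps_def take_Suc_conv_app_nth)
  have ps_mono: "ps i \<le> ps j" if "i \<le> j" for i j
    by (rule lift_Suc_mono_le[OF _ that]) (simp add: ps_Suc)
  have ps_lip: "ps (i + n) \<le> ps i + m * n" for i n
  proof (induction n)
    case (Suc n)
    have "ps (Suc (i + n)) \<le> ps (i + n) + m" using m_ge v'(1) by (simp add: ps_Suc)
    with Suc show ?case by simp
  qed simp
  let ?D = "{1..d}"
  define \<B> where "\<B> = (\<lambda>i. {1..i}) ` {..d}"
  define S where "S = chain_rank m ?D \<B> (\<lambda>B. ps (card B))"
  have \<B>: "\<B> \<subseteq> Pow ?D" "{} \<in> \<B>" "?D \<in> \<B>" "\<And>i. i \<le> d \<Longrightarrow> {1..i} \<in> \<B>"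
    unfolding \<B>_def by (auto intro: image_eqI[of _ _ 0])
  have chain: "B \<subseteq> C \<or> C \<subseteq> B" if "B \<in> \<B>" "C \<in> \<B>" for B C using that by (force simp: \<B>_def)
  have Spoly: "polymatroid ?D S" "\<And>i. i \<in> ?D \<Longrightarrow> S {i} \<le> m"
    unfolding S_def using chain_rank_polymatroid[of ?D \<B> "\<lambda>B. ps (card B)", OF _ \<B>(1,2) chain] by (simp_all add: ps_def)
  \<comment> \<open>For a minimising member \<open>B\<close> of the chain, \<open>card Y\<close> is
    at most the sizes of \<open>B\<close> and \<open>Y - B\<close> together, and the partial sums
    grow by at most \<open>m\<close> per step.\<close>
  have S_ge: "ps (card Y) \<le> S Y" if Y: "Y \<subseteq> ?D" for Y
  proof -
    obtain B where B: "B \<in> \<B>" "S Y = ps (card B) + m * card (Y - B)"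
      unfolding S_def using chain_rank_attained[of ?D \<B> Y m "\<lambda>B. ps (card B)"] \<B>(1,2) Y by blast
    then have "finite B" by (auto simp: \<B>_def)
    have "card Y \<le> card (B \<union> (Y - B))" using Y \<open>finite B\<close> finite_subset[OF Y] by (intro card_mono) auto
    also have "\<dots> \<le> card B + card (Y - B)" by (rule card_Un_le)
    finally have "ps (card Y) \<le> ps (card B + card (Y - B))" by (rule ps_mono)
    then show ?thesis using ps_lip[of "card B" "card (Y - B)"] B(2) by simp
  qed
  have S_init: "S {1..i} = ps i" if "i \<le> d" for i
  proof (rule antisym)
    show "S {1..i} \<le> ps i"
      unfolding S_def using chain_rank_le[of ?D \<B> "{1..i}" "{1..i}" m "\<lambda>B. ps (card B)"] \<B>(1,4) that by simp
    show "ps i \<le> S {1..i}" using S_ge[of "{1..i}"] that by simp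
  qed
  have "S {1..d} = r" using S_init[of d] v' by (simp add: ps_def)
  then have S: "S \<in> of_bidegree K d r"
    using Spoly m down_J by (auto simp: of_bidegree_def K_iff)
  have "a (jumps S {} l) = (if jumps S {} l = v then a v else 0)" if l: "l \<in> permutations_of_set ?D" for l
  proof (cases "a (jumps S {} l) = 0")
    case False
    have l': "set l = {1..d}" "distinct l" "length l = d"
      using l length_finite_permutations_of_set[OF l] by (auto dest: permutations_of_setD)
    let ?w = "jumps S {} l"
    have psw: "sum_list (take k ?w) = S (set (take k l))" if "k \<le> d" for k
      using jumps_eq_iff[OF Spoly(1), of l ?w] l' that by simp
    have ge: "sum_list (take k v) \<le> sum_list (take k ?w)" if "k \<le> d" for k
      using S_ge[of "set (take k l)"] psw[OF that] set_take_subset[of k l] l' that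
      by (simp add: ps_def distinct_card)
    have "j \<in> J" if "x \<in> ?D" "j \<le> S {x}" for x j
      using down_J[OF m] that(2) Spoly(2)[OF that(1)] by simp
    then have "set ?w \<subseteq> J"
      using l' by (intro set_jumps[OF Spoly(1)]) auto
    moreover have "sum_list ?w = r" using psw[of d] l' \<open>S {1..d} = r\<close> by simp
    ultimately have "?w \<in> W" using l' False by (simp add: W_def)
    then have "pot ?w \<le> pot v" by (rule v(2))
    have "sum_list (take k v) = sum_list (take k ?w)" if "k \<le> d" for k
    proof (rule ccontr)
      assume "\<not> ?thesis"
      then have "pot v < pot ?w"
        unfolding pot_def using ge that by (intro sum_strict_mono_ex1) (auto simp: order_less_le)
      then show False using \<open>pot ?w \<le> pot v\<close> by simp
    qed
    then have "v = ?w" using v'(1) l' by (intro partial_sums_eq) auto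
    then show ?thesis by simp
  qed (use v'(4) in auto)
  then have "flag_sum S {} ?D a = (\<Sum>l\<in>permutations_of_set ?D. if jumps S {} l = v then a v else 0)"
    unfolding flag_sum_def by (intro sum.cong) auto
  also have "\<dots> = of_nat (card {l\<in>permutations_of_set ?D. jumps S {} l = v}) * a v"
    by (simp add: sum.If_cases Int_def)
  finally have "card {l\<in>permutations_of_set ?D. jumps S {} l = v} = 0"
    using zero[OF S] v'(4) by simp
  \<comment> \<open>The flag of initial segments attains \<open>v\<close>, so its multiplicity is
    not zero.\<close>
  moreover have "[1..<Suc d] \<in> {l\<in>permutations_of_set ?D. jumps S {} l = v}"
  proof -
    have perm: "[1..<Suc d] \<in> permutations_of_set ?D" by (auto simp: permutations_of_set_def)
    have "S (set (take k [1..<Suc d])) = sum_list (take k v)" if "k \<le> d" for k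
    proof -
      have "set (take k [1..<Suc d]) = {1..k}" using that by (subst take_upt) auto
      then show ?thesis using S_init[OF that] by (simp add: ps_def)
    qed
    then have "jumps S {} [1..<Suc d] = v"
      using jumps_eq_iff[OF Spoly(1), of "[1..<Suc d]" v] v'(1)
      by (auto simp: atLeastLessThanSuc_atLeastAtMost simp del: upt_Suc)
    with perm show ?thesis by simp
  qed
  moreover have "finite {l\<in>permutations_of_set ?D. jumps S {} l = v}" by simp
  ultimately show False by (metis card_eq_0_iff empty_iff)
qed

end

section \<open>Sums over flags span the valuative invariants\<close>

text \<open>A chain \<open>A \<supset> B\<^sub>1 \<supset> \<dots> \<supset> B\<^sub>k = {}\<close> is represented by the list \<open>[B\<^sub>1, \<dots>, B\<^sub>k]\<close>.\<close>

primrec chain_list :: "nat set \<Rightarrow> nat set list \<Rightarrow> bool" where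
  "chain_list A [] \<longleftrightarrow> A = {}"
| "chain_list A (B # L) \<longleftrightarrow> B \<subset> A \<and> chain_list B L"

lemma chain_lists_empty: "{L. chain_list {} L} = {[]}"
proof -
  have "chain_list {} L \<longleftrightarrow> L = []" for L by (cases L) auto
  then show ?thesis by auto
qed

lemma chain_lists_nonempty:
  assumes "A \<noteq> {}"
  shows "{L. chain_list A L} = (\<Union>B\<in>{B. B \<subset> A}. (#) B ` {L. chain_list B L})"
proof (rule Set.set_eqI)
  fix L
  show "L \<in> {L. chain_list A L} \<longleftrightarrow> L \<in> (\<Union>B\<in>{B. B \<subset> A}. (#) B ` {L. chain_list B L})"
    using assms by (cases L) auto
qed

lemma finite_chain_lists: "finite A \<Longrightarrow> finite {L. chain_list A L}"
proof (induction A rule: finite_psubset_induct)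
  case (psubset A)
  show ?case
  proof (cases "A = {}")
    case True
    then show ?thesis by (simp add: chain_lists_empty)
  next
    case False
    have "finite {B. B \<subset> A}" using psubset.hyps by (auto intro: finite_subset[of _ "Pow A"])
    then show ?thesis
      unfolding chain_lists_nonempty[OF False] using psubset.IH by (intro finite_UN_I finite_imageI) auto
  qed
qed

lemma chain_list_props:
  assumes "chain_list A L"
  shows "{} \<in> set (A # L)" "set (A # L) \<subseteq> Pow A"
    "\<And>B C. B \<in> set (A # L) \<Longrightarrow> C \<in> set (A # L) \<Longrightarrow> B \<subseteq> C \<or> C \<subseteq> B"
proof -
  show "{} \<in> set (A # L)" using assms by (induction L arbitrary: A) auto
  have sub: "set (A # L) \<subseteq> Pow A" if "chain_list A L" for A L
    using that
  proof (induction L arbitrary: A)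
    case (Cons B L)
    then show ?case using Cons.IH[of B] by auto
  qed simp
  then show "set (A # L) \<subseteq> Pow A" using assms .
  show "B \<subseteq> C \<or> C \<subseteq> B" if "B \<in> set (A # L)" "C \<in> set (A # L)" for B C
    using assms that
  proof (induction L arbitrary: A)
    case (Cons B' L)
    have "B \<subseteq> A" "C \<subseteq> A" using sub[OF Cons.prems(1)] Cons.prems(2,3) by auto
    then show ?case using Cons by auto
  qed simp
qed

text \<open>A complete flag refining the chain, in which a member \<open>B\<close> stands at
  position \<open>card B\<close>. The rank of \<open>B\<close> can thus be read from the jump word
  as a partial sum.\<close>

lemma chain_list_flag:
  assumes "chain_list A L" "finite A"
  shows "\<exists>l\<in>permutations_of_set A. \<forall>B\<in>set (A # L). set (take (card B) l) = B"
  using assms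
proof (induction L arbitrary: A)
  case Nil
  then show ?case by simp
next
  case (Cons B L)
  then have B: "B \<subset> A" "chain_list B L" "finite B" by (auto intro: finite_subset)
  then obtain l where l: "l \<in> permutations_of_set B" "\<forall>C\<in>set (B # L). set (take (card C) l) = C"
    using Cons.IH by blast
  have "finite (A - B)" using Cons.prems by simp
  then obtain l' where l': "l' \<in> permutations_of_set (A - B)"
    by (metis all_not_in_conv permutations_of_set_empty_iff)
  have perm: "l @ l' \<in> permutations_of_set A"
    using l(1) l' B(1) by (auto simp: permutations_of_set_def)
  have "length l = card B" using l(1) by (rule length_finite_permutations_of_set)
  have "set (take (card C) (l @ l')) = C" if C: "C \<in> set (B # L)" for C
  proof -
    have "card C \<le> card B" using chain_list_props(2)[OF B(2)] C B(3) by (intro card_mono) auto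
    then have "take (card C) (l @ l') = take (card C) l" using \<open>length l = card B\<close> by simp
    then show ?thesis using l(2) C by metis
  qed
  moreover have "set (take (card A) (l @ l')) = A"
    using length_finite_permutations_of_set[OF perm] permutations_of_setD(1)[OF perm] by simp
  ultimately have "\<forall>C\<in>set (A # B # L). set (take (card C) (l @ l')) = C"
    by (simp del: take_append)
  then show ?case using perm by blast
qed

text \<open>Toggling \<open>x\<close> is a sign-reversing pairing; equivalently, a cone has
  vanishing reduced Euler characteristic.\<close>

lemma sum_alternating_cone:
  assumes fin: "finite \<Delta>" "\<And>B. B \<in> \<Delta> \<Longrightarrow> finite B"
    and cone: "\<And>B. B \<in> \<Delta> \<Longrightarrow> insert x B \<in> \<Delta>" "\<And>B. B \<in> \<Delta> \<Longrightarrow> B - {x} \<in> \<Delta>"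
  shows "(\<Sum>B\<in>\<Delta>. (-1::int) ^ card B) = 0"
proof -
  let ?\<Delta> = "{B\<in>\<Delta>. x \<notin> B}"
  have \<Delta>: "\<Delta> = ?\<Delta> \<union> insert x ` ?\<Delta>"
  proof
    show "\<Delta> \<subseteq> ?\<Delta> \<union> insert x ` ?\<Delta>"
    proof
      fix B assume "B \<in> \<Delta>"
      then show "B \<in> ?\<Delta> \<union> insert x ` ?\<Delta>"
        using cone(2)[of B] by (cases "x \<in> B") (auto simp: insert_absorb intro!: image_eqI[of _ _ "B - {x}"])
    qed
  qed (use cone(1) in auto)
  have "inj_on (insert x) ?\<Delta>" by (auto intro!: inj_onI)
  then have "(\<Sum>B\<in>insert x ` ?\<Delta>. (-1::int) ^ card B) = (\<Sum>B\<in>?\<Delta>. (-1) ^ card (insert x B))"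
    by (simp add: sum.reindex)
  also have "\<dots> = - (\<Sum>B\<in>?\<Delta>. (-1) ^ card B)"
    unfolding sum_negf[symmetric] using fin by (intro sum.cong) auto
  finally have "(\<Sum>B\<in>insert x ` ?\<Delta>. (-1::int) ^ card B) = - (\<Sum>B\<in>?\<Delta>. (-1) ^ card B)" .
  moreover have "(\<Sum>B\<in>?\<Delta> \<union> insert x ` ?\<Delta>. (-1::int) ^ card B) =
      (\<Sum>B\<in>?\<Delta>. (-1) ^ card B) + (\<Sum>B\<in>insert x ` ?\<Delta>. (-1) ^ card B)"
    using fin(1) by (intro sum.union_disjoint) auto
  ultimately show ?thesis using \<Delta> by simp
qed

text \<open>If a submodular function \<open>w\<close> is negative at its minimizer \<open>M\<close>, then any point outside \<open>M\<close> is a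
  cone point of the complex of all sets with no subset at which \<open>w\<close> is negative.\<close>

lemma sum_good_chains:
  fixes w :: "nat set \<Rightarrow> real"
  assumes "finite A" and "w {} = 0" and "w A \<ge> 0"
    and "\<And>B C. B \<subseteq> A \<Longrightarrow> C \<subseteq> A \<Longrightarrow> w (B \<union> C) + w (B \<inter> C) \<le> w B + w C"
  shows "(\<Sum>L | chain_list A L. (-1::int) ^ length L * of_bool (\<forall>B\<in>set L. w B \<ge> 0)) =
    (-1) ^ card A * of_bool (\<forall>B\<subseteq>A. w B \<ge> 0)"
  using assms
proof (induction A rule: finite_psubset_induct)
  case (psubset A)
  show ?case
  proof (cases "A = {}")
    case True
    then show ?thesis using psubset.prems by (simp add: chain_lists_empty)
  next
    case False
    let ?h = "\<lambda>L. (-1::int) ^ length L * of_bool (\<forall>B\<in>set L. w B \<ge> 0)"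
    let ?good = "\<lambda>A. \<forall>B\<subseteq>A. w B \<ge> 0"
    have fin: "finite {B. B \<subset> A}" using psubset.hyps by (auto intro: finite_subset[of _ "Pow A"])
    have finB: "finite B" if "B \<subset> A" for B using psubset.hyps that by (auto intro: finite_subset)
    define \<Delta> where "\<Delta> = {B. B \<subset> A \<and> ?good B}"
    have fin\<Delta>: "finite \<Delta>" using fin by (auto simp: \<Delta>_def)
    \<comment> \<open>Chains are sorted by their first member B. The rest is a chain in B, to which
      the induction hypothesis applies if w B \<ge> 0; otherwise the contribution is zero.\<close>
    have "(\<Sum>L | chain_list A L. ?h L) = (\<Sum>B\<in>{B. B \<subset> A}. sum ?h ((#) B ` {L. chain_list B L}))"
      unfolding chain_lists_nonempty[OF False]
      using fin finB finite_chain_lists by (intro sum.UNION_disjoint) auto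
    also have "\<dots> = (\<Sum>B\<in>{B. B \<subset> A}. if B \<in> \<Delta> then - ((-1) ^ card B) else 0)"
    proof (intro sum.cong refl)
      fix B assume "B \<in> {B. B \<subset> A}"
      then have B: "B \<subset> A" by simp
      have "sum ?h ((#) B ` {L. chain_list B L}) = (\<Sum>L | chain_list B L. ?h (B # L))"
        by (simp add: sum.reindex)
      also have "\<dots> = (\<Sum>L | chain_list B L. - (of_bool (w B \<ge> 0) * ?h L))"
        by (intro sum.cong) auto
      also have "\<dots> = - (of_bool (w B \<ge> 0) * (\<Sum>L | chain_list B L. ?h L))"
        by (simp only: sum_negf sum_distrib_left)
      also have "\<dots> = (if B \<in> \<Delta> then - ((-1) ^ card B) else 0)"
      proof (cases "w B \<ge> 0")
        case True
        have "(\<Sum>L | chain_list B L. ?h L) = (-1) ^ card B * of_bool (?good B)"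
          using B True psubset.prems by (intro psubset.IH) auto
        then show ?thesis using B True by (simp add: \<Delta>_def)
      qed (auto simp: \<Delta>_def)
      finally show "sum ?h ((#) B ` {L. chain_list B L}) = (if B \<in> \<Delta> then - ((-1) ^ card B) else 0)" .
    qed
    also have "\<dots> = - (\<Sum>B\<in>\<Delta>. (-1) ^ card B)"
    proof -
      have "{B. B \<subset> A} \<inter> \<Delta> = \<Delta>" by (auto simp: \<Delta>_def)
      then show ?thesis using fin by (simp add: sum.inter_restrict[symmetric] sum_negf del: sum.inter_restrict)
    qed
    also have "\<dots> = (-1) ^ card A * of_bool (?good A)"
    proof (cases "?good A")
      case True
      \<comment> \<open>Here \<Delta> consists of all proper subsets, and the alternating sum over
        the whole power set vanishes, which leaves the term of \<open>A\<close>.\<close>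
      obtain x where "x \<in> A" using False by blast
      then have "(\<Sum>B\<in>Pow A. (-1::int) ^ card B) = 0"
        using psubset.hyps by (intro sum_alternating_cone[of _ x]) (auto intro: finite_subset)
      moreover have "Pow A = insert A \<Delta>" "A \<notin> \<Delta>" using True by (auto simp: \<Delta>_def)
      ultimately have "(-1) ^ card A + (\<Sum>B\<in>\<Delta>. (-1::int) ^ card B) = 0" using fin\<Delta> by simp
      then show ?thesis using True by simp
    next
      case bad: False
      have "Min (w ` Pow A) \<in> w ` Pow A" using psubset.hyps by (intro Min_in) auto
      then obtain M where M: "M \<subseteq> A" "Min (w ` Pow A) = w M" by auto
      have Mmin: "w M \<le> w B" if "B \<subseteq> A" for B
        unfolding M(2)[symmetric] using that psubset.hyps by (intro Min_le) auto
      obtain B where "B \<subseteq> A" "w B < 0" using bad by (auto simp: not_le)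
      then have Mneg: "w M < 0" using Mmin[of B] by linarith
      then have "M \<noteq> A" using psubset.prems(2) by auto
      then obtain x where x: "x \<in> A" "x \<notin> M" using M(1) by blast
      have "(\<Sum>B\<in>\<Delta>. (-1::int) ^ card B) = 0"
      proof (rule sum_alternating_cone[OF fin\<Delta>])
        show "finite B" if "B \<in> \<Delta>" for B using that finB by (auto simp: \<Delta>_def)
        show "B - {x} \<in> \<Delta>" if "B \<in> \<Delta>" for B using that by (auto simp: \<Delta>_def)
        show "insert x B \<in> \<Delta>" if "B \<in> \<Delta>" for B
        proof -
          have B: "B \<subset> A" "?good B" using that by (auto simp: \<Delta>_def)
          have good: "?good (insert x B)"
          proof (intro allI impI, rule ccontr)
            fix C assume C: "C \<subseteq> insert x B" "\<not> 0 \<le> w C"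
            then have CA: "C \<subseteq> A" using B(1) x by auto
            \<comment> \<open>Minimality of \<open>M\<close> bounds the union from below, so a
              negative value at \<open>C\<close> would pass to the intersection with
              \<open>M\<close>, which avoids \<open>x\<close> and therefore lies in
              \<open>B\<close>.\<close>
            have "w (C \<union> M) + w (C \<inter> M) \<le> w C + w M" using CA M(1) by (intro psubset.prems(3))
            moreover have "w M \<le> w (C \<union> M)" using CA M(1) by (intro Mmin) auto
            moreover have "C \<inter> M \<subseteq> B" using C(1) x(2) by auto
            then have "0 \<le> w (C \<inter> M)" using B(2) by blast
            ultimately show False using C(2) by linarith
          qed
          then have "insert x B \<noteq> A" using bad by auto
          then show ?thesis using good B(1) x(1) by (auto simp: \<Delta>_def)
        qed
      qed
      then show ?thesis using bad by simp
    qed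
    finally show ?thesis .
  qed
qed

text \<open>Listing the cube inequalities explicitly gives all pieces of the decomposition and the
  polytope itself a common first factor, so that only the remaining constraints have to be
  compared.\<close>

lemma mem_base_polytope_iff:
  assumes rk: "polymatroid {1..d} rk" "\<And>i. i \<in> {1..d} \<Longrightarrow> rk {i} \<le> m"
  shows "y \<in> base_polytope d rk \<longleftrightarrow>
    ((\<forall>i. i \<notin> {1..d} \<longrightarrow> y i = 0) \<and> sum y {1..d} = real (rk {1..d}) \<and> (\<forall>i\<in>{1..d}. 0 \<le> y i \<and> y i \<le> real m)) \<and>
    (\<forall>B\<subseteq>{1..d}. 0 \<le> real (rk B) - sum y B)"
proof -
  have "y i \<le> real m" if y: "y \<in> base_polytope d rk" and i: "i \<in> {1..d}" for i
  proof -
    have "sum y {i} \<le> real (rk {i})" using y i unfolding base_polytope_def by blast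
    then show ?thesis using rk(2)[OF i] by simp
  qed
  then show ?thesis using base_polytope_nonneg[OF rk(1)] by (auto simp: base_polytope_def)
qed

text \<open>The constraint for A follows from that for a minimising B in the chain: on A \<inter> B
  the coordinates sum to at most y(B) since they are nonnegative, and each element of A - B
  contributes at most m.\<close>

lemma mem_base_polytope_chain_rank_iff:
  assumes B: "\<B> \<subseteq> Pow {1..d}" "{} \<in> \<B>" "{1..d} \<in> \<B>"
    and chain: "\<And>B C. B \<in> \<B> \<Longrightarrow> C \<in> \<B> \<Longrightarrow> B \<subseteq> C \<or> C \<subseteq> B"
    and \<rho>: "\<rho> {} = 0" "\<And>B. B \<in> \<B> \<Longrightarrow> \<rho> {1..d} \<le> \<rho> B + m * card ({1..d} - B)"
  shows "y \<in> base_polytope d (chain_rank m {1..d} \<B> \<rho>) \<longleftrightarrow>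
    ((\<forall>i. i \<notin> {1..d} \<longrightarrow> y i = 0) \<and> sum y {1..d} = real (\<rho> {1..d}) \<and> (\<forall>i\<in>{1..d}. 0 \<le> y i \<and> y i \<le> real m)) \<and>
    (\<forall>B\<in>\<B>. 0 \<le> real (\<rho> B) - sum y B)"
    (is "?l \<longleftrightarrow> ?box \<and> ?ch")
proof -
  let ?D = "{1..d}" and ?r = "chain_rank m {1..d} \<B> \<rho>"
  have fin: "finite ?D" by simp
  have poly: "polymatroid ?D ?r"
    by (rule chain_rank_polymatroid(1)[where \<rho> = \<rho>, OF fin B(1,2) _ \<rho>(1)]) (rule chain)
  have le_m: "?r {i} \<le> m" if "i \<in> ?D" for i
    by (rule chain_rank_polymatroid(2)[where \<rho> = \<rho>, OF fin B(1,2) _ \<rho>(1) that]) (rule chain)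
  have top: "?r ?D = \<rho> ?D"
    by (rule chain_rank_top[where \<rho> = \<rho>, OF fin B(1,3)]) (rule \<rho>(2))
  show ?thesis
  proof
    assume l: ?l
    have "?box" using l mem_base_polytope_iff[OF poly le_m] top by simp
    moreover have ?ch
    proof
      fix B assume "B \<in> \<B>"
      then have "?r B \<le> \<rho> B" "B \<subseteq> ?D"
        using chain_rank_le[OF fin B(1), of B B m \<rho>] B(1) by auto
      moreover have "sum y B \<le> real (?r B)" using l \<open>B \<subseteq> ?D\<close> unfolding base_polytope_def by blast
      ultimately show "0 \<le> real (\<rho> B) - sum y B" by simp
    qed
    ultimately show "?box \<and> ?ch" ..
  next
    assume r: "?box \<and> ?ch"
    have "sum y A \<le> real (?r A)" if A: "A \<subseteq> ?D" for A
    proof -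
      obtain B where B': "B \<in> \<B>" "?r A = \<rho> B + m * card (A - B)"
        using chain_rank_attained[OF fin B(1) _ A, of m \<rho>] B(2) by blast
      then have BD: "B \<subseteq> ?D" using B(1) by auto
      have finA: "finite A" "finite B" using A BD by (auto intro: finite_subset)
      have "sum y A = sum y (A \<inter> B) + sum y (A - B)"
        using finA sum.Int_Diff[of A y B] by simp
      also have "sum y (A \<inter> B) \<le> sum y B" using r finA BD by (intro sum_mono2) auto
      also have "sum y (A - B) \<le> real (card (A - B)) * real m"
        using r A by (intro sum_bounded_above) auto
      also have "sum y B \<le> real (\<rho> B)" using r B'(1) by fastforce
      finally show ?thesis unfolding B'(2) by (simp add: mult.commute)
    qed
    then show ?l using r top by (simp add: base_polytope_def)
  qed
qed

text \<open>The decomposition of a base polytope into truncated cones, one for each chain, after Derksen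
  and Fink.\<close>

lemma base_indicator_chain_sum:
  assumes rk: "polymatroid {1..d} rk" "\<And>i. i \<in> {1..d} \<Longrightarrow> rk {i} \<le> m"
  shows "base_indicator d rk y = (\<Sum>L | chain_list {1..d} L.
    (-1) ^ (d + length L) * base_indicator d (chain_rank m {1..d} (set ({1..d} # L)) rk) y)"
proof -
  let ?D = "{1..d}"
  let ?box = "(\<forall>i. i \<notin> ?D \<longrightarrow> y i = 0) \<and> sum y ?D = real (rk ?D) \<and> (\<forall>i\<in>?D. 0 \<le> y i \<and> y i \<le> real m)"
  let ?w = "\<lambda>B. real (rk B) - sum y B"
  have L: "base_indicator d (chain_rank m ?D (set (?D # L)) rk) y =
      of_bool ?box * of_bool (\<forall>B\<in>set L. 0 \<le> ?w B)" if "chain_list ?D L" for L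
  proof -
    note ch = chain_list_props[OF that]
    have "rk ?D \<le> rk B + m * card (?D - B)" if "B \<in> set (?D # L)" for B
      using ch(2) that by (intro polymatroid_le_sum[OF rk]) auto
    then have "y \<in> base_polytope d (chain_rank m ?D (set (?D # L)) rk) \<longleftrightarrow>
        ?box \<and> (\<forall>B\<in>set (?D # L). 0 \<le> ?w B)"
      using ch polymatroidD(2)[OF rk(1)] by (intro mem_base_polytope_chain_rank_iff) auto
    also have "\<dots> \<longleftrightarrow> ?box \<and> (\<forall>B\<in>set L. 0 \<le> ?w B)" by auto
    finally show ?thesis unfolding base_indicator_def indicator_def by auto
  qed
  have "(\<Sum>L | chain_list ?D L. (-1) ^ (d + length L) * base_indicator d (chain_rank m ?D (set (?D # L)) rk) y) =
      (-1) ^ d * of_bool ?box * (\<Sum>L | chain_list ?D L. (-1) ^ length L * of_bool (\<forall>B\<in>set L. 0 \<le> ?w B))"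
    unfolding sum_distrib_left
  proof (rule sum.cong[OF refl])
    fix L assume "L \<in> {L. chain_list ?D L}"
    then show "(-1) ^ (d + length L) * base_indicator d (chain_rank m ?D (set (?D # L)) rk) y =
        (-1) ^ d * of_bool ?box * ((-1) ^ length L * of_bool (\<forall>B\<in>set L. 0 \<le> ?w B))"
      using L[of L] by (simp only: mem_Collect_eq power_add mult_ac)
  qed
  also have "\<dots> = of_bool ?box * of_bool (\<forall>B\<subseteq>?D. 0 \<le> ?w B)"
  proof (cases ?box)
    case True
    \<comment> \<open>For a point of the truncated hyperplane the slack rk B - y(B) is submodular,
      as y is modular, and vanishes at the empty set and at the whole set.\<close>
    have "(\<Sum>L | chain_list ?D L. (-1::int) ^ length L * of_bool (\<forall>B\<in>set L. ?w B \<ge> 0)) =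
        (-1) ^ card ?D * of_bool (\<forall>B\<subseteq>?D. ?w B \<ge> 0)"
    proof (rule sum_good_chains)
      fix B C assume BC: "B \<subseteq> ?D" "C \<subseteq> ?D"
      have "real (rk (B \<union> C)) + real (rk (B \<inter> C)) \<le> real (rk B) + real (rk C)"
        using polymatroidD(5)[OF rk(1) BC] by linarith
      moreover have "sum y (B \<union> C) + sum y (B \<inter> C) = sum y B + sum y C"
        using BC by (intro sum.union_inter) (auto intro: finite_subset)
      ultimately show "?w (B \<union> C) + ?w (B \<inter> C) \<le> ?w B + ?w C" by linarith
    qed (use True polymatroidD(2)[OF rk(1)] in auto)
    then have "(-1) ^ d * of_bool ?box * (\<Sum>L | chain_list ?D L. (-1) ^ length L * of_bool (\<forall>B\<in>set L. 0 \<le> ?w B)) =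
        of_bool ?box * (((-1) ^ d * (-1) ^ d) * of_bool (\<forall>B\<subseteq>?D. 0 \<le> ?w B) :: int)"
      by (simp only: mult_ac) simp
    then show ?thesis by (simp add: power_mult_distrib[symmetric])
  qed simp
  also have "\<dots> = base_indicator d rk y"
    using mem_base_polytope_iff[OF rk, where y = y] by (auto simp: base_indicator_def indicator_def)
  finally show ?thesis ..
qed

context singleton_rank_class
begin

text \<open>Each chain is refined to a fixed flag, and the term of that chain becomes a function of
  the jump word along this flag. The functions, hence the coefficients \<open>b\<close>, are the
  same for all rank functions of the bidegree.\<close>

lemma valuative_invariant_eq_flag_sum:
  assumes f: "f \<in> valuative_invariants K d r"
  shows "\<exists>b. \<forall>rk\<in>of_bidegree K d r. f rk = flag_sum rk {} {1..d} b"
proof -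
  let ?D = "{1..d}"
  let ?C = "{L. chain_list ?D L}"
  \<comment> \<open>One cube for the whole bidegree: the side bounds the ranks of all singletons
    that occur and lies in \<open>J\<close>, so the truncated pieces stay in the class.\<close>
  define m where "m = Max (J \<inter> {..r})"
  have "m \<in> J \<inter> {..r}" unfolding m_def using zero_J by (intro Max_in) auto
  then have mJ: "m \<in> J" by simp
  have m: "rk {i} \<le> m" if "rk \<in> of_bidegree K d r" "i \<in> ?D" for rk i
  proof -
    note rk = of_bidegreeD[OF singleton_rank_class_axioms that(1)]
    have "rk {i} \<le> rk ?D" using that(2) by (intro polymatroidD(4)[OF rk(1)]) auto
    then show ?thesis unfolding m_def using rk that(2) by (intro Max_ge) auto
  qed
  define fl where "fl = (\<lambda>L. SOME l. l \<in> permutations_of_set ?D \<and> (\<forall>B\<in>set (?D # L). set (take (card B) l) = B))"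
  have fl: "fl L \<in> permutations_of_set ?D" "\<And>B. B \<in> set (?D # L) \<Longrightarrow> set (take (card B) (fl L)) = B"
    if "L \<in> ?C" for L
  proof -
    have "\<exists>l. l \<in> permutations_of_set ?D \<and> (\<forall>B\<in>set (?D # L). set (take (card B) l) = B)"
      using chain_list_flag[of ?D L] that by auto
    from someI_ex[OF this] show "fl L \<in> permutations_of_set ?D"
      "\<And>B. B \<in> set (?D # L) \<Longrightarrow> set (take (card B) (fl L)) = B" by (auto simp: fl_def)
  qed
  \<comment> \<open>The ranks of the members of the chain are recovered from the word as partial
    sums, so \<open>g\<close> makes sense on arbitrary words without reference to a rank
    function.\<close>
  define g where "g = (\<lambda>L w. f (chain_rank m ?D (set (?D # L)) (\<lambda>B. sum_list (take (card B) w))))"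
  have expand: "f rk = (\<Sum>L\<in>?C. of_int ((-1) ^ (d + length L)) * g L (jumps rk {} (fl L)))"
    if rk: "rk \<in> of_bidegree K d r" for rk
  proof -
    note rk' = of_bidegreeD[OF singleton_rank_class_axioms rk]
    let ?R = "\<lambda>L. chain_rank m ?D (set (?D # L)) rk"
    have "f rk = (\<Sum>L\<in>?C. of_int ((-1) ^ (d + length L)) * f (?R L))"
    proof (rule valuative_invariantsD(3)[OF f])
      show "finite ?C" by (rule finite_chain_lists) simp
      show "?R ` ?C \<subseteq> of_bidegree K d r"
      proof clarify
        fix L assume L: "chain_list ?D L"
        note ch = chain_list_props[OF L]
        have fin: "finite ?D" by simp
        have "polymatroid ?D (?R L)"
          by (rule chain_rank_polymatroid(1)[where \<rho> = rk, OF fin ch(2,1) _ polymatroidD(2)[OF rk'(1)]]) (rule ch(3))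
        moreover have "?R L {i} \<in> J" if "i \<in> ?D" for i
        proof (rule down_J[OF mJ])
          show "?R L {i} \<le> m"
            by (rule chain_rank_polymatroid(2)[where \<rho> = rk, OF fin ch(2,1) _ polymatroidD(2)[OF rk'(1)] that]) (rule ch(3))
        qed
        moreover have "?R L ?D = rk ?D"
        proof (rule chain_rank_top[where \<rho> = rk, OF fin ch(2)])
          fix B assume "B \<in> set (?D # L)"
          then show "rk ?D \<le> rk B + m * card (?D - B)"
            using ch(2) by (intro polymatroid_le_sum[OF rk'(1) m[OF rk]]) auto
        qed simp
        ultimately show "?R L \<in> of_bidegree K d r"
          using rk'(2) by (simp only: of_bidegree_def K_iff mem_Collect_eq) blast
      qed
      show "base_indicator d rk y = (\<Sum>L\<in>?C. (-1) ^ (d + length L) * base_indicator d (?R L) y)" for y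
        by (rule base_indicator_chain_sum[OF rk'(1) m[OF rk]])
    qed (rule rk)
    also have "\<dots> = (\<Sum>L\<in>?C. of_int ((-1) ^ (d + length L)) * g L (jumps rk {} (fl L)))"
    proof (intro sum.cong refl arg_cong2[of _ _ _ _ "(*)"])
      fix L assume L: "L \<in> ?C"
      let ?w = "jumps rk {} (fl L)"
      have "sum_list (take (card B) ?w) = rk B" if "B \<in> set (?D # L)" for B
      proof -
        have l: "set (fl L) = ?D" "length (fl L) = d"
          using fl(1)[OF L] length_finite_permutations_of_set[OF fl(1)[OF L]] by (auto dest: permutations_of_setD)
        have "card B \<le> card ?D" using chain_list_props(2)[of ?D L] L that by (intro card_mono) auto
        then have "rk (set (take (card B) (fl L))) = sum_list (take (card B) ?w)"
          using jumps_eq_iff[OF rk'(1), of "fl L" ?w] l by simp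
        then show ?thesis using fl(2)[OF L that] by simp
      qed
      then have "chain_rank m ?D (set (?D # L)) (\<lambda>B. sum_list (take (card B) ?w)) = ?R L"
        unfolding chain_rank_def by (intro restrict_ext arg_cong[of _ _ Min] image_cong) auto
      then show "f (?R L) = g L ?w" unfolding g_def by simp
    qed
    finally show ?thesis .
  qed
  define b where "b = (\<lambda>w. (\<Sum>L\<in>?C. of_int ((-1) ^ (d + length L)) * g L w) / fact d)"
  have "f rk = flag_sum rk {} ?D b" if rk: "rk \<in> of_bidegree K d r" for rk
  proof -
    let ?S = "{\<sigma>. \<sigma> permutes ?D}"
    have cardS: "card ?S = fact d" using card_permutations[of ?D d] by simp
    \<comment> \<open>The permutations carry one fixed ordering to every ordering exactly once, and
      relabelling the rank function has the same effect as moving the flag.\<close>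
    have flag: "(\<Sum>\<sigma>\<in>?S. h (jumps (relabel d \<sigma> rk) {} l)) = flag_sum rk {} ?D h"
      if l: "l \<in> permutations_of_set ?D" for h l
    proof -
      have l': "set l = ?D" using l by (auto dest: permutations_of_setD)
      have inj: "inj_on (\<lambda>\<sigma>. map \<sigma> l) ?S"
      proof (rule inj_onI)
        fix \<sigma> \<tau> assume *: "\<sigma> \<in> ?S" "\<tau> \<in> ?S" "map \<sigma> l = map \<tau> l"
        then have "\<sigma> i = \<tau> i" for i
          using l' by (cases "i \<in> ?D") (auto simp: permutes_not_in)
        then show "\<sigma> = \<tau>" by auto
      qed
      have "(\<lambda>\<sigma>. map \<sigma> l) ` ?S = permutations_of_set ?D"
      proof (rule card_subset_eq)
        show "(\<lambda>\<sigma>. map \<sigma> l) ` ?S \<subseteq> permutations_of_set ?D"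
        proof clarify
          fix \<sigma> assume "\<sigma> permutes ?D"
          then show "map \<sigma> l \<in> permutations_of_set ?D"
            using permutations_of_set_image_permutes[of \<sigma> ?D] l by blast
        qed
        show "card ((\<lambda>\<sigma>. map \<sigma> l) ` ?S) = card (permutations_of_set ?D)"
          unfolding card_image[OF inj] cardS by simp
      qed simp
      then have "flag_sum rk {} ?D h = (\<Sum>\<sigma>\<in>?S. h (jumps rk {} (map \<sigma> l)))"
        unfolding flag_sum_def using sum.reindex[OF inj, of "\<lambda>l. h (jumps rk {} l)"] by simp
      also have "\<dots> = (\<Sum>\<sigma>\<in>?S. h (jumps (relabel d \<sigma> rk) {} l))"
      proof (rule sum.cong[OF refl])
        fix \<sigma> assume "\<sigma> \<in> ?S"
        have "jumps rk {} (map \<sigma> l) = jumps (relabel d \<sigma> rk) {} l"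
          by (rule jumps_map[of _ _ _ _ 0 _ _ 0]) (use l' in \<open>auto simp: relabel_def\<close>)
        then show "h (jumps rk {} (map \<sigma> l)) = h (jumps (relabel d \<sigma> rk) {} l)" by simp
      qed
      finally show ?thesis ..
    qed
    have "fact d * f rk = (\<Sum>\<sigma>\<in>?S. f (relabel d \<sigma> rk))"
      using valuative_invariantsD(2)[OF f rk] cardS by simp
    also have "\<dots> = (\<Sum>\<sigma>\<in>?S. \<Sum>L\<in>?C. of_int ((-1) ^ (d + length L)) * g L (jumps (relabel d \<sigma> rk) {} (fl L)))"
    proof (rule sum.cong[OF refl])
      fix \<sigma> assume "\<sigma> \<in> ?S"
      then show "f (relabel d \<sigma> rk) = (\<Sum>L\<in>?C. of_int ((-1) ^ (d + length L)) * g L (jumps (relabel d \<sigma> rk) {} (fl L)))"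
        using expand[OF relabel_of_bidegree[OF rk]] by simp
    qed
    also have "\<dots> = (\<Sum>L\<in>?C. of_int ((-1) ^ (d + length L)) * (\<Sum>\<sigma>\<in>?S. g L (jumps (relabel d \<sigma> rk) {} (fl L))))"
      unfolding sum_distrib_left by (rule sum.swap)
    also have "\<dots> = (\<Sum>L\<in>?C. of_int ((-1) ^ (d + length L)) * flag_sum rk {} ?D (g L))"
    proof (rule sum.cong[OF refl])
      fix L assume "L \<in> ?C"
      then show "of_int ((-1) ^ (d + length L)) * (\<Sum>\<sigma>\<in>?S. g L (jumps (relabel d \<sigma> rk) {} (fl L))) =
          of_int ((-1) ^ (d + length L)) * flag_sum rk {} ?D (g L)"
        using flag[OF fl(1), of L "g L"] by simp
    qed
    also have "\<dots> = (\<Sum>l\<in>permutations_of_set ?D. \<Sum>L\<in>?C. of_int ((-1) ^ (d + length L)) * g L (jumps rk {} l))"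
      unfolding flag_sum_def sum_distrib_left by (rule sum.swap)
    also have "\<dots> = fact d * flag_sum rk {} ?D b"
      unfolding flag_sum_def b_def sum_distrib_left by simp
    finally show ?thesis by simp
  qed
  then show ?thesis by blast
qed

end

section \<open>The algebra isomorphism\<close>

text \<open>The letters of a word are bounded by its sum, which settles the infinite alphabet
  too.\<close>

lemma finite_words_bidegree: "finite {w :: nat list. length w = d \<and> sum_list w = r}"
proof (rule finite_subset)
  show "{w :: nat list. length w = d \<and> sum_list w = r} \<subseteq> {w. set w \<subseteq> {..r} \<and> length w = d}"
    by (auto simp: member_le_sum_list)
qed (simp add: finite_lists_length_eq)

lemma carrier_nc_algebra: "carrier (nc_algebra J) = {a. \<forall>w. a w \<noteq> 0 \<longrightarrow> set w \<subseteq> J}"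
proof -
  have "finite {w. a w \<noteq> 0 \<and> length w = d \<and> sum_list w = r}" for a :: nc_series and d r
    by (rule finite_subset[OF _ finite_words_bidegree[of d r]]) auto
  then show ?thesis by (simp add: nc_algebra_def)
qed

section \<open>Restriction, contraction and the product\<close>

lemma flag_sum_restriction: "flag_sum (restriction rk A) {} A a = flag_sum rk {} A a"
  by (rule flag_sum_transport[where \<beta> = id and c = 0 and c' = 0]) (auto simp: restriction_def)

lemma flag_sum_contraction:
  assumes "polymatroid X rk" "A \<subseteq> X"
  shows "flag_sum (contraction X rk A) {} (X - A) a = flag_sum rk A (X - A) a"
proof (rule flag_sum_transport[where \<beta> = id and c = "rk A" and c' = 0])
  fix S assume "S \<subseteq> X - A"
  moreover from this have "rk A \<le> rk (A \<union> S)" using assms(2) by (intro polymatroidD(4)[OF assms(1)]) auto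
  ultimately show "contraction X rk A ({} \<union> id ` S) + rk A = rk (A \<union> S) + 0"
    by (simp add: contraction_def)
qed simp

lemma polymatroid_restriction:
  assumes "polymatroid X rk" "A \<subseteq> X"
  shows "polymatroid A (restriction rk A)"
  using polymatroid_pullback[OF assms(1), of id A] assms finite_subset[OF assms(2) polymatroidD(1)[OF assms(1)]]
  by (simp add: restriction_def)

lemma polymatroid_contraction:
  assumes rk: "polymatroid X rk" and A: "A \<subseteq> X"
  shows "polymatroid (X - A) (contraction X rk A)"
  unfolding polymatroid_def
proof (intro conjI allI impI)
  fix B C assume BC: "B \<subseteq> C \<and> C \<subseteq> X - A"
  then have "rk (A \<union> B) \<le> rk (A \<union> C)" using A by (intro polymatroidD(4)[OF rk]) auto
  then show "contraction X rk A B \<le> contraction X rk A C"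
    using BC by (auto simp: contraction_def)
next
  fix B C assume BC: "B \<subseteq> X - A \<and> C \<subseteq> X - A"
  have "rk ((A \<union> B) \<union> (A \<union> C)) + rk ((A \<union> B) \<inter> (A \<union> C)) \<le> rk (A \<union> B) + rk (A \<union> C)"
    using A BC by (intro polymatroidD(5)[OF rk]) auto
  moreover have "(A \<union> B) \<union> (A \<union> C) = A \<union> (B \<union> C)" "(A \<union> B) \<inter> (A \<union> C) = A \<union> (B \<inter> C)" by auto
  moreover have "rk A \<le> rk (A \<union> (B \<inter> C))" "rk A \<le> rk (A \<union> B)" "rk A \<le> rk (A \<union> C)" "rk A \<le> rk (A \<union> (B \<union> C))"
    using A BC by (auto intro!: polymatroidD(4)[OF rk])
  moreover have "B \<union> C \<subseteq> X - A" "B \<inter> C \<subseteq> X - A" using BC by auto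
  ultimately show "contraction X rk A (B \<union> C) + contraction X rk A (B \<inter> C) \<le>
      contraction X rk A B + contraction X rk A C"
    using BC by (simp add: contraction_def)
qed (use polymatroidD(1)[OF rk] in \<open>auto simp: contraction_def\<close>)

context singleton_rank_class
begin

lemma K_restriction: "K X rk \<Longrightarrow> A \<subseteq> X \<Longrightarrow> K A (restriction rk A)"
  using polymatroid_restriction by (auto simp: K_iff restriction_def)

lemma K_contraction:
  assumes "K X rk" "A \<subseteq> X"
  shows "K (X - A) (contraction X rk A)"
proof -
  have rk: "polymatroid X rk" using assms(1) by (simp add: K_iff)
  have "contraction X rk A {i} \<in> J" if "i \<in> X - A" for i
  proof (rule down_J)
    show "rk {i} \<in> J" using assms that by (simp add: K_iff)
    show "contraction X rk A {i} \<le> rk {i}"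
      using polymatroid_insert_le[OF rk assms(2), of i] that by (simp add: contraction_def)
  qed
  then show ?thesis using polymatroid_contraction[OF rk assms(2)] by (simp add: K_iff)
qed

text \<open>Flag sums are invariant under bijections of the ground set, so the arbitrary choice in
  \<open>value_on\<close> has no effect.\<close>

lemma value_on_flag_invariant:
  assumes rk: "K X rk" and X: "card X = d" "rk X = r"
  shows "value_on d (flag_invariant K a d r) X rk = flag_sum rk {} X a"
proof -
  let ?\<beta> = "SOME \<beta>. bij_betw \<beta> {1..d} X"
  have "finite X" using rk by (auto simp: K_iff dest: polymatroidD)
  then have "\<exists>\<beta>. bij_betw \<beta> {1..d} X"
    using X(1) by (intro finite_same_card_bij) auto
  then have \<beta>: "bij_betw ?\<beta> {1..d} X" by (rule someI_ex)
  have "flag_sum rk {} X a = flag_sum (restrict (\<lambda>S. rk (?\<beta> ` S)) (Pow {1..d})) {} {1..d} a"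
    by (rule flag_sum_transport[OF \<beta>, of _ _ 0 _ _ 0]) simp
  then show ?thesis
    using pullback_of_bidegree[OF \<beta> rk] X(2) by (simp add: value_on_def flag_invariant_def)
qed

lemma flag_invariant_carrier: "flag_invariant K a \<in> carrier (invariant_algebra K)"
  by (simp add: invariant_algebra_def flag_invariant_valuative)

text \<open>A subset A appears in exactly one homogeneous product, the one for card A and rk A. The
  sum over all bidegrees of the factors is therefore the sum over all subsets, the places where a
  flag can be cut.\<close>

lemma flag_invariant_product:
  "flag_invariant K (nc_product a b) = invariant_product K (flag_invariant K a) (flag_invariant K b)"
proof (intro ext)
  fix n t :: nat and rk
  let ?D = "{1..n}"
  show "flag_invariant K (nc_product a b) n t rk = invariant_product K (flag_invariant K a) (flag_invariant K b) n t rk"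
  proof (cases "rk \<in> of_bidegree K n t")
    case False
    then show ?thesis by (simp add: flag_invariant_def invariant_product_def homogeneous_product_def)
  next
    case True
    then have rk: "K ?D rk" "polymatroid ?D rk" "rk ?D = t" by (auto simp: of_bidegree_def K_iff)
    let ?F = "\<lambda>A. flag_sum rk {} A a * flag_sum rk A (?D - A) b"
    have hom: "homogeneous_product K d r (n - d) (t - r) (flag_invariant K a d r) (flag_invariant K b (n - d) (t - r)) rk =
        (\<Sum>A | A \<subseteq> ?D \<and> card A = d \<and> rk A = r. ?F A)" if "d \<le> n" "r \<le> t" for d r
    proof -
      have "homogeneous_product K d r (n - d) (t - r) (flag_invariant K a d r) (flag_invariant K b (n - d) (t - r)) rk =
        (\<Sum>A | A \<subseteq> ?D \<and> card A = d \<and> rk A = r.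
           value_on d (flag_invariant K a d r) A (restriction rk A) *
           value_on (n - d) (flag_invariant K b (n - d) (t - r)) (?D - A) (contraction ?D rk A))"
        using True that by (simp add: homogeneous_product_def)
      also have "\<dots> = (\<Sum>A | A \<subseteq> ?D \<and> card A = d \<and> rk A = r. ?F A)"
      proof (rule sum.cong[OF refl])
        fix A assume "A \<in> {A. A \<subseteq> ?D \<and> card A = d \<and> rk A = r}"
        then have A: "A \<subseteq> ?D" "card A = d" "rk A = r" by auto
        have "value_on d (flag_invariant K a d r) A (restriction rk A) = flag_sum (restriction rk A) {} A a"
          using A by (intro value_on_flag_invariant K_restriction[OF rk(1)]) (auto simp: restriction_def)
        then have "value_on d (flag_invariant K a d r) A (restriction rk A) = flag_sum rk {} A a"
          by (simp only: flag_sum_restriction)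
        moreover have "value_on (n - d) (flag_invariant K b (n - d) (t - r)) (?D - A) (contraction ?D rk A) =
            flag_sum rk A (?D - A) b"
          unfolding flag_sum_contraction[OF rk(2) A(1), symmetric]
        proof (intro value_on_flag_invariant K_contraction[OF rk(1) A(1)])
          show "card (?D - A) = n - d" using A by (subst card_Diff_subset) (auto intro: finite_subset)
          have "A \<union> (?D - A) = ?D" using A by auto
          then show "contraction ?D rk A (?D - A) = t - r"
            using A rk(3) by (simp add: contraction_def)
        qed
        ultimately show "value_on d (flag_invariant K a d r) A (restriction rk A) *
           value_on (n - d) (flag_invariant K b (n - d) (t - r)) (?D - A) (contraction ?D rk A) = ?F A" by simp
      qed
      finally show ?thesis .
    qed
    have "invariant_product K (flag_invariant K a) (flag_invariant K b) n t rk =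
        (\<Sum>d\<le>n. \<Sum>r\<le>t. \<Sum>A | A \<subseteq> ?D \<and> card A = d \<and> rk A = r. ?F A)"
      unfolding invariant_product_def by (intro sum.cong refl hom) auto
    also have "\<dots> = (\<Sum>(d,r)\<in>{..n} \<times> {..t}. \<Sum>A | A \<in> Pow ?D \<and> (card A, rk A) = (d, r). ?F A)"
      unfolding sum.cartesian_product by (intro sum.cong) auto
    also have "\<dots> = (\<Sum>dr\<in>{..n} \<times> {..t}. \<Sum>A | A \<in> Pow ?D \<and> (card A, rk A) = dr. ?F A)"
      by (intro sum.cong) auto
    also have "\<dots> = (\<Sum>A\<in>Pow ?D. ?F A)"
    proof (rule sum.group)
      show "(\<lambda>A. (card A, rk A)) ` Pow ?D \<subseteq> {..n} \<times> {..t}"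
      proof (rule image_subsetI)
        fix A assume "A \<in> Pow ?D"
        then have A: "A \<subseteq> ?D" by simp
        have "card A \<le> card ?D" using A by (intro card_mono) auto
        moreover have "rk A \<le> rk ?D" using A by (intro polymatroidD(4)[OF rk(2)]) auto
        ultimately show "(card A, rk A) \<in> {..n} \<times> {..t}" using rk(3) by simp
      qed
    qed auto
    also have "\<dots> = flag_sum rk {} ?D (nc_product a b)"
      by (subst flag_sum_product) simp_all
    finally show ?thesis using True by (simp add: flag_invariant_def)
  qed
qed

lemma jumps_word:
  assumes rk: "rk \<in> of_bidegree K d r" and l: "l \<in> permutations_of_set {1..d}"
  shows "length (jumps rk {} l) = d" "sum_list (jumps rk {} l) = r" "set (jumps rk {} l) \<subseteq> J"
proof -
  note rk' = of_bidegreeD[OF singleton_rank_class_axioms rk]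
  have l': "set l = {1..d}" using l by (auto dest: permutations_of_setD)
  show "length (jumps rk {} l) = d" using length_finite_permutations_of_set[OF l] by simp
  show "sum_list (jumps rk {} l) = r"
    using sum_list_jumps[OF rk'(1), of "{}" l] l' rk'(2) polymatroidD(2)[OF rk'(1)] by simp
  show "set (jumps rk {} l) \<subseteq> J"
    using l' rk'(3) down_J by (intro set_jumps[OF rk'(1)]) blast+
qed

lemma flag_sum_cong_words:
  assumes rk: "rk \<in> of_bidegree K d r"
    and "\<And>w. length w = d \<Longrightarrow> sum_list w = r \<Longrightarrow> set w \<subseteq> J \<Longrightarrow> a w = b w"
  shows "flag_sum rk {} {1..d} a = flag_sum rk {} {1..d} b"
  unfolding flag_sum_def using assms(2) jumps_word[OF rk] by (intro sum.cong refl) blast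

lemma flag_invariant_inj:
  assumes "a \<in> carrier (nc_algebra J)" "b \<in> carrier (nc_algebra J)"
    and eq: "flag_invariant K a = flag_invariant K b"
  shows "a = b"
proof
  fix w
  show "a w = b w"
  proof (cases "set w \<subseteq> J")
    case True
    have "(\<lambda>w. a w - b w) w = 0"
    proof (rule flag_sum_independent)
      fix rk assume rk: "rk \<in> of_bidegree K (length w) (sum_list w)"
      have "flag_sum rk {} {1..length w} a = flag_sum rk {} {1..length w} b"
        using fun_cong[OF fun_cong[OF fun_cong[OF eq, of "length w"], of "sum_list w"], of rk] rk
        by (simp add: flag_invariant_def)
      then show "flag_sum rk {} {1..length w} (\<lambda>w. a w - b w) = 0"
        by (simp add: flag_sum_def sum_subtractf)
    qed (use True in auto)
    then show ?thesis by simp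
  next
    case False
    then have "a w = 0" "b w = 0" using assms(1,2) unfolding carrier_nc_algebra by blast+
    then show ?thesis by simp
  qed
qed

text \<open>A word has only one bidegree, so the coefficients found separately in each bidegree fit
  into a single series.\<close>

lemma flag_invariant_surj:
  assumes F: "F \<in> carrier (invariant_algebra K)"
  shows "\<exists>a\<in>carrier (nc_algebra J). flag_invariant K a = F"
proof -
  have val: "F d r \<in> valuative_invariants K d r" for d r using F by (simp add: invariant_algebra_def)
  then have "\<forall>d r. \<exists>b. \<forall>rk\<in>of_bidegree K d r. F d r rk = flag_sum rk {} {1..d} b"
    using valuative_invariant_eq_flag_sum by blast
  then obtain b where b: "\<And>d r rk. rk \<in> of_bidegree K d r \<Longrightarrow> F d r rk = flag_sum rk {} {1..d} (b d r)" by metis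
  define a where "a = (\<lambda>w. if set w \<subseteq> J then b (length w) (sum_list w) w else 0)"
  have "flag_invariant K a d r rk = F d r rk" for d r rk
  proof (cases "rk \<in> of_bidegree K d r")
    case True
    have "flag_sum rk {} {1..d} a = flag_sum rk {} {1..d} (b d r)"
      by (rule flag_sum_cong_words[OF True]) (simp add: a_def)
    then show ?thesis using b[OF True] True by (simp add: flag_invariant_def)
  next
    case False
    then show ?thesis using valuative_invariantsD(1)[OF val] by (simp add: flag_invariant_def)
  qed
  then have "flag_invariant K a = F" by blast
  moreover have "a \<in> carrier (nc_algebra J)" by (simp add: carrier_nc_algebra a_def)
  ultimately show ?thesis by blast
qed

lemma flag_invariant_add: "flag_invariant K (a + b) = flag_invariant K a + flag_invariant K b"
  by (intro ext) (simp add: flag_invariant_def flag_sum_def sum.distrib)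

lemma flag_invariant_scale: "flag_invariant K (nc_scale c a) = invariant_scale c (flag_invariant K a)"
  by (intro ext) (simp add: flag_invariant_def invariant_scale_def nc_scale_def flag_sum_def sum_distrib_left)

lemma flag_invariant_component:
  "flag_invariant K (nc_component d r a) = invariant_component d r (flag_invariant K a)"
proof (intro ext)
  fix d' r' rk
  have "flag_sum rk {} {1..d'} (nc_component d r a) = (if d' = d \<and> r' = r then flag_sum rk {} {1..d'} a else 0)"
    if rk: "rk \<in> of_bidegree K d' r'"
  proof -
    have "flag_sum rk {} {1..d'} (nc_component d r a) =
        flag_sum rk {} {1..d'} (if d' = d \<and> r' = r then a else (\<lambda>_. 0))"
      by (rule flag_sum_cong_words[OF rk]) (auto simp: nc_component_def)
    then show ?thesis by (simp add: flag_sum_def)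
  qed
  then show "flag_invariant K (nc_component d r a) d' r' rk = invariant_component d r (flag_invariant K a) d' r' rk"
    by (auto simp: flag_invariant_def invariant_component_def)
qed

lemma flag_invariant_unit: "flag_invariant K (nc_monomial []) = invariant_unit K"
proof (intro ext)
  fix d r rk
  show "flag_invariant K (nc_monomial []) d r rk = invariant_unit K d r rk"
  proof (cases "rk \<in> of_bidegree K d r")
    case True
    note rk = of_bidegreeD[OF singleton_rank_class_axioms True]
    show ?thesis
    proof (cases "d = 0")
      case d: True
      then have "r = 0" using rk(2) polymatroidD(2)[OF rk(1)] by simp
      then show ?thesis using d True by (simp add: flag_invariant_def invariant_unit_def flag_sum_def nc_monomial_def)
    next
      case d: False
      have "flag_sum rk {} {1..d} (nc_monomial []) = flag_sum rk {} {1..d} (\<lambda>_. 0)"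
        by (rule flag_sum_cong_words[OF True]) (use d in \<open>auto simp: nc_monomial_def\<close>)
      then show ?thesis using d by (simp add: flag_invariant_def invariant_unit_def flag_sum_def)
    qed
  qed (auto simp: flag_invariant_def invariant_unit_def)
qed

lemma flag_invariant_generator: "flag_invariant K (nc_monomial [i]) = u_invariant K i"
proof (intro ext)
  fix d r rk
  show "flag_invariant K (nc_monomial [i]) d r rk = u_invariant K i d r rk"
  proof (cases "rk \<in> of_bidegree K d r \<and> d = 1 \<and> r = i")
    case True
    then have "rk \<in> of_bidegree K d r" "d = 1" "r = i" by blast+
    then have rk: "rk \<in> of_bidegree K 1 i" by simp
    have "flag_sum rk {} {1..1} (nc_monomial [i]) = flag_sum rk {} {1..1} (\<lambda>_. 1)"
    proof (rule flag_sum_cong_words[OF rk])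
      fix w :: "nat list" assume "length w = 1" "sum_list w = i"
      then have "w = [i]" by (cases w) auto
      then show "nc_monomial [i] w = 1" by (simp add: nc_monomial_def)
    qed
    then show ?thesis using True by (simp add: flag_invariant_def u_invariant_def flag_sum_def)
  next
    case False
    have "flag_sum rk {} {1..d} (nc_monomial [i]) = flag_sum rk {} {1..d} (\<lambda>_. 0)" if rk: "rk \<in> of_bidegree K d r"
      by (rule flag_sum_cong_words[OF rk]) (use rk False in \<open>auto simp: nc_monomial_def\<close>)
    then show ?thesis using False by (auto simp: flag_invariant_def u_invariant_def flag_sum_def)
  qed
qed

lemma nc_algebra_closed:
  assumes a: "a \<in> carrier (nc_algebra J)"
  shows "nc_scale c a \<in> carrier (nc_algebra J)" "nc_component d r a \<in> carrier (nc_algebra J)"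
    "b \<in> carrier (nc_algebra J) \<Longrightarrow> a + b \<in> carrier (nc_algebra J)"
    "b \<in> carrier (nc_algebra J) \<Longrightarrow> nc_product a b \<in> carrier (nc_algebra J)"
    "nc_monomial [] \<in> carrier (nc_algebra J)"
    "i \<in> J \<Longrightarrow> nc_monomial [i] \<in> carrier (nc_algebra J)"
proof -
  show "nc_product a b \<in> carrier (nc_algebra J)" if b: "b \<in> carrier (nc_algebra J)"
    unfolding carrier_nc_algebra
  proof (intro CollectI allI impI)
    fix w assume "nc_product a b w \<noteq> 0"
    then obtain k where "a (take k w) * b (drop k w) \<noteq> 0"
      unfolding nc_product_def using sum.not_neutral_contains_not_neutral by force
    then have "set (take k w) \<subseteq> J" "set (drop k w) \<subseteq> J" using a b by (auto simp: carrier_nc_algebra)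
    then show "set w \<subseteq> J" by (metis Un_least append_take_drop_id set_append)
  qed
  show "a + b \<in> carrier (nc_algebra J)" if "b \<in> carrier (nc_algebra J)"
    unfolding carrier_nc_algebra
  proof (intro CollectI allI impI)
    fix w assume "(a + b) w \<noteq> 0"
    then have "a w \<noteq> 0 \<or> b w \<noteq> 0" by auto
    then show "set w \<subseteq> J" using a that by (auto simp: carrier_nc_algebra)
  qed
qed (use a in \<open>auto simp: carrier_nc_algebra nc_scale_def nc_component_def nc_monomial_def split: if_splits\<close>)

definition flag_coefficients :: "invariant_family \<Rightarrow> nc_series" where
  "flag_coefficients = inv_into (carrier (nc_algebra J)) (flag_invariant K)"

lemma bij_flag_invariant:
  "bij_betw (flag_invariant K) (carrier (nc_algebra J)) (carrier (invariant_algebra K))"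
proof (rule bij_betw_imageI)
  show "inj_on (flag_invariant K) (carrier (nc_algebra J))"
    by (intro inj_onI flag_invariant_inj)
  show "flag_invariant K ` carrier (nc_algebra J) = carrier (invariant_algebra K)"
    using flag_invariant_carrier flag_invariant_surj by blast
qed

lemma flag_coefficients_flag_invariant:
  "a \<in> carrier (nc_algebra J) \<Longrightarrow> flag_coefficients (flag_invariant K a) = a"
  unfolding flag_coefficients_def using bij_flag_invariant by (intro inv_into_f_f) (auto simp: bij_betw_def)

text \<open>Every invariant is the image of a series, so each compatibility is transported from the
  corresponding one of \<open>flag_invariant\<close>.\<close>

lemma bigraded_algebra_iso_flag_coefficients: "bigraded_algebra_iso K J flag_coefficients"
proof -
  let ?V = "invariant_algebra K" and ?N = "nc_algebra J"
  have ops: "mult ?V = invariant_product K" "one ?V = invariant_unit K" "add ?V = (+)"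
    "mult ?N = nc_product" "one ?N = nc_monomial []" "add ?N = (+)"
    by (simp_all add: invariant_algebra_def nc_algebra_def)
  have bij: "bij_betw flag_coefficients (carrier ?V) (carrier ?N)"
    unfolding flag_coefficients_def by (rule bij_betw_inv_into[OF bij_flag_invariant])
  note inv = flag_coefficients_flag_invariant and ex = flag_invariant_surj
  have one: "nc_monomial [] \<in> carrier ?N" by (simp add: carrier_nc_algebra nc_monomial_def)
  have "flag_coefficients \<in> ring_iso ?V ?N"
    unfolding ring_iso_def
  proof (intro CollectI conjI bij ring_hom_memI, unfold ops)
    show "flag_coefficients F \<in> carrier ?N" if "F \<in> carrier ?V" for F using bij that by (rule bij_betwE[rule_format])
    show "flag_coefficients (invariant_unit K) = nc_monomial []"
      using inv[OF one] by (simp add: flag_invariant_unit)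
    fix F G assume FG: "F \<in> carrier ?V" "G \<in> carrier ?V"
    then obtain a b where ab: "a \<in> carrier ?N" "F = flag_invariant K a" "b \<in> carrier ?N" "G = flag_invariant K b"
      using ex by metis
    show "flag_coefficients (invariant_product K F G) = nc_product (flag_coefficients F) (flag_coefficients G)"
      using inv[OF nc_algebra_closed(4)[OF ab(1,3)]] inv[OF ab(1)] inv[OF ab(3)]
      by (simp only: ab(2,4) flag_invariant_product)
    show "flag_coefficients (F + G) = flag_coefficients F + flag_coefficients G"
      using inv[OF nc_algebra_closed(3)[OF ab(1,3)]] inv[OF ab(1)] inv[OF ab(3)]
      by (simp only: ab(2,4) flag_invariant_add)
  qed
  moreover have "flag_coefficients (invariant_scale c F) = nc_scale c (flag_coefficients F)"
    "flag_coefficients (invariant_component d r F) = nc_component d r (flag_coefficients F)"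
    if "F \<in> carrier ?V" for c d r F
  proof -
    obtain a where a: "a \<in> carrier ?N" "F = flag_invariant K a" using ex \<open>F \<in> carrier ?V\<close> by metis
    show "flag_coefficients (invariant_scale c F) = nc_scale c (flag_coefficients F)"
      using inv[OF nc_algebra_closed(1)[OF a(1)]] inv[OF a(1)]
      by (simp only: a(2) flag_invariant_scale[symmetric])
    show "flag_coefficients (invariant_component d r F) = nc_component d r (flag_coefficients F)"
      using inv[OF nc_algebra_closed(2)[OF a(1)]] inv[OF a(1)]
      by (simp only: a(2) flag_invariant_component[symmetric])
  qed
  ultimately show ?thesis unfolding bigraded_algebra_iso_def by blast
qed

lemma flag_coefficients_generator:
  assumes "i \<in> J"
  shows "flag_coefficients (u_invariant K i) = nc_monomial [i]"
proof -
  have "nc_monomial [i] \<in> carrier (nc_algebra J)"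
    using assms by (auto simp: carrier_nc_algebra nc_monomial_def)
  from flag_coefficients_flag_invariant[OF this] show ?thesis by (simp only: flag_invariant_generator)
qed

end

section \<open>Dimension of base polytopes\<close>

interpretation fun_space: vector_space "\<lambda>(c::real) (y::nat \<Rightarrow> real) i. c * y i"
  by unfold_locales (auto simp: fun_eq_iff algebra_simps)

text \<open>The root vector e_i - e_a. For fixed a in a finite set, these vectors span the vectors
  supported there with coordinate sum zero.\<close>

definition unit_difference :: "nat \<Rightarrow> nat \<Rightarrow> nat \<Rightarrow> real" where
  "unit_difference i a = (\<lambda>j. of_bool (j = i) - of_bool (j = a))"

lemma zero_sum_in_span:
  fixes z :: "nat \<Rightarrow> real"
  assumes A: "finite A" "a \<in> A" and z: "\<And>i. i \<notin> A \<Longrightarrow> z i = 0" "sum z A = 0"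
  shows "z \<in> fun_space.span ((\<lambda>i. unit_difference i a) ` (A - {a}))"
proof -
  have za: "sum z (A - {a}) = - z a" using sum.remove[OF A, of z] z(2) by simp
  have "z = (\<Sum>i\<in>A - {a}. (\<lambda>j. z i * unit_difference i a j))"
  proof
    fix j
    have "(\<Sum>i\<in>A - {a}. z i * unit_difference i a j) =
        (\<Sum>i\<in>A - {a}. z i * of_bool (j = i)) - sum z (A - {a}) * of_bool (j = a)"
      by (simp only: unit_difference_def right_diff_distrib sum_subtractf sum_distrib_right)
    also have "(\<Sum>i\<in>A - {a}. z i * of_bool (j = i)) = (\<Sum>i\<in>A - {a}. if j = i then z i else 0)"
      by (intro sum.cong) auto
    also have "(\<Sum>i\<in>A - {a}. if j = i then z i else 0) - sum z (A - {a}) * of_bool (j = a) = z j"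
      using A(1) z(1)[of j] za by (cases "j = a") auto
    finally show "z j = (\<Sum>i\<in>A - {a}. (\<lambda>j. z i * unit_difference i a j)) j" by (simp add: sum_fun_apply)
  qed
  also have "\<dots> \<in> fun_space.span ((\<lambda>i. unit_difference i a) ` (A - {a}))"
    by (intro fun_space.span_sum fun_space.span_scale fun_space.span_base) auto
  finally show ?thesis .
qed

text \<open>The constraints for A and for its complement add up to the total, so both are tight on
  the whole polytope. Differences of points then have coordinate sum zero on each of the two blocks,
  which costs one dimension per block.\<close>

lemma affine_dimension_separable:
  assumes A: "A \<subseteq> {1..d}" "A \<noteq> {}" "A \<noteq> {1..d}" and sep: "rk A + rk ({1..d} - A) = rk {1..d}"
  shows "affine_dimension (base_polytope d rk) + 2 \<le> d"
proof -
  let ?D = "{1..d}"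
  let ?B = "?D - A"
  have fin: "finite A" "finite ?B" using A by (auto intro: finite_subset)
  obtain a b where ab: "a \<in> A" "b \<in> ?B" using A by blast
  let ?W = "(\<lambda>i. unit_difference i a) ` (A - {a}) \<union> (\<lambda>i. unit_difference i b) ` (?B - {b})"
  have tight: "sum y A = real (rk A)" if y: "y \<in> base_polytope d rk" for y
  proof -
    have "sum y A \<le> real (rk A)" "sum y ?B \<le> real (rk ?B)" "sum y ?D = real (rk ?D)"
      using y A(1) by (auto simp: base_polytope_def)
    moreover have "sum y ?D = sum y A + sum y ?B" using A(1) by (simp add: sum.subset_diff)
    moreover have "real (rk ?D) = real (rk A) + real (rk ?B)" using sep by (metis of_nat_add)
    ultimately show ?thesis by linarith
  qed
  have "{x - y | x y. x \<in> base_polytope d rk \<and> y \<in> base_polytope d rk} \<subseteq> fun_space.span ?W"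
  proof clarify
    fix x y assume xy: "x \<in> base_polytope d rk" "y \<in> base_polytope d rk"
    define z where "z = x - y"
    have off: "z i = 0" if "i \<notin> ?D" for i using xy that by (simp add: z_def base_polytope_def)
    have zA: "sum z A = 0" using tight[OF xy(1)] tight[OF xy(2)] by (simp add: z_def sum_subtractf)
    have "sum z ?D = 0" using xy by (simp add: z_def sum_subtractf base_polytope_def)
    then have zB: "sum z ?B = 0" using zA A(1) by (simp add: sum.subset_diff)
    let ?z1 = "\<lambda>i. if i \<in> A then z i else 0" and ?z2 = "\<lambda>i. if i \<in> ?B then z i else 0"
    have "sum ?z1 A = sum z A" "sum ?z2 ?B = sum z ?B" by (intro sum.cong; simp)+
    then have "sum ?z1 A = 0" "sum ?z2 ?B = 0" using zA zB by linarith+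
    then have "?z1 \<in> fun_space.span ((\<lambda>i. unit_difference i a) ` (A - {a}))"
      "?z2 \<in> fun_space.span ((\<lambda>i. unit_difference i b) ` (?B - {b}))"
      using fin ab by (intro zero_sum_in_span; auto)+
    then have "?z1 \<in> fun_space.span ?W" "?z2 \<in> fun_space.span ?W"
      using fun_space.span_mono[OF Un_upper1] fun_space.span_mono[OF Un_upper2] by blast+
    moreover have "x - y = ?z1 + ?z2" unfolding z_def[symmetric] using off by (auto simp: fun_eq_iff)
    ultimately show "x - y \<in> fun_space.span ?W" using fun_space.span_add by presburger
  qed
  then have "affine_dimension (base_polytope d rk) \<le> card ?W"
    unfolding affine_dimension_def using fin by (intro fun_space.dim_le_card) auto
  also have "\<dots> \<le> card (A - {a}) + card (?B - {b})"
    using fin by (intro order_trans[OF card_Un_le] add_mono card_image_le) auto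
  finally have "affine_dimension (base_polytope d rk) + 2 \<le> (card (A - {a}) + 1) + (card (?B - {b}) + 1)" by simp
  also have "\<dots> = card A + card ?B"
    using fin ab card_Suc_Diff1[of A a] card_Suc_Diff1[of ?B b] by simp
  also have "\<dots> = d"
    using fin A(1) card_Un_disjoint[of A ?B] by (simp add: Un_absorb1 Diff_partition)
  finally show ?thesis .
qed

text \<open>The average of greedy vertices, one for each proper subset, lies in the relative interior.\<close>

lemma affine_dimension_nonseparable:
  assumes rk: "polymatroid {1..d} rk" and d: "d \<ge> 2"
    and nonsep: "\<And>A. A \<subseteq> {1..d} \<Longrightarrow> A \<noteq> {} \<Longrightarrow> A \<noteq> {1..d} \<Longrightarrow> rk A + rk ({1..d} - A) \<noteq> rk {1..d}"
  shows "affine_dimension (base_polytope d rk) = d - 1"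
proof -
  let ?D = "{1..d}" and ?Q = "base_polytope d rk"
  define P where "P = {A. A \<subseteq> ?D \<and> A \<noteq> {} \<and> A \<noteq> ?D}"
  have finP: "finite P" by (auto simp: P_def intro: finite_subset[of _ "Pow ?D"])
  have "2 \<in> ?D" using d by simp
  then have "{1} \<noteq> ?D" by (metis numeral_One numeral_eq_iff semiring_norm(85) singletonD)
  then have "{1} \<in> P" using d by (simp add: P_def)
  then have cardP: "card P > 0" using finP by (auto simp: card_gt_0_iff)
  have "\<exists>y\<in>?Q. sum y A < real (rk A)" if "A \<in> P" for A
  proof -
    have A: "A \<subseteq> ?D" "A \<noteq> {}" "A \<noteq> ?D" using that by (auto simp: P_def)
    \<comment> \<open>Listing the complement of \<open>A\<close> first makes its constraint tight at
      the greedy vertex; nonseparability then leaves the constraint of \<open>A\<close>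
      strict.\<close>
    obtain l1 where l1: "set l1 = ?D - A" "distinct l1" using finite_distinct_list[of "?D - A"] by auto
    have "finite A" using A(1) by (auto intro: finite_subset)
    then obtain l2 where l2: "set l2 = A" "distinct l2" using finite_distinct_list by auto
    have l: "distinct (l1 @ l2)" "set (l1 @ l2) = ?D" using l1 l2 A by auto
    have "\<exists>y::nat \<Rightarrow> real. (\<forall>i. i \<notin> set (l1 @ l2) \<longrightarrow> y i = 0) \<and> (\<forall>A\<subseteq>set (l1 @ l2). sum y A \<le> real (rk A)) \<and>
        (\<forall>k\<le>length (l1 @ l2). sum y (set (take k (l1 @ l2))) = real (rk (set (take k (l1 @ l2)))))"
      by (rule greedy_vertex[OF rk l(1)]) (simp only: l(2) order_refl)
    then obtain y :: "nat \<Rightarrow> real" where y: "\<And>i. i \<notin> ?D \<Longrightarrow> y i = 0" "\<And>A. A \<subseteq> ?D \<Longrightarrow> sum y A \<le> real (rk A)"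
      "\<And>k. k \<le> length (l1 @ l2) \<Longrightarrow> sum y (set (take k (l1 @ l2))) = real (rk (set (take k (l1 @ l2))))"
      unfolding l(2) by blast
    have yD: "sum y ?D = real (rk ?D)" using y(3)[of "length (l1 @ l2)"] l(2) by simp
    have "sum y (?D - A) = real (rk (?D - A))" using y(3)[of "length l1"] l1 by simp
    moreover have "sum y ?D = sum y (?D - A) + sum y A" using A(1) by (simp add: sum.subset_diff)
    moreover have "rk (A \<union> (?D - A)) + rk (A \<inter> (?D - A)) \<le> rk A + rk (?D - A)"
      using A(1) by (intro polymatroidD(5)[OF rk]) auto
    then have "rk ?D < rk A + rk (?D - A)"
      using nonsep[OF A] A(1) by (simp add: Un_absorb1 Diff_partition)
    then have "real (rk ?D) < real (rk A) + real (rk (?D - A))" by linarith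
    ultimately have "sum y A < real (rk A)" using yD by linarith
    moreover have "y \<in> ?Q" using y(1,2) yD by (simp add: base_polytope_def)
    ultimately show ?thesis by blast
  qed
  then obtain v where v: "\<And>A. A \<in> P \<Longrightarrow> v A \<in> ?Q" "\<And>A. A \<in> P \<Longrightarrow> sum (v A) A < real (rk A)" by metis
  \<comment> \<open>A proper nonempty set has slack at the vertex chosen for it and is never
    violated at the others, so the average has slack everywhere.\<close>
  define c where "c = (\<lambda>i. (\<Sum>A\<in>P. v A i) / real (card P))"
  have sum_c: "sum c B = (\<Sum>A\<in>P. sum (v A) B) / real (card P)" for B
    unfolding c_def sum_divide_distrib[symmetric] by (simp add: sum.swap[of _ B])
  have c_off: "c i = 0" if "i \<notin> ?D" for i
    unfolding c_def using v(1) that by (simp add: base_polytope_def)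
  have c_D: "sum c ?D = real (rk ?D)"
  proof -
    have "(\<Sum>A\<in>P. sum (v A) ?D) = (\<Sum>A\<in>P. real (rk ?D))"
      using v(1) by (intro sum.cong) (auto simp: base_polytope_def)
    then show ?thesis using cardP by (simp add: sum_c)
  qed
  have c_lt: "sum c B < real (rk B)" if B: "B \<in> P" for B
  proof -
    have "(\<Sum>A\<in>P. sum (v A) B) < (\<Sum>A\<in>P. real (rk B))"
    proof (rule sum_strict_mono_ex1[OF finP])
      show "\<forall>A\<in>P. sum (v A) B \<le> real (rk B)"
        using v(1) B by (auto simp: base_polytope_def P_def)
      show "\<exists>A\<in>P. sum (v A) B < real (rk B)" using v(2) B by blast
    qed
    then show ?thesis using cardP by (simp add: sum_c divide_less_eq mult.commute)
  qed
  define e where "e = Min ((\<lambda>B. real (rk B) - sum c B) ` P)"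
  have e_le: "e \<le> real (rk B) - sum c B" if "B \<in> P" for B
    unfolding e_def using finP that by (intro Min_le) auto
  have "e \<in> (\<lambda>B. real (rk B) - sum c B) ` P"
    unfolding e_def using finP \<open>{1} \<in> P\<close> by (intro Min_in) auto
  then have e_pos: "e > 0" using c_lt by auto
  have c_Q: "c \<in> ?Q"
  proof -
    have "sum c B \<le> real (rk B)" if "B \<subseteq> ?D" for B
    proof (cases "B \<in> P")
      case True
      then show ?thesis using c_lt by force
    next
      case False
      then have "B = {} \<or> B = ?D" using that by (auto simp: P_def)
      then show ?thesis using c_D by auto
    qed
    then show ?thesis using c_off c_D by (simp add: base_polytope_def)
  qed
  let ?diff = "{x - y | x y. x \<in> ?Q \<and> y \<in> ?Q}"
  let ?b = "(\<lambda>i. unit_difference i 1) ` (?D - {1})"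
  have b_diff: "unit_difference i 1 \<in> fun_space.span ?diff" if i: "i \<in> ?D - {1}" for i
  proof -
    \<comment> \<open>Moving from \<open>c\<close> by \<open>e\<close> in the direction e_i - e_1
      raises the sum over any set by at most the smallest slack and keeps the total.\<close>
    define x where "x = (\<lambda>j. c j + e * unit_difference i 1 j)"
    have sum_u: "sum (unit_difference i 1) B = of_bool (i \<in> B) - of_bool (1 \<in> B)" if "finite B" for B
      using that by (simp add: unit_difference_def sum_subtractf of_bool_def sum.delta)
    have sum_x: "sum x B = sum c B + e * (of_bool (i \<in> B) - of_bool (1 \<in> B))" if "finite B" for B
      using sum_u[OF that] by (simp add: x_def sum.distrib sum_distrib_left[symmetric])
    have "x \<in> ?Q"
    proof -
      have "sum x B \<le> real (rk B)" if B: "B \<subseteq> ?D" for B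
      proof (cases "B \<in> P")
        case True
        have "sum x B \<le> sum c B + e"
          using sum_x[of B] B e_pos by (auto simp: of_bool_def finite_subset)
        then show ?thesis using e_le[OF True] by linarith
      next
        case False
        then have "B = {} \<or> B = ?D" using B by (auto simp: P_def)
        then show ?thesis using c_D sum_x[of ?D] i d by auto
      qed
      moreover have "sum x ?D = real (rk ?D)" using c_D sum_x[of ?D] i d by auto
      moreover have "x j = 0" if "j \<notin> ?D" for j
        using c_off[OF that] that i d by (auto simp: x_def unit_difference_def)
      ultimately show ?thesis by (simp add: base_polytope_def)
    qed
    then have "x - c \<in> fun_space.span ?diff" using c_Q by (intro fun_space.span_base) blast
    then have "(\<lambda>j. (1 / e) * (x - c) j) \<in> fun_space.span ?diff" by (rule fun_space.span_scale)
    also have "(\<lambda>j. (1 / e) * (x - c) j) = unit_difference i 1" using e_pos by (auto simp: x_def)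
    finally show ?thesis .
  qed
  have diff_b: "x - y \<in> fun_space.span ?b" if "x \<in> ?Q" "y \<in> ?Q" for x y
  proof (rule zero_sum_in_span)
    show "(x - y) i = 0" if "i \<notin> ?D" for i using \<open>x \<in> ?Q\<close> \<open>y \<in> ?Q\<close> that by (simp add: base_polytope_def)
    show "sum (x - y) ?D = 0" using that by (simp add: base_polytope_def sum_subtractf)
  qed (use d in auto)
  have span: "fun_space.span ?b = fun_space.span ?diff"
  proof (rule antisym)
    show "fun_space.span ?b \<subseteq> fun_space.span ?diff"
      by (intro fun_space.span_minimal fun_space.subspace_span image_subsetI b_diff)
    show "fun_space.span ?diff \<subseteq> fun_space.span ?b"
      using diff_b by (intro fun_space.span_minimal fun_space.subspace_span) auto
  qed
  have eval: "unit_difference i 1 j = of_bool (j = i)" if "j \<noteq> 1" for i j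
    using that by (simp add: unit_difference_def)
  have inj: "inj_on (\<lambda>i. unit_difference i 1) (?D - {1})"
  proof (rule inj_onI)
    fix i j assume ij: "i \<in> ?D - {1}" "j \<in> ?D - {1}" "unit_difference i 1 = unit_difference j 1"
    then show "i = j" using eval[of i i] eval[of i j] by (metis DiffD2 insertI1 of_bool_eq_1_iff)
  qed
  have "fun_space.independent ?b"
  proof (rule fun_space.independent_if_scalars_zero)
    fix f x assume z: "(\<Sum>x\<in>?b. (\<lambda>i. f x * x i)) = 0" and x: "x \<in> ?b"
    from x obtain j where j: "j \<in> ?D - {1}" "x = unit_difference j 1" by (rule imageE)
    have "0 = (\<Sum>x\<in>?b. (\<lambda>i. f x * x i)) j" using z by simp
    also have "\<dots> = (\<Sum>i\<in>?D - {1}. f (unit_difference i 1) * unit_difference i 1 j)"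
      unfolding sum_fun_apply sum.reindex[OF inj] by simp
    also have "\<dots> = (\<Sum>i\<in>?D - {1}. if j = i then f (unit_difference i 1) else 0)"
    proof (rule sum.cong[OF refl])
      fix i
      show "f (unit_difference i 1) * unit_difference i 1 j = (if j = i then f (unit_difference i 1) else 0)"
        using eval[of j i] j(1) by auto
    qed
    also have "\<dots> = f x" using j by simp
    finally show "f x = 0" ..
  qed simp
  then have "fun_space.dim ?diff = card ?b" using span by (intro fun_space.dim_eq_card)
  also have "\<dots> = d - 1" unfolding card_image[OF inj] using d by simp
  finally show ?thesis by (simp add: affine_dimension_def)
qed

section \<open>Additive invariants\<close>

definition primitive_series :: "nc_series \<Rightarrow> bool" where
  "primitive_series a \<longleftrightarrow> a [] = 0 \<and> (\<forall>u v. u \<noteq> [] \<longrightarrow> v \<noteq> [] \<longrightarrow> shuffle_sum a u v = 0)"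

lemma shuffle_sum_nc_component:
  "shuffle_sum (nc_component d r a) u v =
    (if length u + length v = d \<and> sum_list u + sum_list v = r then shuffle_sum a u v else 0)"
proof -
  have "length w = length u + length v \<and> sum_list w = sum_list u + sum_list v" if "mset w = mset u + mset v" for w
    using arg_cong[OF that, of size] arg_cong[OF that, of sum_mset] by (simp add: sum_mset_sum_list)
  then have "shuffle_sum (nc_component d r a) u v =
      shuffle_sum (if length u + length v = d \<and> sum_list u + sum_list v = r then a else (\<lambda>_. 0)) u v"
    by (intro shuffle_sum_cong) (auto simp: nc_component_def)
  then show ?thesis by simp
qed

text \<open>Shuffling respects the bidegree, so primitivity may be tested on homogeneous components.
  The component of length 0 is treated apart because the Dynkin argument divides by the
  length.\<close>

lemma lie_series_iff_primitive:
  assumes a: "a \<in> carrier (nc_algebra J)"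
  shows "a \<in> lie_series J \<longleftrightarrow> primitive_series a"
proof
  assume "a \<in> lie_series J"
  then have "nc_component d r a [] = 0 \<and>
      (\<forall>u v. u \<noteq> [] \<longrightarrow> v \<noteq> [] \<longrightarrow> shuffle_sum (nc_component d r a) u v = 0)" for d r
    using lie_imp_primitive[of "nc_component d r a" J] by (simp add: lie_series_def)
  then show "primitive_series a"
    unfolding primitive_series_def shuffle_sum_nc_component
    by (metis list.size(3) nc_component_def sum_list.Nil)
next
  assume prim: "primitive_series a"
  have "nc_component d r a \<in> lie_polynomials J" for d r
  proof (cases "d = 0")
    case True
    then have "nc_component d r a = 0"
      using prim by (auto simp: nc_component_def primitive_series_def fun_eq_iff)
    then show ?thesis by (simp only: lie_polynomials.zero)
  next
    case False
    show ?thesis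
    proof (rule primitive_imp_lie)
      show "finite {w. nc_component d r a w \<noteq> 0}"
        by (rule finite_subset[OF _ finite_words_bidegree[of d r]]) (auto simp: nc_component_def split: if_splits)
      show "shuffle_sum (nc_component d r a) u v = 0" if "u \<noteq> []" "v \<noteq> []" for u v
        using prim that by (simp add: shuffle_sum_nc_component primitive_series_def)
      show "length w = d" if "nc_component d r a w \<noteq> 0" for w
        using that by (auto simp: nc_component_def split: if_splits)
      show "set w \<subseteq> J" if "nc_component d r a w \<noteq> 0" for w
        using that a by (auto simp: nc_component_def carrier_nc_algebra split: if_splits)
    qed (use False in simp)
  qed
  then show "a \<in> lie_series J" using a by (simp add: lie_series_def)
qed

section \<open>Direct sums of rank functions\<close>

definition direct_sum :: "nat \<Rightarrow> nat \<Rightarrow> rank_fun \<Rightarrow> rank_fun \<Rightarrow> rank_fun" where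
  "direct_sum d e rk rk' =
    restrict (\<lambda>S. rk (S \<inter> {1..d}) + rk' ((\<lambda>i. i - d) ` (S - {1..d}))) (Pow {1..d+e})"

lemma direct_sum_apply:
  "S \<subseteq> {1..d+e} \<Longrightarrow> direct_sum d e rk rk' S = rk (S \<inter> {1..d}) + rk' ((\<lambda>i. i - d) ` (S - {1..d}))"
  by (simp add: direct_sum_def)

lemma polymatroid_direct_sum:
  assumes rk: "polymatroid {1..d} rk" and rk': "polymatroid {1..e} rk'"
  shows "polymatroid {1..d+e} (direct_sum d e rk rk')"
proof -
  let ?\<tau> = "\<lambda>i. i - d"
  have sub: "?\<tau> ` (S - {1..d}) \<subseteq> {1..e}" if "S \<subseteq> {1..d+e}" for S
  proof (rule image_subsetI)
    fix i assume "i \<in> S - {1..d}"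
    then have "i \<in> {1..d+e}" "i \<notin> {1..d}" using that by auto
    then show "i - d \<in> {1..e}" by auto
  qed
  \<comment> \<open>Truncated subtraction sends the whole first block to 0; on the second block it
    is injective, which makes images commute with intersections.\<close>
  have inj: "inj_on ?\<tau> ({1..d+e} - {1..d})" by (rule inj_onI) auto
  show ?thesis
    unfolding polymatroid_def
  proof (intro conjI allI impI)
    fix S T assume ST: "S \<subseteq> T \<and> T \<subseteq> {1..d+e}"
    then have "rk (S \<inter> {1..d}) \<le> rk (T \<inter> {1..d})" by (intro polymatroidD(4)[OF rk]) auto
    moreover have "rk' (?\<tau> ` (S - {1..d})) \<le> rk' (?\<tau> ` (T - {1..d}))"
      using ST by (intro polymatroidD(4)[OF rk'] image_mono sub) auto
    ultimately show "direct_sum d e rk rk' S \<le> direct_sum d e rk rk' T"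
      using ST by (auto simp: direct_sum_def)
  next
    fix S T assume ST: "S \<subseteq> {1..d+e} \<and> T \<subseteq> {1..d+e}"
    have "rk ((S \<inter> {1..d}) \<union> (T \<inter> {1..d})) + rk ((S \<inter> {1..d}) \<inter> (T \<inter> {1..d})) \<le>
        rk (S \<inter> {1..d}) + rk (T \<inter> {1..d})" by (intro polymatroidD(5)[OF rk]) auto
    moreover have "(S \<union> T) \<inter> {1..d} = (S \<inter> {1..d}) \<union> (T \<inter> {1..d})"
      "(S \<inter> T) \<inter> {1..d} = (S \<inter> {1..d}) \<inter> (T \<inter> {1..d})" by auto
    moreover have "rk' (?\<tau> ` (S - {1..d}) \<union> ?\<tau> ` (T - {1..d})) + rk' (?\<tau> ` (S - {1..d}) \<inter> ?\<tau> ` (T - {1..d})) \<le>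
        rk' (?\<tau> ` (S - {1..d})) + rk' (?\<tau> ` (T - {1..d}))"
      using ST by (intro polymatroidD(5)[OF rk'] sub) auto
    moreover have "?\<tau> ` ((S \<union> T) - {1..d}) = ?\<tau> ` (S - {1..d}) \<union> ?\<tau> ` (T - {1..d})" by auto
    moreover have "?\<tau> ` ((S \<inter> T) - {1..d}) = ?\<tau> ` (S - {1..d}) \<inter> ?\<tau> ` (T - {1..d})"
      unfolding Diff_Int_distrib2 using ST by (subst inj_on_image_Int[OF inj, symmetric]) (auto intro!: arg_cong[of _ _ "image ?\<tau>"])
    moreover have "S \<union> T \<subseteq> {1..d+e}" "S \<inter> T \<subseteq> {1..d+e}" using ST by auto
    ultimately show "direct_sum d e rk rk' (S \<union> T) + direct_sum d e rk rk' (S \<inter> T) \<le>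
        direct_sum d e rk rk' S + direct_sum d e rk rk' T"
      using ST unfolding direct_sum_def by (simp only: restrict_apply Pow_iff if_True)
  qed (use polymatroidD(2)[OF rk] polymatroidD(2)[OF rk'] in \<open>auto simp: direct_sum_def\<close>)
qed

context singleton_rank_class
begin

lemma direct_sum_of_bidegree:
  assumes "rk \<in> of_bidegree K d r" "rk' \<in> of_bidegree K e s"
  shows "direct_sum d e rk rk' \<in> of_bidegree K (d + e) (r + s)"
    and "direct_sum d e rk rk' {1..d} = r"
    and "direct_sum d e rk rk' ({1..d+e} - {1..d}) = s"
    and "\<And>S. S \<subseteq> {1..d} \<Longrightarrow> direct_sum d e rk rk' S = rk S"
    and "\<And>S. S \<subseteq> {1..e} \<Longrightarrow> direct_sum d e rk rk' ((\<lambda>i. i + d) ` S) = rk' S"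
proof -
  note rk = of_bidegreeD[OF singleton_rank_class_axioms assms(1)] and rk' = of_bidegreeD[OF singleton_rank_class_axioms assms(2)]
  show left: "direct_sum d e rk rk' S = rk S" if "S \<subseteq> {1..d}" for S
  proof -
    have "S \<inter> {1..d} = S" "S - {1..d} = {}" "S \<subseteq> {1..d+e}" using that by auto
    then show ?thesis using polymatroidD(2)[OF rk'(1)] by (simp only: direct_sum_apply) simp
  qed
  show right: "direct_sum d e rk rk' ((\<lambda>i. i + d) ` S) = rk' S" if S: "S \<subseteq> {1..e}" for S
  proof -
    have 1: "(\<lambda>i. i + d) ` S \<inter> {1..d} = {}" "(\<lambda>i. i + d) ` S \<subseteq> {1..d+e}" using S by auto
    have 2: "(\<lambda>i. i - d) ` ((\<lambda>i. i + d) ` S - {1..d}) = S"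
      unfolding Diff_triv[OF 1(1)] by (simp add: image_image)
    show ?thesis unfolding direct_sum_apply[OF 1(2)] 1(1) 2 using polymatroidD(2)[OF rk(1)] by simp
  qed
  show top1: "direct_sum d e rk rk' {1..d} = r" using left[of "{1..d}"] rk(2) by simp
  have im: "(\<lambda>i. i + d) ` {1..e} = {1..d+e} - {1..d}"
  proof
    show "{1..d+e} - {1..d} \<subseteq> (\<lambda>i. i + d) ` {1..e}"
    proof
      fix i assume "i \<in> {1..d+e} - {1..d}"
      then have "i = (i - d) + d" "i - d \<in> {1..e}" by auto
      then show "i \<in> (\<lambda>i. i + d) ` {1..e}" by blast
    qed
  qed auto
  show top2: "direct_sum d e rk rk' ({1..d+e} - {1..d}) = s" using right[of "{1..e}"] rk'(2) im by simp
  have "direct_sum d e rk rk' {i} \<in> J" if i: "i \<in> {1..d+e}" for i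
  proof (cases "i \<in> {1..d}")
    case True
    then show ?thesis using left[of "{i}"] rk(3) by simp
  next
    case False
    then have "i \<in> (\<lambda>i. i + d) ` {1..e}" using i im by auto
    then obtain k where "k \<in> {1..e}" "i = k + d" by blast
    then show ?thesis using right[of "{k}"] rk'(3)[of k] by simp
  qed
  moreover have "direct_sum d e rk rk' {1..d+e} = r + s"
  proof -
    have "rk ({1..d+e} \<inter> {1..d}) = r" using rk(2) by (simp add: Int_absorb1)
    moreover have "rk' ((\<lambda>i. i - d) ` ({1..d+e} - {1..d})) = s"
      unfolding im[symmetric] using rk'(2) by (simp only: image_image) simp
    ultimately show ?thesis by (simp only: direct_sum_apply order_refl)
  qed
  ultimately show "direct_sum d e rk rk' \<in> of_bidegree K (d + e) (r + s)"
    using polymatroid_direct_sum[OF rk(1) rk'(1)] by (simp add: of_bidegree_def K_iff)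
qed

text \<open>The iterated form, with one variable word per summand, is what allows independence of
  flag sums to be applied to each summand separately.\<close>

lemma flag_sum_direct_sum:
  assumes rk: "rk \<in> of_bidegree K d r" and rk': "rk' \<in> of_bidegree K e s"
  shows "flag_sum (direct_sum d e rk rk') {} {1..d+e} a =
    flag_sum rk {} {1..d} (\<lambda>u. flag_sum rk' {} {1..e} (shuffle_sum a u))"
proof -
  let ?R = "direct_sum d e rk rk'" and ?B = "{1..d+e} - {1..d}"
  note ds = direct_sum_of_bidegree[OF rk rk']
  note R = of_bidegreeD[OF singleton_rank_class_axioms ds(1)]
  have inner: "flag_sum ?R {} ?B h = flag_sum rk' {} {1..e} h" for h
  proof (rule flag_sum_transport[where \<beta> = "\<lambda>i. i + d" and c = 0 and c' = 0])
    show "bij_betw (\<lambda>i. i + d) {1..e} ?B"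
      by (rule bij_betw_byWitness[where f' = "\<lambda>i. i - d"]) auto
  qed (use ds(5) in simp)
  have outer: "flag_sum ?R {} {1..d} h = flag_sum rk {} {1..d} h" for h
    by (rule flag_sum_transport[where \<beta> = id and c = 0 and c' = 0]) (use ds(4) in auto)
  have sep: "?R {1..d} + ?R ?B = ?R {1..d+e}" using ds(2,3) R(2) by simp
  have "flag_sum ?R {} {1..d+e} a = (\<Sum>l1\<in>permutations_of_set {1..d}. \<Sum>l2\<in>permutations_of_set ?B.
      shuffle_sum a (jumps ?R {} l1) (jumps ?R {} l2))"
    by (rule flag_sum_separable[OF R(1) _ sep]) simp
  also have "\<dots> = flag_sum ?R {} {1..d} (\<lambda>u. flag_sum ?R {} ?B (shuffle_sum a u))"
    by (simp only: flag_sum_def)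
  finally have "flag_sum ?R {} {1..d+e} a = flag_sum ?R {} {1..d} (\<lambda>u. flag_sum ?R {} ?B (shuffle_sum a u))" .
  then show ?thesis unfolding inner outer .
qed

text \<open>If the dimension drops, the rank function splits and its flag sum consists of shuffle
  sums of two nonempty words, which primitivity kills. Conversely, additivity is evaluated on all
  direct sums of two nonempty rank functions, and independence of flag sums isolates the single
  shuffle sums.\<close>

lemma additive_iff_primitive:
  assumes a: "a \<in> carrier (nc_algebra J)"
  shows "flag_invariant K a \<in> additive_invariants K \<longleftrightarrow> primitive_series a"
proof
  assume prim: "primitive_series a"
  have "flag_invariant K a d r rk = 0"
    if rk: "rk \<in> of_bidegree K d r" and dim: "int (affine_dimension (base_polytope d rk)) < int d - 1" for d r rk
  proof -
    note rk' = of_bidegreeD[OF singleton_rank_class_axioms rk]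
    \<comment> \<open>The dimension is a natural number, so the integer bound excludes d = 0 and d =
      1.\<close>
    have d: "d \<ge> 2" using dim by simp
    have "affine_dimension (base_polytope d rk) \<noteq> d - 1" using dim d by linarith
    then obtain A where A: "A \<subseteq> {1..d}" "A \<noteq> {}" "A \<noteq> {1..d}" "rk A + rk ({1..d} - A) = rk {1..d}"
      using affine_dimension_nonseparable[OF rk'(1) d] by blast
    have "flag_sum rk {} {1..d} a = (\<Sum>l1\<in>permutations_of_set A. \<Sum>l2\<in>permutations_of_set ({1..d} - A).
        shuffle_sum a (jumps rk {} l1) (jumps rk {} l2))"
      by (rule flag_sum_separable[OF rk'(1) A(1,4)])
    also have "\<dots> = 0"
    proof (intro sum.neutral ballI)
      fix l1 l2 assume l: "l1 \<in> permutations_of_set A" "l2 \<in> permutations_of_set ({1..d} - A)"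
      have "set l1 = A" "set l2 = {1..d} - A" using permutations_of_setD(1)[OF l(1)] permutations_of_setD(1)[OF l(2)] .
      moreover have "{1..d} - A \<noteq> {}" using A(1,3) by blast
      ultimately have "length l1 \<noteq> 0" "length l2 \<noteq> 0" using A(2) by (metis length_0_conv set_empty2)+
      then have "jumps rk {} l1 \<noteq> []" "jumps rk {} l2 \<noteq> []" by (metis length_0_conv length_jumps)+
      then show "shuffle_sum a (jumps rk {} l1) (jumps rk {} l2) = 0" using prim by (simp add: primitive_series_def)
    qed
    finally show ?thesis by (simp add: flag_invariant_def)
  qed
  moreover have "flag_invariant K a 0 0 rk = 0" for rk
    using prim by (simp add: flag_invariant_def flag_sum_def primitive_series_def)
  then have "flag_invariant K a 0 0 = 0" by auto
  ultimately show "flag_invariant K a \<in> additive_invariants K"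
    unfolding additive_invariants_def using flag_invariant_carrier by blast
next
  assume add: "flag_invariant K a \<in> additive_invariants K"
  \<comment> \<open>The rank function on the empty ground set detects the constant term.\<close>
  define rk0 :: rank_fun where "rk0 = restrict (\<lambda>_. 0) (Pow {1..0})"
  have "rk0 \<in> of_bidegree K 0 0"
    by (auto simp: rk0_def of_bidegree_def K_iff polymatroid_def)
  moreover have "flag_invariant K a 0 0 rk0 = 0" using add by (simp add: additive_invariants_def)
  ultimately have "a [] = 0" by (simp add: flag_invariant_def flag_sum_def)
  moreover have "shuffle_sum a u v = 0" if uv: "u \<noteq> []" "v \<noteq> []" for u v
  proof (cases "set u \<subseteq> J \<and> set v \<subseteq> J")
    case True
    let ?d = "length u" and ?e = "length v" and ?r = "sum_list u" and ?s = "sum_list v"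
    have zero: "flag_sum rk {} {1..?d} (\<lambda>u. flag_sum rk' {} {1..?e} (shuffle_sum a u)) = 0"
      if rk: "rk \<in> of_bidegree K ?d ?r" and rk': "rk' \<in> of_bidegree K ?e ?s" for rk rk'
    proof -
      let ?R = "direct_sum ?d ?e rk rk'"
      note ds = direct_sum_of_bidegree[OF rk rk']
      have "affine_dimension (base_polytope (?d + ?e) ?R) + 2 \<le> ?d + ?e"
      proof (rule affine_dimension_separable[of "{1..?d}"])
        show "{1..?d} \<noteq> {}" using uv by (simp add: Suc_le_eq)
        have "?d + ?e \<in> {1..?d + ?e}" "?d + ?e \<notin> {1..?d}" using uv by (simp_all add: Suc_le_eq)
        then show "{1..?d} \<noteq> {1..?d + ?e}" by blast
        show "?R {1..?d} + ?R ({1..?d + ?e} - {1..?d}) = ?R {1..?d + ?e}"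
          using ds(2,3) of_bidegreeD(2)[OF singleton_rank_class_axioms ds(1)] by simp
      qed auto
      then have "int (affine_dimension (base_polytope (?d + ?e) ?R)) < int (?d + ?e) - 1" by linarith
      then have "flag_invariant K a (?d + ?e) (?r + ?s) ?R = 0"
        using add ds(1) unfolding additive_invariants_def by blast
      then show ?thesis using ds(1) flag_sum_direct_sum[OF rk rk'] by (simp add: flag_invariant_def)
    qed
    \<comment> \<open>Independence is used twice: with \<open>rk'\<close> fixed it removes the flags
      of the first summand, and afterwards those of the second.\<close>
    have "flag_sum rk' {} {1..?e} (shuffle_sum a u) = 0" if "rk' \<in> of_bidegree K ?e ?s" for rk'
      using flag_sum_independent[of ?d ?r "\<lambda>u. flag_sum rk' {} {1..?e} (shuffle_sum a u)" u] zero[OF _ that] True by blast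
    then show ?thesis using flag_sum_independent[of ?e ?s "shuffle_sum a u" v] True by blast
  next
    case False
    have "a w = 0" if "mset w = mset u + mset v" for w
    proof -
      have "set w = set u \<union> set v" using arg_cong[OF that, of set_mset] by simp
      then have "\<not> set w \<subseteq> J" using False by auto
      then show ?thesis using a unfolding carrier_nc_algebra by blast
    qed
    then have "shuffle_sum a u v = shuffle_sum (\<lambda>_. 0) u v" by (intro shuffle_sum_cong)
    then show ?thesis by simp
  qed
  ultimately show "primitive_series a" by (simp add: primitive_series_def)
qed

lemma flag_coefficients_additive: "flag_coefficients ` additive_invariants K = lie_series J"
proof
  show "flag_coefficients ` additive_invariants K \<subseteq> lie_series J"
  proof (rule image_subsetI)
    fix F assume F: "F \<in> additive_invariants K"
    then have "F \<in> carrier (invariant_algebra K)" by (simp add: additive_invariants_def)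
    then obtain a where a: "a \<in> carrier (nc_algebra J)" "flag_invariant K a = F" using flag_invariant_surj by blast
    then have "a \<in> lie_series J"
      using F additive_iff_primitive[OF a(1)] lie_series_iff_primitive[OF a(1)] by blast
    then show "flag_coefficients F \<in> lie_series J" using flag_coefficients_flag_invariant[OF a(1)] a(2) by simp
  qed
  show "lie_series J \<subseteq> flag_coefficients ` additive_invariants K"
  proof
    fix a assume "a \<in> lie_series J"
    moreover from this have a: "a \<in> carrier (nc_algebra J)" by (simp add: lie_series_def)
    ultimately have "flag_invariant K a \<in> additive_invariants K"
      using additive_iff_primitive[OF a] lie_series_iff_primitive[OF a] by blast
    then show "a \<in> flag_coefficients ` additive_invariants K"
      using flag_coefficients_flag_invariant[OF a] by (metis imageI)
  qed
qed

lemma exists_bigraded_iso: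
  "\<exists>\<Phi>. (bigraded_algebra_iso K J \<Phi> \<and> (\<forall>i\<in>J. \<Phi> (u_invariant K i) = nc_monomial [i])) \<and>
    \<Phi> ` additive_invariants K = lie_series J"
  using bigraded_algebra_iso_flag_coefficients flag_coefficients_generator flag_coefficients_additive by blast

end

theorem theorem1p6:
  shows "\<exists>\<Phi>\<^sub>M \<Phi>\<^sub>P\<^sub>M.
    (bigraded_algebra_iso matroid {0, 1} \<Phi>\<^sub>M \<and>
       (\<forall>i\<in>{0, 1}. \<Phi>\<^sub>M (u_invariant matroid i) = nc_monomial [i])) \<and>
    (bigraded_algebra_iso polymatroid UNIV \<Phi>\<^sub>P\<^sub>M \<and>
       (\<forall>i. \<Phi>\<^sub>P\<^sub>M (u_invariant polymatroid i) = nc_monomial [i])) \<and>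
    \<Phi>\<^sub>M ` additive_invariants matroid = lie_series {0, 1} \<and>
    \<Phi>\<^sub>P\<^sub>M ` additive_invariants polymatroid = lie_series UNIV"
proof -
  have le_1: "n \<le> 1 \<longleftrightarrow> n \<in> {0, 1}" for n :: nat by auto
  interpret M: singleton_rank_class matroid "{0, 1}"
    by unfold_locales (auto simp: matroid_def le_1)
  interpret P: singleton_rank_class polymatroid UNIV
    by unfold_locales auto
  from M.exists_bigraded_iso P.exists_bigraded_iso show ?thesis by blast
qed

end
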